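(* Let $F_1,F_2$ be two symmetric probability distributions on $\mathbb{R}$ having bounded continuous densities $f_1,f_2$ such that $$\lim_{x\to\infty}\frac{f_1(x)}{f_2(x)}=K$$ for some finite non-zero $K$. Let $\phi$ be the standard Gaussian density, let $h_r=f_r/\phi$ for $r=1,2$, let $X_1,X_2,\ldots$ be independent standard Gaussian random variables, and suppose that the distribution of $h_1(X_1)$ belongs to the Cauchy domain of attraction. For $r=1,2$, let $\hat\theta_{r,n}$ be the maximum-likelihood estimator of $\theta\in[0,1]$ based on $X_1,\ldots,X_n$ in the mixture model with density $(1-\theta)\phi+\theta f_r$, and let $\Lambda_{r,n}=2\sum_{i=1}^n\log\bigl(1+\hat\theta_{r,n}(h_r(X_i)-1)\bigr)$ be the corresponding likelihood-ratio statistic for testing $\theta=0$. Then, for every $\epsilon>0$, $$\lim_{n\to\infty}\mathbb{P}_0\bigl(|\Lambda_{1,n}-\Lambda_{2,n}|>\epsilon\ \big|\ \hat\theta_{1,n}>0\bigr)=0.$$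
   Context: $\mathbb{P}_0$ denotes probability when $X_1,\ldots,X_n$ are i.i.d. standard Gaussian. The maximum-likelihood estimator maximizes $\sum_{i=1}^n\log\{(1-\theta)\phi(X_i)+\theta f_r(X_i)\}$ over $\theta\in[0,1]$. The Cauchy domain of attraction (for a nonnegative random variable) is the domain of attraction of the maximally skew stable law with index $\alpha=1$, having log characteristic function $\log\psi(t)=-|t|-2it\log|t|/\pi$: for i.i.d. copies $Y_i$ there exist deterministic $A_n\in\mathbb{R}$, $B_n>0$ such that $B_n^{-1}\sum_{i=1}^nY_i-A_n$ converges in distribution to this law. *)

theory Defs
  imports "HOL-Probability.Probability"
begin

definition symmetric_distribution :: "real measure \<Rightarrow> bool" where
  "symmetric_distribution F \<longleftrightarrow> real_distribution F \<and> distr F borel uminus = F"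

definition has_bounded_continuous_density :: "real measure \<Rightarrow> (real \<Rightarrow> real) \<Rightarrow> bool" where
  "has_bounded_continuous_density F f \<longleftrightarrow>
     (\<forall>x. 0 \<le> f x) \<and> bounded (range f) \<and> continuous_on UNIV f \<and> F = density lborel f"

text \<open>The maximally skew stable law with index 1; at \<open>t = 0\<close> the exponent is 0, since \<open>0 * ln 0 = 0\<close>.\<close>

definition skew_cauchy_law :: "real measure \<Rightarrow> bool" where
  "skew_cauchy_law S \<longleftrightarrow> real_distribution S \<and>
     (\<forall>t. char S t = exp (- complex_of_real \<bar>t\<bar>
            - 2 * \<i> * complex_of_real t * complex_of_real (ln \<bar>t\<bar>) / complex_of_real pi))"

text \<open>The i.i.d. copies are the coordinates on the infinite product of \<open>\<mu>\<close>; only their joint law matters.\<close>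

definition cauchy_domain_of_attraction :: "real measure \<Rightarrow> bool" where
  "cauchy_domain_of_attraction \<mu> \<longleftrightarrow> real_distribution \<mu> \<and> (AE y in \<mu>. 0 \<le> y) \<and>
     (\<exists>S (A :: nat \<Rightarrow> real) (B :: nat \<Rightarrow> real). skew_cauchy_law S \<and> (\<forall>n. 0 < B n) \<and>
        weak_conv_m
          (\<lambda>n. distr (Pi\<^sub>M (UNIV :: nat set) (\<lambda>_. \<mu>)) borel (\<lambda>y. (\<Sum>i<n. y i) / B n - A n)) S)"

abbreviation normal_ratio :: "(real \<Rightarrow> real) \<Rightarrow> real \<Rightarrow> real" where
  "normal_ratio f x \<equiv> f x / std_normal_density x"

text \<open>In HOL \<open>ln 0 = 0\<close>. The mixture density can vanish at \<open>\<theta> = 1\<close>, where the log-likelihood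
  has to be \<open>-\<infinity>\<close>.\<close>

definition ereal_log :: "real \<Rightarrow> ereal" where
  "ereal_log u = (if 0 < u then ereal (ln u) else - \<infinity>)"

definition mixture_loglik :: "(real \<Rightarrow> real) \<Rightarrow> nat \<Rightarrow> (nat \<Rightarrow> real) \<Rightarrow> real \<Rightarrow> ereal" where
  "mixture_loglik f n x \<theta> = (\<Sum>i<n. ereal_log ((1 - \<theta>) * std_normal_density (x i) + \<theta> * f (x i)))"

definition is_mixture_mle :: "(real \<Rightarrow> real) \<Rightarrow> nat \<Rightarrow> (nat \<Rightarrow> real) \<Rightarrow> real \<Rightarrow> bool" where
  "is_mixture_mle f n x \<theta> \<longleftrightarrow> is_arg_max (mixture_loglik f n x) (\<lambda>\<theta>. \<theta> \<in> {0..1}) \<theta>"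

text \<open>At a maximizer the arguments of \<open>ln\<close> are positive, because the likelihood is positive at
  \<open>\<theta> = 0\<close>.\<close>

definition lr_statistic :: "(real \<Rightarrow> real) \<Rightarrow> nat \<Rightarrow> (nat \<Rightarrow> real) \<Rightarrow> real \<Rightarrow> real" where
  "lr_statistic f n x \<theta> = 2 * (\<Sum>i<n. ln (1 + \<theta> * (normal_ratio f (x i) - 1)))"

end

theory Submission
  imports Defs
begin

text \<open>
Write \<open>Y = h\<^sub>1 X\<close> and \<open>Z = h\<^sub>2 X\<close>. Both variables have mean 1, and the log-likelihood ratio
\<open>\<Sum> ln (1 + \<theta> (Y\<^sub>i - 1))\<close> is concave in \<open>\<theta>\<close> with slope \<open>\<Sum> (Y\<^sub>i - 1)\<close> at 0. Hence the estimator
is positive as soon as \<open>\<Sum> Y\<^sub>i\<close> exceeds \<open>n\<close>, and otherwise the statistic is 0. The event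
\<open>\<Sum> Y\<^sub>i > n\<close> is rare, and the whole matter is to see how it arises.

In the Cauchy domain of attraction the mean excess \<open>E (Y - y)\<^sup>+\<close> is of larger order than
\<open>y P(Y > y)\<close> (\<open>cauchy_domain_tail\<close>). Let \<open>b\<^sub>n\<close> solve \<open>n E (Y - b\<^sub>n)\<^sup>+ = b\<^sub>n\<close> and put
\<open>\<tau>\<^sub>n = n P(Y > b\<^sub>n)\<close>, which tends to 0. The observations below \<open>b\<^sub>n\<close> add up to \<open>n - b\<^sub>n\<close> with an
error \<open>o(b\<^sub>n)\<close>, by Chebyshev's inequality. So the sum passes \<open>n\<close> by one jump of order \<open>b\<^sub>n\<close>, at a
cost of order \<open>\<tau>\<^sub>n\<close> (\<open>prob_sum_exceeds_lower\<close>), while doing so with steps below \<open>b\<^sub>n / 2\<close> has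
probability \<open>o(\<tau>\<^sub>n)\<close>, by a Chernoff bound (\<open>no_jump_negligible\<close>).

Suppose that observation \<open>i\<close> is the jump and that the others behave regularly. At
\<open>\<theta> = u / b\<^sub>n\<close> the others contribute about \<open>- u\<close> to the log-likelihood ratio, which is therefore close to
\<open>ln (1 + u s) - u\<close> with \<open>s = (Y\<^sub>i - 1) / b\<^sub>n\<close>; its maximum lies in \<open>u \<le> 2\<close>, and it depends on the sample
through \<open>s\<close> alone (\<open>log_ratio_profile\<close>, \<open>log_ratio_maximum_near_zero\<close>). For \<open>Z\<close> the same analysis
applies with the scale \<open>b\<^sub>n / K\<close> (\<open>jump_scale_transfer\<close>). As \<open>f\<^sub>1 / f\<^sub>2\<close> tends to \<open>K\<close>, a large \<open>Y\<^sub>i\<close> is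
close to \<open>K Z\<^sub>i\<close>, so both statistics see the same \<open>s\<close> and nearly agree (\<open>lr_statistics_close\<close>).
Consequently the statistics differ by more than \<open>\<epsilon>\<close> only on an event of unconditional probability
\<open>o(\<tau>\<^sub>n)\<close> (\<open>exceptional_negligible\<close>), and dividing by \<open>P(\<theta> > 0)\<close>, which is at least \<open>c \<tau>\<^sub>n\<close>, gives
the theorem.

The tail estimates come from the modulus of the characteristic function. The \<open>n\<close>-th power of the
modulus converges to \<open>exp (- \<bar>u\<bar>)\<close>, so the truncated second moment \<open>E min(1, (s Y)\<^sup>2)\<close> is of order \<open>s\<close>
along the normalizing sequence (\<open>cauchy_domain_trunc2\<close>); up to constants it then varies regularly
with index 1, and the tail of \<open>Y\<close> inherits this.
\<close>

section \<open>Characteristic functions of a weakly convergent sequence\<close>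

lemma cmod_iexp_diff_le: "cmod (iexp x - iexp y) \<le> min 2 \<bar>x - y\<bar>"
proof -
  have e: "iexp x = iexp y * iexp (x - y)"
    by (simp flip: exp_add add: algebra_simps)
  have "cmod (iexp x - iexp y) = cmod (iexp y * (iexp (x - y) - 1))"
    unfolding e by (simp add: algebra_simps)
  also have "\<dots> = cmod (iexp (x - y) - 1)"
    by (simp add: norm_mult)
  also have "\<dots> \<le> \<bar>x - y\<bar>"
    using iexp_approx1[of "x - y" 0] by simp
  finally have 1: "cmod (iexp x - iexp y) \<le> \<bar>x - y\<bar>" .
  have "cmod (iexp x - iexp y) \<le> cmod (iexp x) + cmod (iexp y)"
    by (rule norm_triangle_ineq4)
  then have "cmod (iexp x - iexp y) \<le> 2" by simp
  with 1 show ?thesis by simp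
qed

text \<open>In a Skorohod coupling \<open>E min(2, t \<bar>Z\<^sub>n - Y\<bar>)\<close> bounds the difference of the characteristic functions
at all frequencies up to \<open>t\<close> at once, and it tends to 0 by dominated convergence.\<close>

lemma weak_conv_char_uniform:
  fixes \<mu> :: "nat \<Rightarrow> real measure"
  assumes \<mu>: "\<And>n. real_distribution (\<mu> n)" and S: "real_distribution S"
    and conv: "weak_conv_m \<mu> S" and "0 < \<epsilon>"
  shows "\<forall>\<^sub>F n in sequentially. \<forall>u. \<bar>u\<bar> \<le> t \<longrightarrow> cmod (char (\<mu> n) u - char S u) \<le> \<epsilon>"
proof -
  obtain \<Omega> :: "real measure" and Z :: "nat \<Rightarrow> real \<Rightarrow> real" and Y :: "real \<Rightarrow> real" where
    "prob_space \<Omega>" and Z[measurable]: "\<And>n. Z n \<in> borel_measurable \<Omega>"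
    and dZ: "\<And>n. distr \<Omega> borel (Z n) = \<mu> n" and Y[measurable]: "Y \<in> borel_measurable \<Omega>"
    and dY: "distr \<Omega> borel Y = S" and ZY: "\<And>x. x \<in> space \<Omega> \<Longrightarrow> (\<lambda>n. Z n x) \<longlonglongrightarrow> Y x"
    using Skorohod[OF \<mu> S conv] by force
  interpret prob_space \<Omega> by fact
  let ?d = "\<lambda>n x. min 2 (\<bar>t\<bar> * \<bar>Z n x - Y x\<bar>)"
  have "(\<lambda>n. \<integral>x. ?d n x \<partial>\<Omega>) \<longlonglongrightarrow> (\<integral>x. 0 \<partial>\<Omega>)"
  proof (rule integral_dominated_convergence[where w = "\<lambda>_. 2"])
    show "AE x in \<Omega>. (\<lambda>n. ?d n x) \<longlonglongrightarrow> 0"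
    proof (rule AE_I2)
      fix x assume "x \<in> space \<Omega>"
      then have "(\<lambda>n. min 2 (\<bar>t\<bar> * \<bar>Z n x - Y x\<bar>)) \<longlonglongrightarrow> min 2 (\<bar>t\<bar> * \<bar>Y x - Y x\<bar>)"
        by (intro tendsto_intros ZY)
      then show "(\<lambda>n. ?d n x) \<longlonglongrightarrow> 0" by simp
    qed
  qed auto
  then have "\<forall>\<^sub>F n in sequentially. (\<integral>x. ?d n x \<partial>\<Omega>) < \<epsilon>"
    using \<open>0 < \<epsilon>\<close> by (auto intro: order_tendstoD)
  then show ?thesis
  proof eventually_elim
    case (elim n)
    show ?case
    proof (intro allI impI)
      fix u assume u: "\<bar>u\<bar> \<le> t"
      have int: "integrable \<Omega> (\<lambda>x. iexp (u * Z n x))" "integrable \<Omega> (\<lambda>x. iexp (u * Y x))"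
        by (rule integrable_iexp; simp)+
      have "char (\<mu> n) u - char S u = (CLINT x|\<Omega>. iexp (u * Z n x) - iexp (u * Y x))"
        unfolding dZ[symmetric] dY[symmetric] char_def
        using int by (simp add: integral_distr)
      also have "cmod \<dots> \<le> (\<integral>x. cmod (iexp (u * Z n x) - iexp (u * Y x)) \<partial>\<Omega>)"
        by (rule integral_norm_bound)
      also have "\<dots> \<le> (\<integral>x. ?d n x \<partial>\<Omega>)"
      proof (rule integral_mono)
        show "integrable \<Omega> (\<lambda>x. cmod (iexp (u * Z n x) - iexp (u * Y x)))"
          using int by (intro integrable_norm Bochner_Integration.integrable_diff)
        show "integrable \<Omega> (?d n)"
          by (rule integrable_const_bound[where B = 2]) auto
        fix x
        have "cmod (iexp (u * Z n x) - iexp (u * Y x)) \<le> min 2 \<bar>u * Z n x - u * Y x\<bar>"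
          by (rule cmod_iexp_diff_le)
        also have "\<dots> = min 2 (\<bar>u\<bar> * \<bar>Z n x - Y x\<bar>)"
          by (simp add: abs_mult flip: right_diff_distrib)
        also have "\<dots> \<le> ?d n x"
          using u by (intro min.mono order.refl mult_right_mono) auto
        finally show "cmod (iexp (u * Z n x) - iexp (u * Y x)) \<le> ?d n x" .
      qed
      also have "\<dots> \<le> \<epsilon>" using elim by simp
      finally show "cmod (char (\<mu> n) u - char S u) \<le> \<epsilon>" .
    qed
  qed
qed

section \<open>Truncated second moments\<close>

lemma one_minus_cos_le: "1 - cos x \<le> 2 * min 1 (x\<^sup>2)" for x :: real
proof -
  have "\<bar>sin (x / 2)\<bar> \<le> \<bar>x / 2\<bar>" by (rule abs_sin_x_le_abs_x)
  then have "(sin (x / 2))\<^sup>2 \<le> (x / 2)\<^sup>2" unfolding abs_le_square_iff .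
  moreover have "1 - cos x = 2 * (sin (x / 2))\<^sup>2"
    using cos_double_sin[of "x / 2"] by simp
  ultimately have "1 - cos x \<le> x\<^sup>2 / 2" by (simp add: power2_eq_square)
  moreover have "x\<^sup>2 / 2 \<le> 2 * x\<^sup>2" by simp
  moreover have "1 - cos x \<le> 2" using cos_ge_minus_one[of x] by simp
  moreover have "0 \<le> x\<^sup>2" by simp
  ultimately show ?thesis unfolding min_def by (smt (verit))
qed

text \<open>The function \<open>1 - sin x / x\<close> is the average of \<open>1 - cos (u x)\<close> over \<open>u\<close> in the unit interval. Averaging
removes the zeros of \<open>1 - cos\<close> away from the origin, which leaves a bound from below by \<open>min 1 (x\<^sup>2)\<close>.\<close>

lemma one_minus_sinc_ge:
  fixes x :: real
  assumes "0 < x"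
  shows "min 1 (x\<^sup>2) / 10 \<le> 1 - sin x / x"
proof (cases "x \<le> 2")
  case True
  have e: "(\<Sum>m<5. sin_coeff m * x ^ m) = x - x ^ 3 / 6"
  proof -
    have "{..<5::nat} = {0, 1, 2, 3, 4}" by auto
    then show ?thesis by (simp add: sin_coeff_def fact_numeral)
  qed
  have "\<bar>sin x - (x - x ^ 3 / 6)\<bar> \<le> x ^ 5 / 120"
    using Maclaurin_sin_bound[of x 5] \<open>0 < x\<close> unfolding e by (simp add: fact_numeral field_simps)
  then have "sin x \<le> x - x ^ 3 / 6 + x ^ 5 / 120" by linarith
  then have "sin x / x \<le> (x - x ^ 3 / 6 + x ^ 5 / 120) / x"
    using \<open>0 < x\<close> by (intro divide_right_mono) auto
  also have "\<dots> = 1 - x\<^sup>2 / 6 + x\<^sup>2 * x\<^sup>2 / 120"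
    using \<open>0 < x\<close> by (simp add: field_simps eval_nat_numeral)
  also have "x\<^sup>2 * x\<^sup>2 \<le> x\<^sup>2 * 4"
    using True \<open>0 < x\<close> power_mono[of x 2 2] by (intro mult_left_mono) auto
  finally have "sin x / x \<le> 1 - x\<^sup>2 / 6 + x\<^sup>2 * 4 / 120" by simp
  moreover have "0 \<le> x\<^sup>2" by simp
  ultimately have "sin x / x \<le> 1 - x\<^sup>2 / 10" by linarith
  moreover have "min 1 (x\<^sup>2) / 10 \<le> x\<^sup>2 / 10" by simp
  ultimately show ?thesis by linarith
next
  case False
  then have "sin x * 2 \<le> x"
    using sin_le_one[of x] by linarith
  then have "sin x / x \<le> 1 / 2"
    using \<open>0 < x\<close> by (simp add: field_simps)
  moreover have "min 1 (x\<^sup>2) \<le> 1" by simp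
  ultimately show ?thesis by linarith
qed

lemma integral_cos_unit:
  fixes x :: real
  assumes "x \<noteq> 0"
  shows "(LINT u:{0..1}|lborel. cos (u * x)) = sin x / x"
proof -
  have "((\<lambda>u. cos (u * x)) has_integral (sin (1 * x) / x - sin (0 * x) / x)) {0..1}"
    using assms
    by (intro fundamental_theorem_of_calculus[where f = "\<lambda>u. sin (u * x) / x"])
       (auto intro!: derivative_eq_intros simp flip: has_real_derivative_iff_has_vector_derivative)
  moreover have "set_integrable lborel {0..1} (\<lambda>u. cos (u * x))"
    unfolding set_integrable_def
    by (intro borel_integrable_compact continuous_intros compact_Icc)
  ultimately show ?thesis
    using set_borel_integral_eq_integral(2)[of "{0..1}" "\<lambda>u. cos (u * x)"]
    by (simp add: integral_unique)
qed

text \<open>At \<open>s = 1 / y\<close> and for a nonnegative variable \<open>Y\<close> this is \<open>E (min Y y)\<^sup>2 / y\<^sup>2\<close>. Being monotone in \<open>s\<close>, it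
can be interpolated between the normalizing constants, which the characteristic function cannot.\<close>

definition trunc2 :: "real measure \<Rightarrow> real \<Rightarrow> real" where
  "trunc2 \<mu> s = (\<integral>x. min 1 ((s * x)\<^sup>2) \<partial>\<mu>)"

context real_distribution
begin

lemma integrable_trunc2: "integrable M (\<lambda>x. min 1 ((s * x)\<^sup>2))"
  by (rule integrable_const_bound[where B = 1]) auto

lemma trunc2_nonneg: "0 \<le> trunc2 M s"
  unfolding trunc2_def by (rule integral_nonneg_AE) auto

lemma trunc2_mono:
  assumes "0 \<le> s" "s \<le> t"
  shows "trunc2 M s \<le> trunc2 M t"
  unfolding trunc2_def
proof (rule integral_mono[OF integrable_trunc2 integrable_trunc2])
  fix x
  have "(s * x)\<^sup>2 \<le> (t * x)\<^sup>2"
    using assms by (simp add: power_mult_distrib mult_right_mono power_mono)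
  then show "min 1 ((s * x)\<^sup>2) \<le> min 1 ((t * x)\<^sup>2)" by (intro min.mono) auto
qed

lemma Re_char: "Re (char M s) = (\<integral>x. cos (s * x) \<partial>M)"
proof -
  have "integrable M (\<lambda>x. iexp (s * x))"
    by (rule integrable_iexp) simp_all
  then have "Re (char M s) = (\<integral>x. Re (iexp (s * x)) \<partial>M)"
    unfolding char_def by (rule integral_Re[symmetric])
  also have "\<dots> = (\<integral>x. cos (s * x) \<partial>M)"
    by (simp add: Re_exp)
  finally show ?thesis .
qed

lemma one_minus_Re_char_le_trunc2: "1 - Re (char M s) \<le> 2 * trunc2 M s"
proof -
  have i: "integrable M (\<lambda>x. cos (s * x))"
    by (rule integrable_const_bound[where B = 1]) auto
  have "1 - Re (char M s) = (\<integral>x. 1 - cos (s * x) \<partial>M)"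
    unfolding Re_char using i prob_space by simp
  also have "\<dots> \<le> (\<integral>x. 2 * min 1 ((s * x)\<^sup>2) \<partial>M)"
    using i integrable_trunc2 one_minus_cos_le
    by (intro integral_mono) auto
  finally show ?thesis by (simp add: trunc2_def)
qed

text \<open>Fubini's theorem for the average of \<open>1 - cos (u s x)\<close> over \<open>u\<close>.\<close>

lemma trunc2_le_char:
  assumes s: "0 < s" and q: "\<And>u. 0 \<le> u \<Longrightarrow> u \<le> s \<Longrightarrow> 1 - Re (char M u) \<le> c"
  shows "trunc2 M s \<le> 10 * c"
proof -
  interpret L: sigma_finite_measure lborel by (rule sigma_finite_lborel)
  let ?L = "restrict_space lborel {0..1::real}"
  have em: "emeasure ?L (space ?L) = 1"
    by (simp add: emeasure_restrict_space space_restrict_space)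
  interpret L: prob_space ?L by (rule prob_spaceI) (rule em)
  interpret P: pair_prob_space ?L M ..
  have c_meas[measurable]: "(\<lambda>(u, x). cos (u * s * x)) \<in> borel_measurable (?L \<Otimes>\<^sub>M M)"
  proof -
    have [measurable]: "(\<lambda>z. fst z :: real) \<in> borel_measurable (?L \<Otimes>\<^sub>M M)"
      by (rule measurable_compose[OF measurable_fst]) (simp add: measurable_restrict_space1)
    have [measurable]: "(\<lambda>z. snd z :: real) \<in> borel_measurable (?L \<Otimes>\<^sub>M M)"
      by (rule measurable_compose[OF measurable_snd]) simp
    show ?thesis unfolding case_prod_beta by measurable
  qed
  have int: "integrable (?L \<Otimes>\<^sub>M M) (\<lambda>(u, x). cos (u * s * x))"
    by (rule P.integrable_const_bound[where B = 1]) auto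
  have cs: "(\<integral>u. cos (u * s * x) \<partial>?L) = (if x = 0 then 1 else sin (s * x) / (s * x))" for x
  proof -
    have "(\<integral>u. cos (u * s * x) \<partial>?L) = (LINT u:{0..1}|lborel. cos (u * (s * x)))"
      by (subst integral_restrict_space) (auto simp: set_lebesgue_integral_def mult.assoc)
    then show ?thesis
      using integral_cos_unit[of "s * x"] s by (auto simp: set_integral_const)
  qed
  have ge: "min 1 ((s * x)\<^sup>2) / 10 \<le> 1 - (\<integral>u. cos (u * s * x) \<partial>?L)" for x
  proof -
    consider "x = 0" | "x > 0" | "x < 0" by linarith
    then show ?thesis
    proof cases
      case 3
      then have "0 < s * (- x)" using s by (simp add: mult_pos_neg)
      from one_minus_sinc_ge[OF this] show ?thesis using 3 s by (simp add: cs)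
    qed (use s one_minus_sinc_ge[of "s * x"] in \<open>auto simp: cs\<close>)
  qed
  have i2: "integrable M (\<lambda>x. \<integral>u. cos (u * s * x) \<partial>?L)"
    by (rule P.integrable_snd[OF int])
  have i1: "integrable ?L (\<lambda>u. \<integral>x. cos (u * s * x) \<partial>M)"
    by (rule P.integrable_fst'[OF int, simplified])
  have "trunc2 M s / 10 = (\<integral>x. min 1 ((s * x)\<^sup>2) / 10 \<partial>M)"
    by (simp add: trunc2_def)
  also have "\<dots> \<le> (\<integral>x. 1 - (\<integral>u. cos (u * s * x) \<partial>?L) \<partial>M)"
    using i2 by (intro integral_mono ge Bochner_Integration.integrable_diff
        integrable_divide integrable_trunc2) auto
  also have "\<dots> = 1 - (\<integral>x. (\<integral>u. cos (u * s * x) \<partial>?L) \<partial>M)"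
    using i2 prob_space by simp
  also have "(\<integral>x. (\<integral>u. cos (u * s * x) \<partial>?L) \<partial>M) = (\<integral>u. (\<integral>x. cos (u * s * x) \<partial>M) \<partial>?L)"
    by (rule P.Fubini_integral[OF int])
  also have "1 - \<dots> = (\<integral>u. 1 - (\<integral>x. cos (u * s * x) \<partial>M) \<partial>?L)"
    using i1 L.prob_space by simp
  also have "\<dots> \<le> (\<integral>u. c \<partial>?L)"
  proof (rule integral_mono)
    fix u assume "u \<in> space ?L"
    then have "0 \<le> u" "u \<le> 1" by (auto simp: space_restrict_space)
    then have "0 \<le> u * s" "u * s \<le> s" using s by (auto simp: mult_left_le_one_le)
    from q[OF this] show "1 - (\<integral>x. cos (u * s * x) \<partial>M) \<le> c"
      by (simp add: Re_char)
  qed (use i1 in auto)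
  also have "\<dots> = c" using L.prob_space by simp
  finally show ?thesis by simp
qed

end

lemma (in real_distribution) indep_vars_coordinates:
  "prob_space.indep_vars (\<Pi>\<^sub>M i\<in>UNIV. M) (\<lambda>_. borel) (\<lambda>i y. y i) UNIV"
  and distr_coordinate: "distr (\<Pi>\<^sub>M i\<in>UNIV. M) borel (\<lambda>y. y i) = M"
proof -
  interpret P: product_prob_space "\<lambda>_. M" UNIV ..
  have s: "sets (\<Pi>\<^sub>M i\<in>UNIV. M) = sets (\<Pi>\<^sub>M i\<in>UNIV. borel)"
    by (intro sets_PiM_cong) auto
  have c: "distr (\<Pi>\<^sub>M i\<in>UNIV. M) borel (\<lambda>y. y i) = M" for i
  proof -
    have "distr (\<Pi>\<^sub>M i\<in>UNIV. M) borel (\<lambda>y. y i) = distr (\<Pi>\<^sub>M i\<in>UNIV. M) M (\<lambda>y. y i)"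
      by (intro distr_cong) auto
    then show ?thesis using P.PiM_component[of i] by simp
  qed
  then show "distr (\<Pi>\<^sub>M i\<in>UNIV. M) borel (\<lambda>y. y i) = M" .
  have "distr (\<Pi>\<^sub>M i\<in>UNIV. M) (\<Pi>\<^sub>M i\<in>UNIV. borel) (\<lambda>x. \<lambda>i\<in>UNIV. x i) = (\<Pi>\<^sub>M i\<in>UNIV. M)"
    using distr_id2[OF s[symmetric]] by (simp add: restrict_UNIV id_def)
  then show "P.indep_vars (\<lambda>_. borel) (\<lambda>i y. y i) UNIV"
    by (subst P.indep_vars_iff_distr_eq_PiM) (auto simp: c)
qed

lemma (in real_distribution) char_normalized_sum:
  "char (distr (\<Pi>\<^sub>M i\<in>UNIV. M) borel (\<lambda>y. (\<Sum>i<n. y i) / B - A)) u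
     = char M (u / B) ^ n * iexp (- u * A)" (is ?sum)
  and real_distribution_normalized_sum:
  "real_distribution (distr (\<Pi>\<^sub>M i\<in>UNIV. M) borel (\<lambda>y. (\<Sum>i<(n::nat). y i) / B - A))"
  and symmetrized_char:
  "Re (char (distr (\<Pi>\<^sub>M i\<in>(UNIV::nat set). M) borel (\<lambda>y. y 0 - y 1)) u) = (cmod (char M u))\<^sup>2"
proof -
  interpret P: product_prob_space "\<lambda>_. M" "UNIV::nat set" ..
  let ?P = "\<Pi>\<^sub>M i\<in>(UNIV::nat set). M"
  have [measurable]: "(\<lambda>y. y i) \<in> borel_measurable ?P" for i
    using measurable_component_singleton[of i UNIV "\<lambda>_. M"] by simp
  show "real_distribution (distr ?P borel (\<lambda>y. (\<Sum>i<(n::nat). y i) / B - A))"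
    by (rule P.real_distribution_distr) measurable
  have ind: "P.indep_vars (\<lambda>_. borel) (\<lambda>i y. y i) UNIV"
    by (rule indep_vars_coordinates)
  have "char (distr ?P borel (\<lambda>y. (\<Sum>i<n. y i) / B - A)) u
      = (CLINT y|?P. iexp (u * ((\<Sum>i<n. y i) / B - A)))"
    by (simp add: char_def integral_distr)
  also have "\<dots> = (CLINT y|?P. iexp ((u / B) * (\<Sum>i<n. y i)) * iexp (- u * A))"
    by (intro Bochner_Integration.integral_cong refl)
       (simp add: algebra_simps add_divide_distrib diff_divide_distrib flip: exp_add)
  also have "\<dots> = (CLINT y|?P. iexp ((u / B) * (\<Sum>i<n. y i))) * iexp (- u * A)"
    by simp
  also have "(CLINT y|?P. iexp ((u / B) * (\<Sum>i<n. y i)))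
      = char (distr ?P borel (\<lambda>y. \<Sum>i<n. y i)) (u / B)"
    by (simp add: char_def integral_distr)
  also have "\<dots> = char M (u / B) ^ n"
    using P.indep_vars_subset[OF ind] by (subst P.char_distr_sum) (auto simp: distr_coordinate)
  finally show ?sum .
  have "P.indep_var borel (\<lambda>y. y 0) borel (\<lambda>y. \<Sum>i\<in>{1}. y i)"
    using P.indep_vars_subset[OF ind] by (intro P.indep_vars_sum) auto
  then have "P.indep_var borel ((\<lambda>x. x) \<circ> (\<lambda>y. y 0)) borel (uminus \<circ> (\<lambda>y. y 1))"
    by (intro P.indep_var_compose) auto
  then have "char (distr ?P borel (\<lambda>y. y 0 + - y 1)) u
      = char (distr ?P borel (\<lambda>y. y 0)) u * char (distr ?P borel (\<lambda>y. - y 1)) u"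
    by (intro P.char_distr_add) (simp add: comp_def)
  also have "char (distr ?P borel (\<lambda>y. - y 1)) u = char (distr ?P borel (\<lambda>y. y 1)) (- u)"
    by (simp add: char_def integral_distr)
  also have "\<dots> = char M (- u)" by (simp add: distr_coordinate)
  also have "\<dots> = cnj (char M u)"
    unfolding char_def by (subst Bochner_Integration.integral_cnj[symmetric])
      (simp add: exp_cnj)
  finally have "char (distr ?P borel (\<lambda>y. y 0 - y 1)) u = of_real ((cmod (char M u))\<^sup>2)"
    by (simp add: distr_coordinate complex_norm_square del: of_real_power)
  then show "Re (char (distr ?P borel (\<lambda>y. y 0 - y 1)) u) = (cmod (char M u))\<^sup>2" by simp
qed

text \<open>With probability at least 1/2 the second coordinate is bounded by a constant, and then the first
coordinate is bounded by the difference up to that constant. Independence separates the two factors.\<close>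

lemma (in real_distribution) trunc2_le_symmetrized:
  obtains m where "0 < m" and "\<And>s. trunc2 M s
    \<le> 4 * trunc2 (distr (\<Pi>\<^sub>M i\<in>(UNIV::nat set). M) borel (\<lambda>y. y 0 - y 1)) s + m * s\<^sup>2"
proof -
  interpret P: product_prob_space "\<lambda>_. M" "UNIV::nat set" ..
  let ?P = "\<Pi>\<^sub>M i\<in>(UNIV::nat set). M"
  have [measurable]: "(\<lambda>y. y i) \<in> borel_measurable ?P" for i
    using measurable_component_singleton[of i UNIV "\<lambda>_. M"] by simp
  have "(\<lambda>n. prob {- real n..real n}) \<longlonglongrightarrow> prob (\<Union>n. {- real n..real n})"
    by (rule finite_Lim_measure_incseq) (auto simp: incseq_def)
  moreover have "(\<Union>n. {- real n..real n}) = UNIV"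
  proof (intro set_eqI iffI UNIV_I)
    fix x :: real
    obtain n where "\<bar>x\<bar> \<le> real n" using real_arch_simple by blast
    then show "x \<in> (\<Union>n. {- real n..real n})" by (auto simp: abs_le_iff intro!: exI[of _ n])
  qed
  ultimately have "(\<lambda>n. prob {- real n..real n}) \<longlonglongrightarrow> 1"
    using prob_space by simp
  then have "\<forall>\<^sub>F n in sequentially. 1 / 2 < prob {- real n..real n}"
    by (rule order_tendstoD) simp
  then obtain n where n: "1 / 2 < prob {- real n..real n}"
    by (auto simp: eventually_sequentially)
  let ?I = "{- real n..real n}"
  let ?D = "distr ?P borel (\<lambda>y. y 0 - y 1)"
  have ind: "P.indep_var borel (\<lambda>y. y 0) borel (\<lambda>y. \<Sum>i\<in>{1}. y i)"
    using P.indep_vars_subset[OF indep_vars_coordinates] by (intro P.indep_vars_sum) auto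
  have *: "trunc2 M s \<le> 4 * trunc2 ?D s + (4 * (real n)\<^sup>2) * s\<^sup>2" for s
  proof -
    have int: "integrable ?P (\<lambda>y. min 1 ((s * y i)\<^sup>2))" "integrable ?P (\<lambda>y. indicator ?I (y i) :: real)"
      "integrable ?P (\<lambda>y. min 1 ((s * (y i - y j))\<^sup>2))" for i j
      by (rule P.integrable_const_bound[where B = 1]; simp add: indicator_def)+
    have "P.indep_var borel ((\<lambda>x. min 1 ((s * x)\<^sup>2)) \<circ> (\<lambda>y. y 0)) borel (indicator ?I \<circ> (\<lambda>y. y 1) :: _ \<Rightarrow> real)"
      using ind by (intro P.indep_var_compose) auto
    then have "(\<integral>y. min 1 ((s * y 0)\<^sup>2) * indicator ?I (y 1) \<partial>?P)
        = (\<integral>y. min 1 ((s * y 0)\<^sup>2) \<partial>?P) * (\<integral>y. indicator ?I (y 1) \<partial>?P)"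
      using int by (intro P.indep_var_lebesgue_integral) (auto simp: comp_def)
    also have "(\<integral>y. min 1 ((s * y 0)\<^sup>2) \<partial>?P) = (\<integral>x. min 1 ((s * x)\<^sup>2) \<partial>distr ?P borel (\<lambda>y. y 0))"
      by (simp add: integral_distr)
    also have "(\<integral>y. indicator ?I (y 1) \<partial>?P) = (\<integral>x. (indicator ?I x :: real) \<partial>distr ?P borel (\<lambda>y. y 1))"
      by (rule integral_distr[symmetric]) auto
    also have "\<dots> = prob ?I" by (simp add: distr_coordinate)
    finally have "trunc2 M s * prob ?I = (\<integral>y. min 1 ((s * y 0)\<^sup>2) * indicator ?I (y 1) \<partial>?P)"
      by (simp add: trunc2_def distr_coordinate)
    also have "\<dots> \<le> (\<integral>y. 2 * min 1 ((s * (y 0 - y 1))\<^sup>2) + 2 * (real n)\<^sup>2 * s\<^sup>2 \<partial>?P)"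
    proof (rule integral_mono)
      show "integrable ?P (\<lambda>y. min 1 ((s * y 0)\<^sup>2) * indicator ?I (y 1))"
        by (rule P.integrable_const_bound[where B = 1]) (auto simp: indicator_def)
      fix y :: "nat \<Rightarrow> real"
      show "min 1 ((s * y 0)\<^sup>2) * indicator ?I (y 1) \<le> 2 * min 1 ((s * (y 0 - y 1))\<^sup>2) + 2 * (real n)\<^sup>2 * s\<^sup>2"
      proof (cases "y 1 \<in> ?I")
        case True
        then have "\<bar>y 1\<bar> \<le> \<bar>real n\<bar>" by auto
        then have "(y 1)\<^sup>2 \<le> (real n)\<^sup>2" unfolding abs_le_square_iff .
        then have "(s * y 1)\<^sup>2 \<le> (real n)\<^sup>2 * s\<^sup>2"
          by (simp add: power_mult_distrib mult.commute mult_left_mono)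
        moreover have "(s * y 0)\<^sup>2 \<le> 2 * (s * (y 0 - y 1))\<^sup>2 + 2 * (s * y 1)\<^sup>2"
          using zero_le_power2[of "s * (y 0 - y 1) - s * y 1"]
          by (simp add: power2_eq_square algebra_simps)
        moreover have "0 \<le> (real n)\<^sup>2 * s\<^sup>2" by simp
        ultimately have "(s * y 0)\<^sup>2 \<le> 2 * (s * (y 0 - y 1))\<^sup>2 + 2 * ((real n)\<^sup>2 * s\<^sup>2)"
          by linarith
        then have "min 1 ((s * y 0)\<^sup>2) \<le> 2 * min 1 ((s * (y 0 - y 1))\<^sup>2) + 2 * ((real n)\<^sup>2 * s\<^sup>2)"
          using \<open>0 \<le> (real n)\<^sup>2 * s\<^sup>2\<close> unfolding min_def by (smt (verit))
        then show ?thesis using True by (simp add: mult.assoc)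
      qed auto
    qed (use int in auto)
    also have "\<dots> = 2 * trunc2 ?D s + 2 * (real n)\<^sup>2 * s\<^sup>2"
      using int P.P.prob_space by (simp add: trunc2_def integral_distr)
    finally have "trunc2 M s * prob ?I \<le> 2 * trunc2 ?D s + 2 * (real n)\<^sup>2 * s\<^sup>2" .
    moreover have "trunc2 M s * (1 / 2) \<le> trunc2 M s * prob ?I"
      using n trunc2_nonneg by (intro mult_left_mono) auto
    ultimately show ?thesis by simp
  qed
  show thesis
  proof (rule that[of "4 * (real n)\<^sup>2 + 1"])
    fix s :: real
    show "trunc2 M s \<le> 4 * trunc2 ?D s + (4 * (real n)\<^sup>2 + 1) * s\<^sup>2"
      using *[of s] zero_le_power2[of s] unfolding distrib_right by linarith
  qed (simp add: add_nonneg_pos)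
qed

section \<open>Tails in the Cauchy domain of attraction\<close>

lemma norm_skew_cauchy_char:
  assumes "skew_cauchy_law S"
  shows "cmod (char S t) = exp (- \<bar>t\<bar>)"
  using assms by (auto simp: skew_cauchy_law_def norm_exp_eq_Re)

text \<open>Taking moduli removes the centering: \<open>\<bar>char \<mu> (u / B\<^sub>n)\<bar>\<^sup>n\<close> tends to \<open>exp (- \<bar>u\<bar>)\<close>, uniformly on bounded
sets. With \<open>q = 1 - \<bar>char \<mu>\<bar>\<^sup>2\<close>, the inequality \<open>1 - q \<le> exp (- q)\<close> bounds \<open>n q\<close> from above and
Bernoulli's inequality bounds it from below; Bernoulli's bound saturates, which is the reason for
\<open>t \<le> 1\<close>. As \<open>q\<close> belongs to the difference of two independent copies, the upper bound first
concerns that difference. Applied for arbitrarily large \<open>t\<close> it forces \<open>n / B\<^sub>n\<^sup>2\<close> to vanish, and this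
absorbs the quadratic error in the passage from the difference back to \<open>\<mu>\<close>.\<close>

lemma cauchy_domain_trunc2:
  assumes "cauchy_domain_of_attraction \<mu>"
  obtains B :: "nat \<Rightarrow> real" and c C :: real where "\<forall>n. 0 < B n" "0 < c" "0 < C"
    "(\<lambda>n. real n / (B n)\<^sup>2) \<longlonglongrightarrow> 0"
    "\<forall>t>0. \<forall>\<^sub>F n in sequentially. real n * trunc2 \<mu> (t / B n) \<le> C * t"
    "\<forall>t. 0 < t \<and> t \<le> 1 \<longrightarrow> (\<forall>\<^sub>F n in sequentially. c * t \<le> real n * trunc2 \<mu> (t / B n))"
proof -
  from assms have rd: "real_distribution \<mu>"
    by (simp add: cauchy_domain_of_attraction_def)
  from assms obtain S and A B :: "nat \<Rightarrow> real" where S: "skew_cauchy_law S" and B: "\<And>n. 0 < B n"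
    and conv: "weak_conv_m (\<lambda>n. distr (Pi\<^sub>M UNIV (\<lambda>_. \<mu>)) borel (\<lambda>y. (\<Sum>i<n. y i) / B n - A n)) S"
    by (auto simp: cauchy_domain_of_attraction_def)
  interpret real_distribution \<mu> by (rule rd)
  define \<phi> where "\<phi> u = cmod (char \<mu> u)" for u
  have \<phi>0: "0 \<le> \<phi> u" for u by (simp add: \<phi>_def)
  have \<phi>1: "\<phi> u \<le> 1" for u by (simp add: \<phi>_def cmod_char_le_1)
  have near: "\<forall>\<^sub>F n in sequentially. \<forall>u. \<bar>u\<bar> \<le> t \<longrightarrow> \<bar>\<phi> (u / B n) ^ n - exp (- \<bar>u\<bar>)\<bar> \<le> \<epsilon>"
    if "0 < \<epsilon>" for t \<epsilon>
  proof -
    have "\<forall>\<^sub>F n in sequentially. \<forall>u. \<bar>u\<bar> \<le> t \<longrightarrow>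
      cmod (char (distr (Pi\<^sub>M UNIV (\<lambda>_. \<mu>)) borel (\<lambda>y. (\<Sum>i<n. y i) / B n - A n)) u - char S u) \<le> \<epsilon>"
      using S that conv real_distribution_normalized_sum
      by (intro weak_conv_char_uniform) (auto simp: skew_cauchy_law_def)
    then show ?thesis
    proof eventually_elim
      case (elim n)
      show ?case
      proof (intro allI impI)
        fix u assume "\<bar>u\<bar> \<le> t"
        have "\<phi> (u / B n) ^ n = cmod (char \<mu> (u / B n) ^ n * iexp (- u * A n))"
          by (simp add: norm_mult norm_power \<phi>_def)
        moreover have "exp (- \<bar>u\<bar>) = cmod (char S u)"
          using norm_skew_cauchy_char[OF S] by simp
        moreover have "cmod (char \<mu> (u / B n) ^ n * iexp (- u * A n) - char S u) \<le> \<epsilon>"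
          using elim \<open>\<bar>u\<bar> \<le> t\<close> unfolding char_normalized_sum by blast
        ultimately show "\<bar>\<phi> (u / B n) ^ n - exp (- \<bar>u\<bar>)\<bar> \<le> \<epsilon>"
          by (metis norm_triangle_ineq3 order_trans)
      qed
    qed
  qed
  have upper_char: "\<forall>\<^sub>F n in sequentially. \<forall>u. 0 \<le> u \<longrightarrow> u \<le> t \<longrightarrow> real n * (1 - (\<phi> (u / B n))\<^sup>2) \<le> 4 * t"
    if t: "0 < t" for t
  proof -
    have "0 < exp (- t) - exp (- (2 * t))" using t by simp
    from near[OF this, of t] show ?thesis
    proof eventually_elim
      case (elim n)
      show ?case
      proof (intro allI impI)
        fix u assume u: "0 \<le> u" "u \<le> t"
        let ?q = "1 - (\<phi> (u / B n))\<^sup>2"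
        have "\<bar>\<phi> (u / B n) ^ n - exp (- u)\<bar> \<le> exp (- t) - exp (- (2 * t))"
          using elim[rule_format, of u] u by simp
        moreover have "exp (- t) \<le> exp (- u)" using u by simp
        ultimately have "exp (- (2 * t)) \<le> \<phi> (u / B n) ^ n" by linarith
        then have "(exp (- (2 * t)))\<^sup>2 \<le> (\<phi> (u / B n) ^ n)\<^sup>2"
          by (intro power_mono) auto
        also have "\<dots> = (1 - ?q) ^ n" by (simp add: mult.commute flip: power_mult)
        also have "\<dots> \<le> exp (- ?q) ^ n"
          using exp_ge_add_one_self[of "- ?q"] by (intro power_mono) auto
        also have "\<dots> = exp (- (real n * ?q))"
          by (metis exp_of_nat_mult mult_minus_right)
        also have "(exp (- (2 * t)))\<^sup>2 = exp (- (4 * t))"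
          by (simp add: power2_eq_square flip: exp_add)
        finally show "real n * ?q \<le> 4 * t" by simp
      qed
    qed
  qed
  have lower_char: "\<forall>\<^sub>F n in sequentially. t / 2 \<le> real n * (1 - (\<phi> (t / B n))\<^sup>2)"
    if t: "0 < t" "t \<le> 1" for t
  proof -
    have "(\<lambda>n. \<phi> (t / B n) ^ n) \<longlonglongrightarrow> exp (- t)"
      unfolding tendsto_iff dist_real_def
    proof (intro allI impI)
      fix e :: real assume "0 < e"
      then have "0 < e / 2" by simp
      from near[OF this, of t] show "\<forall>\<^sub>F n in sequentially. \<bar>\<phi> (t / B n) ^ n - exp (- t)\<bar> < e"
      proof eventually_elim
        case (elim n)
        from this[rule_format, of t] have "\<bar>\<phi> (t / B n) ^ n - exp (- t)\<bar> \<le> e / 2"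
          using t by simp
        then show ?case using \<open>0 < e\<close> by simp
      qed
    qed
    then have "(\<lambda>n. (\<phi> (t / B n) ^ n)\<^sup>2) \<longlonglongrightarrow> (exp (- t))\<^sup>2"
      by (intro tendsto_intros)
    moreover have "(exp (- t))\<^sup>2 < 1 - t / 2"
    proof -
      have "(exp (- t))\<^sup>2 = 1 / exp (2 * t)" by (simp add: exp_minus exp_double divide_inverse power_inverse)
      also have "\<dots> \<le> 1 / (1 + 2 * t)"
        using t exp_ge_add_one_self[of "2 * t"] by (intro divide_left_mono mult_pos_pos) auto
      also have "\<dots> < 1 - t / 2"
      proof -
        have "1 < (1 - t / 2) * (1 + 2 * t)"
          using t mult_left_mono[of t 1 t] by (simp add: algebra_simps)
        then show ?thesis using t by (simp add: divide_less_eq)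
      qed
      finally show ?thesis .
    qed
    ultimately have "\<forall>\<^sub>F n in sequentially. (\<phi> (t / B n) ^ n)\<^sup>2 < 1 - t / 2"
      by (rule order_tendstoD)
    then show ?thesis
    proof eventually_elim
      case (elim n)
      let ?q = "1 - (\<phi> (t / B n))\<^sup>2"
      have "1 - real n * ?q \<le> (1 - ?q) ^ n"
        using Bernoulli_inequality[of "- ?q" n] by (simp add: algebra_simps)
      also have "\<dots> = (\<phi> (t / B n) ^ n)\<^sup>2"
        by (simp add: mult.commute flip: power_mult)
      finally show ?case using elim by linarith
    qed
  qed
  let ?D = "distr (\<Pi>\<^sub>M i\<in>(UNIV::nat set). \<mu>) borel (\<lambda>y. y 0 - y 1)"
  have D: "real_distribution ?D"
  proof -
    interpret P: product_prob_space "\<lambda>_. \<mu>" "UNIV::nat set" ..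
    have [measurable]: "(\<lambda>y. y i) \<in> borel_measurable (\<Pi>\<^sub>M i\<in>(UNIV::nat set). \<mu>)" for i
      using measurable_component_singleton[of i UNIV "\<lambda>_. \<mu>"] by simp
    show ?thesis by (rule P.real_distribution_distr) measurable
  qed
  interpret D: real_distribution ?D by (rule D)
  have upper_D: "\<forall>\<^sub>F n in sequentially. real n * trunc2 ?D (t / B n) \<le> 40 * t" if t: "0 < t" for t
    using upper_char[OF t] eventually_gt_at_top[of 0]
  proof eventually_elim
    case (elim n)
    have "trunc2 ?D (t / B n) \<le> 10 * (4 * t / real n)"
    proof (rule D.trunc2_le_char)
      show "0 < t / B n" using t B by simp
      fix u assume u: "0 \<le> u" "u \<le> t / B n"
      then have "0 \<le> u * B n" "u * B n \<le> t" using B[of n] by (simp_all add: field_simps)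
      with elim have "real n * (1 - (\<phi> (u * B n / B n))\<^sup>2) \<le> 4 * t" by blast
      then show "1 - Re (char ?D u) \<le> 4 * t / real n"
        using B[of n] elim(2) unfolding symmetrized_char \<phi>_def by (simp add: field_simps)
    qed
    then show ?case using elim(2) by (simp add: field_simps)
  qed
  have lower_D: "\<forall>\<^sub>F n in sequentially. 1 / 4 \<le> real n * trunc2 ?D (1 / B n)"
    using lower_char[of 1, simplified]
  proof eventually_elim
    case (elim n)
    have "1 - (\<phi> (1 / B n))\<^sup>2 \<le> 2 * trunc2 ?D (1 / B n)"
      using D.one_minus_Re_char_le_trunc2[of "1 / B n"] unfolding symmetrized_char \<phi>_def by simp
    then have "real n * (1 - (\<phi> (1 / B n))\<^sup>2) \<le> real n * (2 * trunc2 ?D (1 / B n))"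
      by (intro mult_left_mono) auto
    then show ?case using elim by simp
  qed
  have w: "0 < trunc2 ?D 1"
  proof (rule ccontr)
    assume "\<not> 0 < trunc2 ?D 1"
    then have 0: "trunc2 ?D 1 = 0" using D.trunc2_nonneg[of 1] by simp
    from lower_D obtain n where n: "1 / 4 \<le> real n * trunc2 ?D (1 / B n)"
      by (auto simp: eventually_sequentially)
    let ?s = "1 + 1 / B n"
    have "trunc2 ?D (1 / B n) \<le> trunc2 ?D ?s"
      using B[of n] by (intro D.trunc2_mono) auto
    also have "\<dots> \<le> (\<integral>x. ?s\<^sup>2 * min 1 ((1 * x)\<^sup>2) \<partial>?D)"
      unfolding trunc2_def
    proof (rule integral_mono)
      fix x :: real
      have "1 \<le> ?s\<^sup>2" using B[of n] by (intro one_le_power) auto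
      then show "min 1 ((?s * x)\<^sup>2) \<le> ?s\<^sup>2 * min 1 ((1 * x)\<^sup>2)"
        by (simp add: min_def power_mult_distrib)
    qed (use D.integrable_trunc2[of 1] D.integrable_trunc2 in auto)
    also have "\<dots> = 0" using 0 by (simp add: trunc2_def)
    finally show False using n mult_left_mono[of "trunc2 ?D (1 / B n)" 0 "real n"] by simp
  qed
  have small: "\<forall>\<^sub>F n in sequentially. real n / (B n)\<^sup>2 \<le> 40 / (t * trunc2 ?D 1)" if t: "0 < t" for t
  proof -
    have "(\<lambda>n. 40 * t / real n) \<longlonglongrightarrow> 0" by real_asymp
    then have "\<forall>\<^sub>F n in sequentially. 40 * t / real n < trunc2 ?D 1"
      using w by (rule order_tendstoD)
    then show ?thesis using upper_D[OF t] eventually_gt_at_top[of 0]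
    proof eventually_elim
      case (elim n)
      have "trunc2 ?D (t / B n) < trunc2 ?D 1"
      proof -
        have "trunc2 ?D (t / B n) \<le> 40 * t / real n"
          using elim by (simp add: field_simps)
        with elim show ?thesis by linarith
      qed
      then have "t / B n < 1"
        using D.trunc2_mono[of 1 "t / B n"] by force
      then have le: "(t / B n)\<^sup>2 \<le> 1" using t B[of n] by (intro power_le_one) auto
      have "(t / B n)\<^sup>2 * trunc2 ?D 1 = (\<integral>x. (t / B n)\<^sup>2 * min 1 ((1 * x)\<^sup>2) \<partial>?D)"
        by (simp add: trunc2_def)
      also have "\<dots> \<le> trunc2 ?D (t / B n)"
        unfolding trunc2_def
      proof (rule integral_mono)
        fix x :: real
        have "(t / B n)\<^sup>2 * min 1 (x\<^sup>2) \<le> 1 * 1"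
          using le by (intro mult_mono) auto
        moreover have "(t / B n)\<^sup>2 * min 1 (x\<^sup>2) \<le> (t / B n)\<^sup>2 * x\<^sup>2"
          by (intro mult_left_mono) auto
        ultimately show "(t / B n)\<^sup>2 * min 1 ((1 * x)\<^sup>2) \<le> min 1 ((t / B n * x)\<^sup>2)"
          by (simp add: power_mult_distrib power_divide)
      qed (use D.integrable_trunc2[of 1] D.integrable_trunc2[of "t / B n"] in auto)
      finally have "real n * ((t / B n)\<^sup>2 * trunc2 ?D 1) \<le> real n * trunc2 ?D (t / B n)"
        by (intro mult_left_mono) auto
      also have "\<dots> \<le> 40 * t" using elim by simp
      finally have "real n / (B n)\<^sup>2 * (t\<^sup>2 * trunc2 ?D 1) \<le> 40 * t"
        by (simp add: power_divide mult_ac)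
      then have "t * (real n / (B n)\<^sup>2 * (t * trunc2 ?D 1)) \<le> t * 40"
        by (simp add: power2_eq_square mult_ac)
      then have "real n / (B n)\<^sup>2 * (t * trunc2 ?D 1) \<le> 40"
        using t by (simp only: mult_le_cancel_left_pos)
      then show ?case using t w by (simp add: pos_le_divide_eq)
    qed
  qed
  have lim: "(\<lambda>n. real n / (B n)\<^sup>2) \<longlonglongrightarrow> 0"
    unfolding tendsto_iff dist_real_def
  proof (intro allI impI)
    fix e :: real assume "0 < e"
    then have "0 < 80 / (e * trunc2 ?D 1)" using w by simp
    from small[OF this] show "\<forall>\<^sub>F n in sequentially. \<bar>real n / (B n)\<^sup>2 - 0\<bar> < e"
    proof eventually_elim
      case (elim n)
      then have "real n / (B n)\<^sup>2 \<le> e / 2" using w \<open>0 < e\<close> by simp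
      moreover have "0 \<le> real n / (B n)\<^sup>2" by simp
      ultimately show ?case using \<open>0 < e\<close> by linarith
    qed
  qed
  obtain m where m: "0 < m" "\<And>s. trunc2 \<mu> s \<le> 4 * trunc2 ?D s + m * s\<^sup>2"
    using trunc2_le_symmetrized by blast
  have upper: "\<forall>\<^sub>F n in sequentially. real n * trunc2 \<mu> (t / B n) \<le> 161 * t" if t: "0 < t" for t
  proof -
    have "0 < 1 / (m * t)" using m t by simp
    with lim have "\<forall>\<^sub>F n in sequentially. real n / (B n)\<^sup>2 < 1 / (m * t)"
      by (rule order_tendstoD)
    then show ?thesis using upper_D[OF t]
    proof eventually_elim
      case (elim n)
      have "real n * trunc2 \<mu> (t / B n) \<le> real n * (4 * trunc2 ?D (t / B n) + m * (t / B n)\<^sup>2)"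
        by (intro mult_left_mono m) auto
      also have "\<dots> = 4 * (real n * trunc2 ?D (t / B n)) + (real n / (B n)\<^sup>2) * (m * t) * t"
        by (simp add: algebra_simps power_divide power2_eq_square)
      also have "\<dots> \<le> 4 * (40 * t) + 1 * t"
      proof (rule add_mono)
        show "4 * (real n * trunc2 ?D (t / B n)) \<le> 4 * (40 * t)" using elim by simp
        have "(real n / (B n)\<^sup>2) * (m * t) \<le> 1"
          using elim(1) m t by (simp add: less_divide_eq)
        then show "(real n / (B n)\<^sup>2) * (m * t) * t \<le> 1 * t"
          using t by (intro mult_right_mono) auto
      qed
      finally show ?case by simp
    qed
  qed
  have lower: "\<forall>\<^sub>F n in sequentially. 1 / 8 * t \<le> real n * trunc2 \<mu> (t / B n)"
    if t: "0 < t" "t \<le> 1" for t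
    using lower_char[OF t]
  proof eventually_elim
    case (elim n)
    let ?r = "Re (char \<mu> (t / B n))"
    have "?r\<^sup>2 \<le> (\<phi> (t / B n))\<^sup>2"
      unfolding \<phi>_def by (simp add: cmod_power2)
    then have 1: "1 - (\<phi> (t / B n))\<^sup>2 \<le> 1 - ?r\<^sup>2" by simp
    have "\<bar>?r\<bar> \<le> 1"
      using abs_Re_le_cmod[of "char \<mu> (t / B n)"] cmod_char_le_1[of "t / B n"] by linarith
    then have 2: "1 - ?r\<^sup>2 \<le> 2 * (1 - ?r)"
      using zero_le_power2[of "1 - ?r"] by (simp add: power2_eq_square algebra_simps)
    have "2 * (1 - ?r) \<le> 4 * trunc2 \<mu> (t / B n)"
      using one_minus_Re_char_le_trunc2[of "t / B n"] by simp
    with 1 2 have "1 - (\<phi> (t / B n))\<^sup>2 \<le> 4 * trunc2 \<mu> (t / B n)" by (metis order_trans)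
    then have "real n * (1 - (\<phi> (t / B n))\<^sup>2) \<le> real n * (4 * trunc2 \<mu> (t / B n))"
      by (intro mult_left_mono) auto
    then show ?case using elim by simp
  qed
  show thesis
    by (rule that[of B "1 / 8" 161]) (use B lim upper lower in auto)
qed

text \<open>Up to a constant that does not depend on \<open>a\<close>, the truncated second moment varies regularly with index 1.
It suffices to know it along the normalizing constants: they tend to infinity with bounded
consecutive ratios, and the truncated second moment is monotone.\<close>

lemma cauchy_domain_trunc2_scaling:
  assumes doa: "cauchy_domain_of_attraction \<mu>"
  obtains c where "0 < c" "c \<le> 1"
    "\<forall>a\<ge>1. \<forall>\<^sub>F y in at_top. c * trunc2 \<mu> (1 / y) / a \<le> trunc2 \<mu> (1 / (a * y))"
    "\<forall>y>0. 0 < trunc2 \<mu> (1 / y)"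
proof -
  from doa have rd: "real_distribution \<mu>"
    by (simp add: cauchy_domain_of_attraction_def)
  interpret real_distribution \<mu> by (rule rd)
  obtain B :: "nat \<Rightarrow> real" and c C :: real where Bpos: "\<forall>n. 0 < B n" and cC: "0 < c" "0 < C"
    and lim: "(\<lambda>n. real n / (B n)\<^sup>2) \<longlonglongrightarrow> 0"
    and upper: "\<forall>t>0. \<forall>\<^sub>F n in sequentially. real n * trunc2 \<mu> (t / B n) \<le> C * t"
    and lower: "\<forall>t. 0 < t \<and> t \<le> 1 \<longrightarrow> (\<forall>\<^sub>F n in sequentially. c * t \<le> real n * trunc2 \<mu> (t / B n))"
    using cauchy_domain_trunc2[OF doa] by blast
  note B = Bpos[rule_format] and upper = upper[rule_format] and lower = lower[rule_format, OF conjI]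
  have B_top: "\<forall>\<^sub>F n in sequentially. Z < B n" for Z
  proof -
    have "0 < 1 / (\<bar>Z\<bar> + 1)\<^sup>2" by simp
    with lim have "\<forall>\<^sub>F n in sequentially. real n / (B n)\<^sup>2 < 1 / (\<bar>Z\<bar> + 1)\<^sup>2"
      by (rule order_tendstoD)
    then show ?thesis using eventually_ge_at_top[of 1]
    proof eventually_elim
      case (elim n)
      have "1 / (B n)\<^sup>2 \<le> real n / (B n)\<^sup>2"
        using elim(2) by (intro divide_right_mono) auto
      with elim(1) have "1 / (B n)\<^sup>2 < 1 / (\<bar>Z\<bar> + 1)\<^sup>2" by linarith
      then have "(\<bar>Z\<bar> + 1)\<^sup>2 < (B n)\<^sup>2"
        using B[of n] by (simp add: divide_less_cancel field_simps)
      then have "\<bar>Z\<bar> + 1 < B n" using B[of n] by (auto intro: power2_less_imp_less less_imp_le)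
      then show ?case by linarith
    qed
  qed
  define R where "R = 2 * C / c + 1"
  have R: "1 < R" using cC by (simp add: R_def)
  have ratio: "\<forall>\<^sub>F n in sequentially. B (Suc n) < R * B n"
  proof -
    have "\<forall>\<^sub>F n in sequentially. c * 1 \<le> real (Suc n) * trunc2 \<mu> (1 / B (Suc n))"
      using lower[of 1] by (subst eventually_sequentially_Suc) simp
    moreover have "\<forall>\<^sub>F n in sequentially. real n * trunc2 \<mu> (1 / R / B n) \<le> C * (1 / R)"
      using R by (intro upper) simp
    ultimately show ?thesis using eventually_ge_at_top[of 1]
    proof eventually_elim
      case (elim n)
      show ?case
      proof (rule ccontr)
        assume "\<not> B (Suc n) < R * B n"
        then have "1 / B (Suc n) \<le> 1 / R / B n"
          using B[of n] B[of "Suc n"] R by (simp add: field_simps)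
        then have "trunc2 \<mu> (1 / B (Suc n)) \<le> trunc2 \<mu> (1 / R / B n)"
          using B[of "Suc n"] by (intro trunc2_mono) auto
        then have "c \<le> real (Suc n) * trunc2 \<mu> (1 / R / B n)"
          using elim(1) mult_left_mono[of "trunc2 \<mu> (1 / B (Suc n))" "trunc2 \<mu> (1 / R / B n)" "real (Suc n)"]
          by linarith
        also have "\<dots> \<le> (2 * real n) * trunc2 \<mu> (1 / R / B n)"
          using elim(3) trunc2_nonneg by (intro mult_right_mono) auto
        also have "\<dots> \<le> 2 * (C * (1 / R))" using elim(2) by simp
        finally have "c * R \<le> 2 * C" using R by (simp add: field_simps)
        moreover have "c * R = 2 * C + c" using cC by (simp add: R_def distrib_left)
        ultimately show False using cC by linarith
      qed
    qed
  qed
  define c' where "c' = min 1 (c / (C * R))"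
  have c': "0 < c'" "c' \<le> 1" "c' \<le> c / (C * R)" using cC R by (auto simp: c'_def)
  have scale: "\<forall>\<^sub>F y in at_top. c' * trunc2 \<mu> (1 / y) / a \<le> trunc2 \<mu> (1 / (a * y))" if a: "1 \<le> a" for a
  proof -
    have "\<forall>\<^sub>F n in sequentially. real n * trunc2 \<mu> (1 / B n) \<le> C * 1"
      by (rule upper) simp
    moreover have "\<forall>\<^sub>F n in sequentially. c * (1 / (a * R)) \<le> real n * trunc2 \<mu> (1 / (a * R) / B n)"
      using a R mult_mono[of 1 a 1 R] by (intro lower) (auto simp: zero_less_mult_iff divide_le_eq)
    ultimately have "\<forall>\<^sub>F n in sequentially. B (Suc n) < R * B n \<and> 1 \<le> n \<and> real n * trunc2 \<mu> (1 / B n) \<le> C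
        \<and> c * (1 / (a * R)) \<le> real n * trunc2 \<mu> (1 / (a * R) / B n)"
      using ratio eventually_ge_at_top[of 1] by eventually_elim auto
    then obtain N where N: "\<And>n. N \<le> n \<Longrightarrow> B (Suc n) < R * B n \<and> 1 \<le> n \<and> real n * trunc2 \<mu> (1 / B n) \<le> C
        \<and> c * (1 / (a * R)) \<le> real n * trunc2 \<mu> (1 / (a * R) / B n)"
      by (auto simp: eventually_sequentially)
    show ?thesis using eventually_ge_at_top[of "B N"]
    proof eventually_elim
      case (elim y)
      then have y: "0 < y" using B[of N] by linarith
      define m where "m = (LEAST m. N \<le> m \<and> y < B m)"
      have "\<forall>\<^sub>F m in sequentially. N \<le> m \<and> y < B m"
        using B_top[of y] eventually_ge_at_top[of N] by eventually_elim auto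
      then have "\<exists>m. N \<le> m \<and> y < B m" by (auto simp: eventually_sequentially)
      then have m: "N \<le> m" "y < B m" using LeastI_ex[of "\<lambda>m. N \<le> m \<and> y < B m"] unfolding m_def by auto
      have "m \<noteq> N" using elim m by auto
      then obtain n where mn: "m = Suc n" "N \<le> n" using m by (cases m) auto
      have "\<not> (N \<le> n \<and> y < B n)"
        using not_less_Least[of n "\<lambda>m. N \<le> m \<and> y < B m"] mn(1) unfolding m_def by simp
      then have n: "B n \<le> y" "y < R * B n" using mn m N[of n] by auto
      have pos: "0 < real n" using N[OF mn(2)] by auto
      have "c' * trunc2 \<mu> (1 / y) \<le> c / (C * R) * trunc2 \<mu> (1 / B n)"
        using c' n B[of n] y cC R
        by (intro mult_mono trunc2_mono trunc2_nonneg) (auto simp: field_simps)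
      also have "\<dots> \<le> c / (C * R) * (C / real n)"
        using N[OF mn(2)] pos cC R by (intro mult_left_mono) (auto simp: field_simps)
      finally have "c' * trunc2 \<mu> (1 / y) / a \<le> c / (C * R) * (C / real n) / a"
        using a by (intro divide_right_mono) auto
      also have "\<dots> = c * (1 / (a * R)) / real n"
        using cC R a pos by (simp add: field_simps)
      also have "\<dots> \<le> trunc2 \<mu> (1 / (a * R) / B n)"
        using N[OF mn(2)] pos by (metis mult.commute pos_divide_le_eq)
      also have "\<dots> \<le> trunc2 \<mu> (1 / (a * y))"
        using a R B[of n] y n by (intro trunc2_mono) (auto simp: field_simps)
      finally show ?case .
    qed
  qed
  have pos: "0 < trunc2 \<mu> (1 / y)" if y: "0 < y" for y
  proof -
    have "\<forall>\<^sub>F n in sequentially. 0 < trunc2 \<mu> (1 / B n) \<and> y < B n"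
      using lower[of 1, simplified] B_top[of y]
    proof eventually_elim
      case (elim n)
      have "trunc2 \<mu> (1 / B n) \<noteq> 0" using elim cC by auto
      then show ?case using elim trunc2_nonneg[of "1 / B n"] by simp
    qed
    then obtain n where n: "0 < trunc2 \<mu> (1 / B n)" "y < B n" by (auto simp: eventually_sequentially)
    have "trunc2 \<mu> (1 / B n) \<le> trunc2 \<mu> (1 / y)"
      using n y B[of n] by (intro trunc2_mono) (auto simp: field_simps)
    then show ?thesis using n by simp
  qed
  show thesis using that[OF c'(1,2)] scale pos by blast
qed

text \<open>The sum adds up the gaps between the dyadic multiples of \<open>y\<close> that lie below \<open>x\<close>.\<close>

lemma dyadic_excess:
  fixes x y :: real and k :: nat
  assumes "0 \<le> y"
  shows "(\<Sum>j=1..k. 2 ^ (j - 1) * y * indicator {2 ^ j * y<..} x) \<le> max 0 (min x (2 ^ k * y) - y)"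
proof (induction k)
  case (Suc k)
  have step: "L + p * indicator {2 * p<..} x \<le> max 0 (min x (2 * p) - y)"
    if "L \<le> max 0 (min x p - y)" "y \<le> p" "0 \<le> p" for L p :: real
    using that by (auto simp: min_def max_def indicator_def split: if_splits)
  have "y \<le> 2 ^ k * y"
    using assms mult_right_mono[of 1 "2 ^ k" y] by simp
  from step[OF Suc.IH this] assms show ?case by (simp add: mult.assoc)
qed simp

text \<open>By the scaling property \<open>E (min Y (a y))\<^sup>2\<close> grows at least linearly in \<open>a\<close>. For a fixed large \<open>a\<close> it
is at least twice \<open>E (min Y y)\<^sup>2\<close>, and only the mass beyond \<open>y\<close> can supply the gain; so the tail is
comparable with the truncated second moment and inherits its scaling. In particular all dyadic
levels above \<open>y\<close> contribute equally to the mean excess, up to constants: \<open>k\<close> levels give at least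
\<open>c k y P(Y > y)\<close>, and \<open>k\<close> is arbitrary.\<close>

lemma cauchy_domain_tail:
  fixes \<mu> :: "real measure"
  assumes doa: "cauchy_domain_of_attraction \<mu>" and int: "integrable \<mu> (\<lambda>x. x)"
  obtains C where "1 \<le> C"
    "\<forall>\<^sub>F y in at_top. 0 < measure \<mu> {y<..}"
    "\<forall>\<^sub>F y in at_top. measure \<mu> {y<..} \<le> C * measure \<mu> {8 * y<..}"
    "\<forall>\<^sub>F y in at_top. trunc2 \<mu> (1 / y) \<le> C * measure \<mu> {y<..}"
    "((\<lambda>y. y * measure \<mu> {y<..} / (\<integral>x. max 0 (x - y) \<partial>\<mu>)) \<longlongrightarrow> 0) at_top"
proof -
  from doa have rd: "real_distribution \<mu>" and nn: "AE x in \<mu>. 0 \<le> x"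
    by (auto simp: cauchy_domain_of_attraction_def)
  interpret real_distribution \<mu> by (rule rd)
  obtain c where c: "0 < c" "c \<le> 1" and
    scale: "\<forall>a\<ge>1. \<forall>\<^sub>F y in at_top. c * trunc2 \<mu> (1 / y) / a \<le> trunc2 \<mu> (1 / (a * y))"
    and pos: "\<forall>y>0. 0 < trunc2 \<mu> (1 / y)"
    using cauchy_domain_trunc2_scaling[OF doa] by blast
  note scale = scale[rule_format] and pos = pos[rule_format]
  define T where "T y = prob {y<..}" for y
  have T0: "0 \<le> T y" for y by (simp add: T_def)
  have int_ind: "integrable \<mu> (indicator {y<..} :: real \<Rightarrow> real)" for y
    by (rule integrable_const_bound[where B = 1]) (auto simp: indicator_def)
  have T_le: "T y \<le> trunc2 \<mu> (1 / y)" if "0 < y" for y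
  proof -
    have "T y = (\<integral>x. indicator {y<..} x \<partial>\<mu>)" by (simp add: T_def)
    also have "\<dots> \<le> trunc2 \<mu> (1 / y)"
      unfolding trunc2_def
    proof (rule integral_mono)
      fix x
      show "indicator {y<..} x \<le> min 1 ((1 / y * x)\<^sup>2)"
        using that by (auto simp: indicator_def one_le_power)
    qed (use int_ind integrable_trunc2[of "1 / y"] in auto)
    finally show ?thesis .
  qed
  \<comment> \<open>At this factor the growth of the truncated second moment is twice what the mass below \<open>y\<close> accounts for.\<close>
  define a where "a = 2 / c"
  have a: "1 \<le> a" "2 \<le> a" "0 < a" using c by (auto simp: a_def field_simps)
  have trunc: "\<forall>\<^sub>F y in at_top. trunc2 \<mu> (1 / y) \<le> a\<^sup>2 * T y"
    using scale[OF a(1)] eventually_gt_at_top[of 0]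
  proof eventually_elim
    case (elim y)
    have "a\<^sup>2 * trunc2 \<mu> (1 / (a * y)) = (\<integral>x. a\<^sup>2 * min 1 ((1 / (a * y) * x)\<^sup>2) \<partial>\<mu>)"
      by (simp add: trunc2_def)
    also have "\<dots> \<le> (\<integral>x. min 1 ((1 / y * x)\<^sup>2) + a\<^sup>2 * indicator {y<..} x \<partial>\<mu>)"
    proof (rule integral_mono_AE)
      show "AE x in \<mu>. a\<^sup>2 * min 1 ((1 / (a * y) * x)\<^sup>2) \<le> min 1 ((1 / y * x)\<^sup>2) + a\<^sup>2 * indicator {y<..} x"
        using nn
      proof eventually_elim
        case (elim x)
        show ?case
        proof (cases "y < x")
          case True
          have "a\<^sup>2 * min 1 ((1 / (a * y) * x)\<^sup>2) \<le> a\<^sup>2 * 1" by (intro mult_left_mono) auto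
          moreover have "0 \<le> min 1 ((1 / y * x)\<^sup>2)" by simp
          ultimately have "a\<^sup>2 * min 1 ((1 / (a * y) * x)\<^sup>2) \<le> min 1 ((1 / y * x)\<^sup>2) + a\<^sup>2 * 1"
            by linarith
          then show ?thesis using True by simp
        next
          case False
          then have "(1 / y * x)\<^sup>2 \<le> 1" using elim \<open>0 < y\<close> by (intro power_le_one) (auto simp: field_simps)
          moreover have "a\<^sup>2 * min 1 ((1 / (a * y) * x)\<^sup>2) \<le> a\<^sup>2 * (1 / (a * y) * x)\<^sup>2"
            by (intro mult_left_mono) auto
          moreover have "a\<^sup>2 * (1 / (a * y) * x)\<^sup>2 = (1 / y * x)\<^sup>2"
            using a by (simp add: power_mult_distrib power_divide)
          ultimately show ?thesis using False by simp
        qed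
      qed
    qed (use int_ind integrable_trunc2[of "1 / y"] integrable_trunc2[of "1 / (a * y)"] in auto)
    also have "\<dots> = trunc2 \<mu> (1 / y) + a\<^sup>2 * T y"
      using int_ind integrable_trunc2[of "1 / y"] by (simp add: trunc2_def T_def)
    finally have 1: "a\<^sup>2 * trunc2 \<mu> (1 / (a * y)) \<le> trunc2 \<mu> (1 / y) + a\<^sup>2 * T y" .
    have "2 * trunc2 \<mu> (1 / y) = a\<^sup>2 * (c * trunc2 \<mu> (1 / y) / a)"
      using c by (simp add: a_def power2_eq_square field_simps)
    also have "\<dots> \<le> a\<^sup>2 * trunc2 \<mu> (1 / (a * y))"
      using elim by (intro mult_left_mono) auto
    finally show ?case using 1 by linarith
  qed
  have Tpos: "\<forall>\<^sub>F y in at_top. 0 < T y"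
    using trunc eventually_gt_at_top[of 0]
  proof eventually_elim
    case (elim y)
    then have "T y \<noteq> 0" using pos[of y] by auto
    then show ?case using T0[of y] by simp
  qed
  have T_scale: "\<forall>\<^sub>F y in at_top. T y \<le> a\<^sup>2 * k / c * T (k * y)" if k: "1 \<le> k" for k
  proof -
    have "filterlim (\<lambda>y. k * y) at_top at_top"
      using k by real_asymp
    from eventually_compose_filterlim[OF trunc this]
    have "\<forall>\<^sub>F y in at_top. trunc2 \<mu> (1 / (k * y)) \<le> a\<^sup>2 * T (k * y)" .
    then show ?thesis using scale[OF k] eventually_gt_at_top[of 0]
    proof eventually_elim
      case (elim y)
      have "c * T y / k \<le> c * trunc2 \<mu> (1 / y) / k"
        using T_le[of y] elim c k by (intro divide_right_mono mult_left_mono) auto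
      also have "\<dots> \<le> a\<^sup>2 * T (k * y)" using elim by linarith
      finally show ?case using c k by (simp add: field_simps)
    qed
  qed
  have lim: "((\<lambda>y. y * T y / (\<integral>x. max 0 (x - y) \<partial>\<mu>)) \<longlongrightarrow> 0) at_top"
    unfolding tendsto_iff dist_real_def
  proof (intro allI impI)
    fix e :: real assume e: "0 < e"
    obtain k :: nat where k: "2 * a\<^sup>2 / (c * e) < real k" using reals_Archimedean2 by blast
    have "0 < 2 * a\<^sup>2 / (c * e)" using a c e by simp
    with k have k0: "0 < real k" by linarith
    have "\<forall>\<^sub>F y in at_top. \<forall>j\<in>{1..k}. T y \<le> a\<^sup>2 * 2 ^ j / c * T (2 ^ j * y)"
      by (intro eventually_ball_finite ballI T_scale) auto
    then show "\<forall>\<^sub>F y in at_top. \<bar>y * T y / (\<integral>x. max 0 (x - y) \<partial>\<mu>) - 0\<bar> < e"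
      using Tpos eventually_gt_at_top[of 0]
    proof eventually_elim
      case (elim y)
      let ?l = "\<integral>x. max 0 (x - y) \<partial>\<mu>"
      have "(\<Sum>j=1..k. c * y * T y / (2 * a\<^sup>2)) \<le> (\<Sum>j=1..k. 2 ^ (j - 1) * y * T (2 ^ j * y))"
      proof (rule sum_mono)
        fix j assume j: "j \<in> {1..k}"
        then have "T y \<le> a\<^sup>2 * 2 ^ j / c * T (2 ^ j * y)" using elim by blast
        then have "c * y / (2 * a\<^sup>2) * T y \<le> c * y / (2 * a\<^sup>2) * (a\<^sup>2 * 2 ^ j / c * T (2 ^ j * y))"
          using c elim by (intro mult_left_mono) auto
        also have "\<dots> = 2 ^ j / 2 * y * T (2 ^ j * y)"
          using c a by (simp add: field_simps)
        also have "2 ^ j / 2 = (2 ^ (j - 1) :: real)" using j by (cases j) auto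
        finally show "c * y * T y / (2 * a\<^sup>2) \<le> 2 ^ (j - 1) * y * T (2 ^ j * y)" by simp
      qed
      also have "\<dots> = (\<integral>x. (\<Sum>j=1..k. 2 ^ (j - 1) * y * indicator {2 ^ j * y<..} x) \<partial>\<mu>)"
        using int_ind by (subst Bochner_Integration.integral_sum) (auto simp: T_def)
      also have "\<dots> \<le> ?l"
      proof (rule integral_mono)
        show "integrable \<mu> (\<lambda>x. \<Sum>j=1..k. 2 ^ (j - 1) * y * indicator {2 ^ j * y<..} x)"
          by (intro Bochner_Integration.integrable_sum integrable_mult_right int_ind)
        show "integrable \<mu> (\<lambda>x. max 0 (x - y))"
          using int by auto
        fix x
        show "(\<Sum>j=1..k. 2 ^ (j - 1) * y * indicator {2 ^ j * y<..} x) \<le> max 0 (x - y)"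
          using dyadic_excess[where y = y and k = k and x = x] elim by (auto simp: min_def max_def split: if_splits)
      qed
      finally have "real k * (c * (y * T y)) \<le> 2 * a\<^sup>2 * ?l"
        using a by (simp add: field_simps)
      moreover have "2 * a\<^sup>2 * (y * T y) < e * (real k * (c * (y * T y)))"
        using k c e elim by (simp add: field_simps)
      ultimately have "2 * a\<^sup>2 * (y * T y) < e * (2 * a\<^sup>2 * ?l)"
        using e mult_left_mono[of _ _ e] by (smt (verit))
      then have "y * T y < e * ?l" using a by simp
      moreover have "0 < y * T y" using elim by simp
      ultimately have "0 < ?l" using e by (smt (verit) zero_less_mult_iff)
      then show ?case using \<open>y * T y < e * ?l\<close> \<open>0 < y * T y\<close> by (simp add: field_simps)
    qed
  qed
  define C where "C = a\<^sup>2 * 8 / c"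
  have "1 \<le> a\<^sup>2" using a by (intro one_le_power) auto
  moreover have C: "a\<^sup>2 \<le> C"
    using c mult_left_mono[of 1 "8 / c" "a\<^sup>2"] by (simp add: C_def)
  ultimately have C1: "1 \<le> C" by linarith
  show thesis
  proof (rule that[of C])
    show "1 \<le> C" by (rule C1)
    show "\<forall>\<^sub>F y in at_top. 0 < prob {y<..}" using Tpos by (simp add: T_def)
    show "\<forall>\<^sub>F y in at_top. prob {y<..} \<le> C * prob {8 * y<..}"
      using T_scale[of 8] by (simp add: T_def C_def)
    show "\<forall>\<^sub>F y in at_top. trunc2 \<mu> (1 / y) \<le> C * prob {y<..}"
      using trunc
    proof eventually_elim
      case (elim y)
      have "a\<^sup>2 * T y \<le> C * T y" using C T0 by (intro mult_right_mono) auto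
      then show ?case using elim by (simp add: T_def)
    qed
    show "((\<lambda>y. y * prob {y<..} / (\<integral>x. max 0 (x - y) \<partial>\<mu>)) \<longlongrightarrow> 0) at_top"
      using lim by (simp add: T_def)
  qed
qed

section \<open>The likelihood ratio around a single large observation\<close>

lemma sum_ereal_minus_infinity:
  fixes g :: "'i \<Rightarrow> ereal"
  assumes "finite A" "i \<in> A" "g i = - \<infinity>" "\<And>j. g j \<noteq> \<infinity>"
  shows "sum g A = - \<infinity>"
proof -
  have "sum g B \<noteq> \<infinity>" if "finite B" for B
    using that by (induction B) (auto simp: assms(4))
  moreover have "sum g A = g i + sum g (A - {i})"
    using assms by (intro sum.remove) auto
  ultimately show ?thesis using assms by simp
qed

text \<open>The mixture log-likelihood is half the likelihood-ratio statistic plus a term free of \<open>\<theta>\<close>, wherever all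
factors are positive. A maximizer is such a point, since the likelihood is positive at 0.\<close>

lemma mle_maximizes_lr:
  assumes f: "\<And>x. 0 \<le> f x" and mle: "is_mixture_mle f n x \<theta>"
  shows "\<theta> \<in> {0..1}"
    and "\<And>i. i < n \<Longrightarrow> 0 < 1 + \<theta> * (normal_ratio f (x i) - 1)"
    and "\<And>\<eta>. \<eta> \<in> {0..1} \<Longrightarrow> (\<And>i. i < n \<Longrightarrow> 0 < 1 + \<eta> * (normal_ratio f (x i) - 1))
      \<Longrightarrow> lr_statistic f n x \<eta> \<le> lr_statistic f n x \<theta>"
proof -
  let ?\<phi> = std_normal_density and ?h = "normal_ratio f"
  have \<phi>: "0 < ?\<phi> t" for t by (rule normal_density_pos) simp
  from mle show \<theta>: "\<theta> \<in> {0..1}" by (simp add: is_mixture_mle_def is_arg_max_def)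
  have max: "mixture_loglik f n x \<eta> \<le> mixture_loglik f n x \<theta>" if "\<eta> \<in> {0..1}" for \<eta>
    using mle that by (auto simp: is_mixture_mle_def is_arg_max_def not_less)
  have mix: "(1 - \<eta>) * ?\<phi> t + \<eta> * f t = ?\<phi> t * (1 + \<eta> * (?h t - 1))" for \<eta> t
    using \<phi>[of t] by (simp add: field_simps)
  have lik: "mixture_loglik f n x \<eta> = ereal ((\<Sum>i<n. ln (?\<phi> (x i))) + lr_statistic f n x \<eta> / 2)"
    if "\<And>i. i < n \<Longrightarrow> 0 < 1 + \<eta> * (?h (x i) - 1)" for \<eta>
  proof -
    have "mixture_loglik f n x \<eta> = (\<Sum>i<n. ereal (ln (?\<phi> (x i)) + ln (1 + \<eta> * (?h (x i) - 1))))"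
      unfolding mixture_loglik_def
    proof (rule sum.cong[OF refl])
      fix i assume "i \<in> {..<n}"
      then have p: "0 < 1 + \<eta> * (?h (x i) - 1)" using that by simp
      then have "0 < ?\<phi> (x i) * (1 + \<eta> * (?h (x i) - 1))" using \<phi>[of "x i"] by (intro mult_pos_pos)
      then show "ereal_log ((1 - \<eta>) * ?\<phi> (x i) + \<eta> * f (x i)) = ereal (ln (?\<phi> (x i)) + ln (1 + \<eta> * (?h (x i) - 1)))"
        using p \<phi>[of "x i"] unfolding mix ereal_log_def by (simp add: ln_mult_pos)
    qed
    then show ?thesis by (simp add: lr_statistic_def sum.distrib)
  qed
  show pos: "0 < 1 + \<theta> * (?h (x i) - 1)" if "i < n" for i
  proof (rule ccontr)
    assume "\<not> 0 < 1 + \<theta> * (?h (x i) - 1)"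
    then have "\<not> 0 < ?\<phi> (x i) * (1 + \<theta> * (?h (x i) - 1))"
      using \<phi>[of "x i"] by (simp add: zero_less_mult_iff)
    then have "ereal_log ((1 - \<theta>) * ?\<phi> (x i) + \<theta> * f (x i)) = - \<infinity>"
      unfolding mix ereal_log_def by simp
    moreover have "ereal_log u \<noteq> \<infinity>" for u
      by (simp add: ereal_log_def)
    ultimately have "mixture_loglik f n x \<theta> = - \<infinity>"
      unfolding mixture_loglik_def using that by (intro sum_ereal_minus_infinity) auto
    moreover have "mixture_loglik f n x 0 \<noteq> - \<infinity>"
      using lik[of 0] by simp
    ultimately show False using max[of 0] by simp
  qed
  show "lr_statistic f n x \<eta> \<le> lr_statistic f n x \<theta>"
    if "\<eta> \<in> {0..1}" "\<And>i. i < n \<Longrightarrow> 0 < 1 + \<eta> * (?h (x i) - 1)" for \<eta>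
    using max[OF that(1)] lik[OF that(2)] lik[OF pos] by simp
qed

lemma ln_one_plus_lower:
  fixes x :: real
  assumes "- (1 / 2) \<le> x"
  shows "x - 2 * x\<^sup>2 \<le> ln (1 + x)"
proof -
  consider "x < 0" | "0 \<le> x" "x \<le> 1" | "1 < x" by linarith
  then show ?thesis
  proof cases
    case 1
    then show ?thesis using ln_one_minus_pos_lower_bound[of "- x"] assms by simp
  next
    case 2
    then have "x - x\<^sup>2 \<le> ln (1 + x)" by (rule ln_one_plus_pos_lower_bound)
    moreover have "0 \<le> x\<^sup>2" by simp
    ultimately show ?thesis by linarith
  next
    case 3
    then have "x * 1 \<le> x * x" by (intro mult_left_mono) auto
    moreover have "0 \<le> ln (1 + x)" using 3 by simp
    ultimately show ?thesis using 3 unfolding power2_eq_square by linarith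
  qed
qed

text \<open>The bounds \<open>x - 2 x\<^sup>2 \<le> ln (1 + x) \<le> x\<close> reduce the sum to its linear part, up to
\<open>2 (u / b)\<^sup>2\<close> times the sum of squares.\<close>

lemma sum_ln_linear:
  fixes y :: "'i \<Rightarrow> real"
  assumes fin: "finite J" and y: "\<And>j. j \<in> J \<Longrightarrow> 0 \<le> y j" and b: "4 \<le> b" and u: "0 \<le> u" "u \<le> 2"
    and S: "\<bar>(\<Sum>j\<in>J. y j - 1) + b\<bar> \<le> \<eta> * b" and Q: "(\<Sum>j\<in>J. (y j - 1)\<^sup>2) \<le> \<eta> * b\<^sup>2"
  shows "\<bar>(\<Sum>j\<in>J. ln (1 + u / b * (y j - 1))) + u\<bar> \<le> 10 * \<eta>"
proof -
  have \<eta>: "0 \<le> \<eta>"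
    using S b abs_ge_zero[of "(\<Sum>j\<in>J. y j - 1) + b"] by (smt (verit) zero_le_mult_iff)
  have half: "- (1 / 2) \<le> u / b * (y j - 1)" if "j \<in> J" for j
  proof -
    have "u / b \<le> 1 / 2" using u b by (simp add: field_simps)
    moreover have "0 \<le> u / b" using u b by simp
    moreover have "u / b * (- 1) \<le> u / b * (y j - 1)"
      using y[OF that] u b by (intro mult_left_mono) auto
    ultimately show ?thesis by linarith
  qed
  have lin: "\<bar>u / b * (\<Sum>j\<in>J. y j - 1) + u\<bar> \<le> 2 * \<eta>"
  proof -
    have "u / b * (\<Sum>j\<in>J. y j - 1) + u = u / b * ((\<Sum>j\<in>J. y j - 1) + b)"
      using b by (simp add: field_simps)
    then have "\<bar>u / b * (\<Sum>j\<in>J. y j - 1) + u\<bar> = u / b * \<bar>(\<Sum>j\<in>J. y j - 1) + b\<bar>"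
      using u b by (simp only: abs_mult) simp
    also have "\<dots> \<le> u / b * (\<eta> * b)" using u b S by (intro mult_left_mono) auto
    also have "\<dots> = u * \<eta>" using b by simp
    also have "\<dots> \<le> 2 * \<eta>" using u \<eta> by (intro mult_right_mono)
    finally show ?thesis .
  qed
  have "(\<Sum>j\<in>J. ln (1 + u / b * (y j - 1))) \<le> (\<Sum>j\<in>J. u / b * (y j - 1))"
  proof (rule sum_mono)
    fix j assume "j \<in> J"
    then have "- 1 < u / b * (y j - 1)" using half[of j] by linarith
    then show "ln (1 + u / b * (y j - 1)) \<le> u / b * (y j - 1)" by (rule ln_add_one_self_le_self2)
  qed
  also have "\<dots> = u / b * (\<Sum>j\<in>J. y j - 1)" by (simp only: sum_distrib_left)
  finally have up: "(\<Sum>j\<in>J. ln (1 + u / b * (y j - 1))) \<le> u / b * (\<Sum>j\<in>J. y j - 1)" .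
  have "u / b * (\<Sum>j\<in>J. y j - 1) - 2 * (u / b)\<^sup>2 * (\<Sum>j\<in>J. (y j - 1)\<^sup>2)
      = (\<Sum>j\<in>J. u / b * (y j - 1) - 2 * (u / b * (y j - 1))\<^sup>2)"
    unfolding sum_subtractf[of "\<lambda>j. u / b * (y j - 1)" "\<lambda>j. 2 * (u / b * (y j - 1))\<^sup>2"]
    by (simp only: sum_distrib_left power_mult_distrib mult.assoc)
  also have "\<dots> \<le> (\<Sum>j\<in>J. ln (1 + u / b * (y j - 1)))"
    by (intro sum_mono ln_one_plus_lower half)
  finally have lo: "u / b * (\<Sum>j\<in>J. y j - 1) - 2 * (u / b)\<^sup>2 * (\<Sum>j\<in>J. (y j - 1)\<^sup>2)
      \<le> (\<Sum>j\<in>J. ln (1 + u / b * (y j - 1)))" .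
  have "2 * (u / b)\<^sup>2 * (\<Sum>j\<in>J. (y j - 1)\<^sup>2) \<le> 2 * (u / b)\<^sup>2 * (\<eta> * b\<^sup>2)"
    using Q by (intro mult_left_mono) auto
  also have "\<dots> = 2 * u\<^sup>2 * \<eta>" using b by (simp add: power_divide)
  also have "\<dots> \<le> 2 * 2\<^sup>2 * \<eta>"
    using u \<eta> power_mono[of u 2 2] by (intro mult_right_mono mult_left_mono) auto
  finally show ?thesis using up lo lin \<eta> by (simp add: abs_le_iff)
qed

text \<open>A sample with one distinguished observation \<open>i\<close>. The others fall short of their nominal sum by about
\<open>b\<close>, and none of them is of order \<open>b\<close>, because their squares are jointly small.\<close>

locale jump_sample =
  fixes y :: "nat \<Rightarrow> real" and n i :: nat and b \<eta> :: real
  assumes y: "\<And>j. j < n \<Longrightarrow> 0 \<le> y j" and i: "i < n" and jump: "1 \<le> y i" and b: "4 \<le> b" and \<eta>: "\<eta> \<le> 1 / 100"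
    and S: "\<bar>(\<Sum>j\<in>{..<n} - {i}. y j - 1) + b\<bar> \<le> \<eta> * b" and Q: "(\<Sum>j\<in>{..<n} - {i}. (y j - 1)\<^sup>2) \<le> \<eta> * b\<^sup>2"
begin

definition log_ratio :: "real \<Rightarrow> real" where "log_ratio \<theta> = (\<Sum>j<n. ln (1 + \<theta> * (y j - 1)))"

lemma log_ratio_profile:
  assumes "0 \<le> u" "u \<le> 2"
  shows "\<bar>log_ratio (u / b) - (ln (1 + u * ((y i - 1) / b)) - u)\<bar> \<le> 10 * \<eta>"
proof -
  have "log_ratio (u / b) = ln (1 + u / b * (y i - 1)) + (\<Sum>j\<in>{..<n} - {i}. ln (1 + u / b * (y j - 1)))"
    unfolding log_ratio_def using i by (intro sum.remove) auto
  moreover have "\<bar>(\<Sum>j\<in>{..<n} - {i}. ln (1 + u / b * (y j - 1))) + u\<bar> \<le> 10 * \<eta>"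
    using y b S Q assms by (intro sum_ln_linear) auto
  ultimately show ?thesis by (simp add: abs_le_iff)
qed

text \<open>From \<open>u = 1\<close> to \<open>u = 2\<close> the profile \<open>ln (1 + u s) - u\<close> falls by at least \<open>1 - ln 2\<close>, whatever the size \<open>s\<close> of the
jump. The bound on \<open>\<eta>\<close> makes this visible in the sample, and concavity does the rest.\<close>

lemma log_ratio_maximum_near_zero:
  assumes \<theta>: "0 \<le> \<theta>" "\<theta> \<le> 1" and pos: "\<And>j. j < n \<Longrightarrow> 0 < 1 + \<theta> * (y j - 1)"
  obtains u where "0 \<le> u" "u \<le> 2" "log_ratio \<theta> \<le> log_ratio (u / b)"
proof (cases "\<theta> \<le> 2 / b")
  case True
  then show ?thesis using that[of "\<theta> * b"] \<theta> b by (simp add: field_simps)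
next
  case False
  define s where "s = (y i - 1) / b"
  have s: "0 \<le> s" using jump b by (simp add: s_def)
  have "log_ratio (2 / b) \<le> log_ratio (1 / b)"
  proof -
    have "ln (1 + 2 * s) \<le> ln (2 * (1 + s))" using s by (subst ln_le_cancel_iff) auto
    also have "\<dots> = ln 2 + ln (1 + s)" using s by (intro ln_mult_pos) auto
    also have "\<dots> \<le> 25 / 36 + ln (1 + s)" using ln2_le_25_over_36 by simp
    finally show ?thesis using log_ratio_profile[of 2] log_ratio_profile[of 1] \<eta> unfolding s_def by (simp add: abs_le_iff)
  qed
  define \<nu> where "\<nu> = (2 / b - 1 / b) / (\<theta> - 1 / b)"
  have bt: "1 / b < 2 / b" "2 / b < \<theta>" using False b by (auto simp: divide_strict_right_mono)
  then have \<nu>: "0 < \<nu>" "\<nu> < 1"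
    unfolding \<nu>_def by (auto intro!: divide_pos_pos simp only: divide_less_eq_1_pos)
  have lin: "(1 - \<nu>) * (1 + p * w) + \<nu> * (1 + \<theta> * w) = 1 + ((1 - \<nu>) * p + \<nu> * \<theta>) * w" for p w
    by (simp add: algebra_simps)
  have comb: "(1 - \<nu>) * (1 / b) + \<nu> * \<theta> = 2 / b"
  proof -
    have "\<nu> * (\<theta> - 1 / b) = 2 / b - 1 / b" using bt by (simp add: \<nu>_def)
    moreover have *: "(1 - \<nu>) * p + \<nu> * \<theta> = p + \<nu> * (\<theta> - p)" for p
      by (simp add: algebra_simps)
    ultimately show ?thesis using *[of "1 / b"] by linarith
  qed
  have "(1 - \<nu>) * log_ratio (1 / b) + \<nu> * log_ratio \<theta> \<le> log_ratio (2 / b)"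
    unfolding log_ratio_def sum_distrib_left sum.distrib[symmetric]
  proof (rule sum_mono)
    fix j assume j: "j \<in> {..<n}"
    have "1 / b * (- 1) \<le> 1 / b * (y j - 1)" using y j b by (intro mult_left_mono) auto
    moreover have "1 / b < 1" using b by simp
    ultimately have p1: "0 < 1 + 1 / b * (y j - 1)" by linarith
    have "concave_on {0<..} (ln :: real \<Rightarrow> real)" by (rule ln_concave)
    then have "(1 - \<nu>) * ln (1 + 1 / b * (y j - 1)) + \<nu> * ln (1 + \<theta> * (y j - 1))
        \<le> ln ((1 - \<nu>) *\<^sub>R (1 + 1 / b * (y j - 1)) + \<nu> *\<^sub>R (1 + \<theta> * (y j - 1)))"
      using \<nu> p1 pos[of j] j by (intro concave_onD) auto
    also have "(1 - \<nu>) *\<^sub>R (1 + 1 / b * (y j - 1)) + \<nu> *\<^sub>R (1 + \<theta> * (y j - 1))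
        = 1 + ((1 - \<nu>) * (1 / b) + \<nu> * \<theta>) * (y j - 1)"
      unfolding real_scaleR_def by (rule lin)
    finally show "(1 - \<nu>) * ln (1 + 1 / b * (y j - 1)) + \<nu> * ln (1 + \<theta> * (y j - 1))
        \<le> ln (1 + 2 / b * (y j - 1))"
      unfolding comb .
  qed
  moreover have "(1 - \<nu>) * log_ratio (2 / b) \<le> (1 - \<nu>) * log_ratio (1 / b)"
    using \<open>log_ratio (2 / b) \<le> log_ratio (1 / b)\<close> \<nu> by (intro mult_left_mono) auto
  ultimately have "\<nu> * log_ratio \<theta> \<le> \<nu> * log_ratio (2 / b)" by (simp add: algebra_simps)
  then have "log_ratio \<theta> \<le> log_ratio (2 / b)" using \<nu> by simp
  then show ?thesis using that[of 2] by simp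
qed

end

text \<open>At equal \<open>u\<close> the two profiles differ by \<open>ln ((1 + u s) / (1 + u t))\<close>, which is at most
\<open>ln (1 + \<kappa>)\<close> however large the jump is.\<close>

lemma jump_sample_compare:
  assumes "jump_sample y n i b \<eta>" "jump_sample z n i b' \<eta>"
    and \<theta>: "0 \<le> \<theta>" "\<theta> \<le> 1" "\<And>j. j < n \<Longrightarrow> 0 < 1 + \<theta> * (y j - 1)"
    and max: "\<And>\<eta>. 0 \<le> \<eta> \<Longrightarrow> \<eta> < 1 \<Longrightarrow> (\<Sum>j<n. ln (1 + \<eta> * (z j - 1))) \<le> L"
    and \<kappa>: "0 \<le> \<kappa>" "(y i - 1) / b \<le> (1 + \<kappa>) * ((z i - 1) / b')"
  shows "(\<Sum>j<n. ln (1 + \<theta> * (y j - 1))) \<le> L + \<kappa> + 20 * \<eta>"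
proof -
  interpret y: jump_sample y n i b \<eta> by fact
  interpret z: jump_sample z n i b' \<eta> by fact
  obtain u where u: "0 \<le> u" "u \<le> 2" "y.log_ratio \<theta> \<le> y.log_ratio (u / b)"
    using y.log_ratio_maximum_near_zero[OF \<theta>] by blast
  define s t where "s = (y i - 1) / b" and "t = (z i - 1) / b'"
  have st: "0 \<le> s" "0 \<le> t" "s \<le> (1 + \<kappa>) * t"
    using \<kappa> y.jump z.jump y.b z.b by (auto simp: s_def t_def)
  have "1 + u * s \<le> (1 + \<kappa>) * (1 + u * t)"
  proof -
    have "u * s \<le> u * ((1 + \<kappa>) * t)" using st u by (intro mult_left_mono)
    also have "1 + \<dots> \<le> (1 + \<kappa>) * (1 + u * t)" using \<kappa> by (simp add: algebra_simps)
    finally show ?thesis by simp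
  qed
  then have "ln (1 + u * s) \<le> ln ((1 + \<kappa>) * (1 + u * t))"
    using st u by (subst ln_le_cancel_iff) (auto intro!: mult_pos_pos add_pos_nonneg simp: \<kappa>)
  also have "\<dots> = ln (1 + \<kappa>) + ln (1 + u * t)"
    using st u \<kappa> by (intro ln_mult_pos) (auto intro!: add_pos_nonneg)
  also have "ln (1 + \<kappa>) \<le> \<kappa>" using \<kappa> by (intro ln_add_one_self_le_self)
  finally have "ln (1 + u * s) \<le> \<kappa> + ln (1 + u * t)" by simp
  moreover have "z.log_ratio (u / b') \<le> L"
    unfolding z.log_ratio_def using u z.b by (intro max) (auto simp: divide_less_eq)
  ultimately have "y.log_ratio \<theta> \<le> L + \<kappa> + 20 * \<eta>"
    using u y.log_ratio_profile[OF u(1,2)] z.log_ratio_profile[OF u(1,2)] by (simp add: s_def t_def abs_le_iff)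
  then show ?thesis by (simp add: y.log_ratio_def)
qed

section \<open>Independent nonnegative samples\<close>

lemma exp_quadratic_upper:
  fixes x :: real
  assumes "0 \<le> x" "x \<le> c"
  shows "exp x \<le> 1 + x + x\<^sup>2 * exp c"
proof -
  obtain t where t: "\<bar>t\<bar> \<le> \<bar>x\<bar>" "exp x = (\<Sum>m<2. x ^ m / fact m) + exp t / fact 2 * x ^ 2"
    using Maclaurin_exp_le[of x 2] by blast
  have "exp t * x\<^sup>2 \<le> exp c * x\<^sup>2" using t(1) assms by (intro mult_right_mono) auto
  moreover have "0 \<le> exp t * x\<^sup>2" by simp
  moreover have "exp t / 2 * x\<^sup>2 = exp t * x\<^sup>2 / 2" by simp
  ultimately have "exp t / 2 * x\<^sup>2 \<le> x\<^sup>2 * exp c" by (simp only: mult.commute[of "x\<^sup>2"])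
  moreover have "(\<Sum>m<2. x ^ m / fact m) = 1 + x" by (simp add: numeral_2_eq_2)
  ultimately show ?thesis using t(2) by (simp add: fact_numeral)
qed

lemma (in prob_space) second_moment_sum_indep:
  fixes \<xi> :: "'i \<Rightarrow> 'a \<Rightarrow> real"
  assumes "finite J" "indep_vars (\<lambda>_. borel) \<xi> J"
    and "\<And>j \<omega>. j \<in> J \<Longrightarrow> \<omega> \<in> space M \<Longrightarrow> \<bar>\<xi> j \<omega>\<bar> \<le> B" and "\<And>j. j \<in> J \<Longrightarrow> expectation (\<xi> j) = 0"
  shows "expectation (\<lambda>\<omega>. (\<Sum>j\<in>J. \<xi> j \<omega>)\<^sup>2) = (\<Sum>j\<in>J. expectation (\<lambda>\<omega>. (\<xi> j \<omega>)\<^sup>2))"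
  using assms
proof (induction J)
  case (insert i J)
  let ?S = "\<lambda>\<omega>. \<Sum>j\<in>J. \<xi> j \<omega>"
  have meas[measurable]: "\<xi> j \<in> borel_measurable M" if "j \<in> insert i J" for j
    using insert.prems(1) that by (auto simp: indep_vars_def)
  have [measurable]: "\<xi> i \<in> borel_measurable M" "?S \<in> borel_measurable M"
    using meas by (auto intro!: borel_measurable_sum)
  have B: "\<bar>\<xi> i \<omega>\<bar> \<le> B" if "\<omega> \<in> space M" for \<omega> using insert.prems(2) that by blast
  have S: "\<bar>?S \<omega>\<bar> \<le> real (card J) * B" if "\<omega> \<in> space M" for \<omega>
  proof -
    have "\<bar>?S \<omega>\<bar> \<le> (\<Sum>j\<in>J. \<bar>\<xi> j \<omega>\<bar>)" by (rule sum_abs)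
    also have "\<dots> \<le> (\<Sum>j\<in>J. B)" using insert.prems(2) that by (intro sum_mono) auto
    finally show ?thesis by simp
  qed
  have int: "integrable M (\<xi> i)" "integrable M ?S" "integrable M (\<lambda>\<omega>. (\<xi> i \<omega>)\<^sup>2)" "integrable M (\<lambda>\<omega>. (?S \<omega>)\<^sup>2)"
  proof -
    show "integrable M (\<xi> i)" by (rule integrable_const_bound[where B = B]) (use B in auto)
    show "integrable M ?S" by (rule integrable_const_bound[where B = "real (card J) * B"]) (use S in auto)
    have "(\<xi> i \<omega>)\<^sup>2 \<le> B\<^sup>2" if "\<omega> \<in> space M" for \<omega>
      using power_mono[OF B[OF that], of 2] by simp
    then show "integrable M (\<lambda>\<omega>. (\<xi> i \<omega>)\<^sup>2)"
      by (intro integrable_const_bound[where B = "B\<^sup>2"]) auto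
    have "(?S \<omega>)\<^sup>2 \<le> (real (card J) * B)\<^sup>2" if "\<omega> \<in> space M" for \<omega>
      using power_mono[OF S[OF that], of 2] by simp
    then show "integrable M (\<lambda>\<omega>. (?S \<omega>)\<^sup>2)"
      by (intro integrable_const_bound[where B = "(real (card J) * B)\<^sup>2"]) auto
  qed
  have ind: "indep_var borel (\<xi> i) borel ?S"
    using insert by (intro indep_vars_sum) auto
  have prod: "integrable M (\<lambda>\<omega>. \<xi> i \<omega> * ?S \<omega>)" "expectation (\<lambda>\<omega>. \<xi> i \<omega> * ?S \<omega>) = 0"
    using indep_var_integrable[OF ind int(1,2)] indep_var_lebesgue_integral[OF ind int(1,2)] insert.prems(3)[of i]
    by auto
  have "expectation (\<lambda>\<omega>. (\<Sum>j\<in>insert i J. \<xi> j \<omega>)\<^sup>2)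
      = expectation (\<lambda>\<omega>. ((\<xi> i \<omega>)\<^sup>2 + 2 * (\<xi> i \<omega> * ?S \<omega>)) + (?S \<omega>)\<^sup>2)"
    using insert.hyps by (simp add: power2_sum algebra_simps)
  also have "\<dots> = expectation (\<lambda>\<omega>. (\<xi> i \<omega>)\<^sup>2) + expectation (\<lambda>\<omega>. (?S \<omega>)\<^sup>2)"
    using int prod by simp
  also have "expectation (\<lambda>\<omega>. (?S \<omega>)\<^sup>2) = (\<Sum>j\<in>J. expectation (\<lambda>\<omega>. (\<xi> j \<omega>)\<^sup>2))"
    using insert.prems indep_vars_subset[OF insert.prems(1)] by (intro insert.IH) auto
  finally show ?case using insert.hyps by simp
qed simp

locale iid_nonneg = prob_space M for M :: "'a measure" +
  fixes G :: "nat \<Rightarrow> 'a \<Rightarrow> real" and \<mu> :: "real measure"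
  assumes indep: "indep_vars (\<lambda>_. borel) G UNIV"
    and law: "\<And>i. distr M borel (G i) = \<mu>"
    and nonneg: "\<And>i \<omega>. \<omega> \<in> space M \<Longrightarrow> 0 \<le> G i \<omega>"
begin

lemma G_measurable[measurable]: "G i \<in> borel_measurable M"
  using indep by (auto simp: indep_vars_def)

lemma real_distribution_law: "real_distribution \<mu>"
  unfolding law[of 0, symmetric] by (rule real_distribution_distr) simp

lemma expectation_G:
  fixes k :: "real \<Rightarrow> real"
  assumes "k \<in> borel_measurable borel"
  shows "expectation (\<lambda>\<omega>. k (G i \<omega>)) = (\<integral>x. k x \<partial>\<mu>)"
  unfolding law[of i, symmetric] using assms by (simp add: integral_distr)

lemma prob_G:
  assumes "A \<in> sets borel"
  shows "prob {\<omega> \<in> space M. G i \<omega> \<in> A} = measure \<mu> A"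
  unfolding law[of i, symmetric] using assms
  by (subst measure_distr) (auto intro!: arg_cong[where f = prob])

lemma nonneg_law: "AE x in \<mu>. 0 \<le> x"
  unfolding law[of 0, symmetric] by (subst AE_distr_iff) (auto simp: nonneg)

lemma indep_G: "indep_vars (\<lambda>_. borel) (\<lambda>i \<omega>. k (G i \<omega>)) J"
  if "k \<in> borel_measurable borel" for k :: "real \<Rightarrow> real"
  by (rule indep_vars_compose2[OF indep_vars_subset[OF indep subset_UNIV]]) (rule that)

text \<open>Chernoff's bound for the variables truncated at \<open>a\<close>; the two terms of the exponent are the drift and the
truncated second moment. Truncation at the larger level \<open>b\<close> only increases both moments.\<close>

lemma prob_sum_exceeds_without_jump_le:
  assumes l: "0 \<le> l" and a: "0 \<le> a" "a \<le> b"
  shows "prob {\<omega> \<in> space M. (\<forall>j<n. G j \<omega> \<le> a) \<and> real n < (\<Sum>j<n. G j \<omega>)}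
    \<le> exp (- l * (real n * (1 - (\<integral>x. min x b \<partial>\<mu>))) + l\<^sup>2 * exp (l * a) * (real n * (\<integral>x. (min x b)\<^sup>2 \<partial>\<mu>)))"
proof -
  interpret \<mu>: real_distribution \<mu> by (rule real_distribution_law)
  let ?m = "\<integral>x. min x b \<partial>\<mu>" and ?v = "\<integral>x. (min x b)\<^sup>2 \<partial>\<mu>"
  let ?U = "\<lambda>j \<omega>. min (G j \<omega>) a"
  have b: "0 \<le> b" using a by simp
  have i1: "integrable \<mu> (\<lambda>x. min x b)"
    using nonneg_law b by (intro \<mu>.integrable_const_bound[where B = b]) auto
  have i2: "integrable \<mu> (\<lambda>x. (min x b)\<^sup>2)"
    using nonneg_law b by (intro \<mu>.integrable_const_bound[where B = "b\<^sup>2"]) (auto elim!: eventually_mono intro!: power_mono)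
  have i3: "integrable \<mu> (\<lambda>x. exp (l * min x a))"
    using l by (intro \<mu>.integrable_const_bound[where B = "exp (l * a)"]) (auto intro!: mult_left_mono)
  have iM: "integrable M (\<lambda>\<omega>. exp (l * ?U j \<omega>))" for j
    using l by (intro integrable_const_bound[where B = "exp (l * a)"]) (auto intro!: mult_left_mono)
  have mgf: "(\<integral>x. exp (l * min x a) \<partial>\<mu>) \<le> exp (l * ?m + l\<^sup>2 * exp (l * a) * ?v)"
  proof -
    have "(\<integral>x. exp (l * min x a) \<partial>\<mu>) \<le> (\<integral>x. 1 + l * min x b + l\<^sup>2 * exp (l * a) * (min x b)\<^sup>2 \<partial>\<mu>)"
    proof (rule integral_mono_AE)
      show "AE x in \<mu>. exp (l * min x a) \<le> 1 + l * min x b + l\<^sup>2 * exp (l * a) * (min x b)\<^sup>2"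
        using nonneg_law
      proof eventually_elim
        case (elim x)
        have u: "0 \<le> min x a" "min x a \<le> min x b" "min x a \<le> a" using elim a by auto
        have "exp (l * min x a) \<le> 1 + l * min x a + (l * min x a)\<^sup>2 * exp (l * a)"
          using u l by (intro exp_quadratic_upper mult_left_mono mult_nonneg_nonneg) auto
        also have "\<dots> \<le> 1 + l * min x b + (l * min x b)\<^sup>2 * exp (l * a)"
          using u l by (intro add_mono order.refl mult_right_mono power_mono mult_left_mono mult_nonneg_nonneg) auto
        finally show ?case by (simp add: power_mult_distrib mult_ac)
      qed
    qed (use i1 i2 i3 in auto)
    also have "\<dots> = 1 + (l * ?m + l\<^sup>2 * exp (l * a) * ?v)"
      using i1 i2 \<mu>.prob_space by simp
    also have "\<dots> \<le> exp (l * ?m + l\<^sup>2 * exp (l * a) * ?v)" by (rule exp_ge_add_one_self)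
    finally show ?thesis .
  qed
  have "prob {\<omega> \<in> space M. (\<forall>j<n. G j \<omega> \<le> a) \<and> real n < (\<Sum>j<n. G j \<omega>)}
      \<le> prob {\<omega> \<in> space M. exp (l * real n) \<le> (\<Prod>j<n. exp (l * ?U j \<omega>))}"
  proof (rule finite_measure_mono)
    show "{\<omega> \<in> space M. (\<forall>j<n. G j \<omega> \<le> a) \<and> real n < (\<Sum>j<n. G j \<omega>)}
        \<subseteq> {\<omega> \<in> space M. exp (l * real n) \<le> (\<Prod>j<n. exp (l * ?U j \<omega>))}"
    proof safe
      fix \<omega> assume *: "\<forall>j<n. G j \<omega> \<le> a" "real n < (\<Sum>j<n. G j \<omega>)"
      then have "(\<Sum>j<n. G j \<omega>) = (\<Sum>j<n. ?U j \<omega>)" by (intro sum.cong) auto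
      then have "l * real n \<le> l * (\<Sum>j<n. ?U j \<omega>)" using * l by (intro mult_left_mono) auto
      then show "exp (l * real n) \<le> (\<Prod>j<n. exp (l * ?U j \<omega>))"
        by (simp add: sum_distrib_left flip: exp_sum)
    qed
  qed measurable
  also have "\<dots> \<le> expectation (\<lambda>\<omega>. \<Prod>j<n. exp (l * ?U j \<omega>)) / exp (l * real n)"
  proof (rule integral_Markov_inequality_measure[where A = "{}"])
    show "integrable M (\<lambda>\<omega>. \<Prod>j<n. exp (l * ?U j \<omega>))"
      using iM by (intro indep_vars_integrable indep_G) auto
  qed (auto intro!: prod_nonneg)
  also have "expectation (\<lambda>\<omega>. \<Prod>j<n. exp (l * ?U j \<omega>)) = (\<Prod>j<n. expectation (\<lambda>\<omega>. exp (l * ?U j \<omega>)))"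
    using iM by (intro indep_vars_lebesgue_integral indep_G) auto
  also have "\<dots> = (\<integral>x. exp (l * min x a) \<partial>\<mu>) ^ n"
    by (subst expectation_G) auto
  also have "\<dots> \<le> exp (l * ?m + l\<^sup>2 * exp (l * a) * ?v) ^ n"
    by (intro power_mono mgf integral_nonneg_AE) auto
  also have "\<dots> / exp (l * real n) = exp (real n * (l * ?m + l\<^sup>2 * exp (l * a) * ?v) - l * real n)"
    by (simp add: exp_diff exp_of_nat_mult)
  also have "real n * (l * ?m + l\<^sup>2 * exp (l * a) * ?v) - l * real n
      = - l * (real n * (1 - ?m)) + l\<^sup>2 * exp (l * a) * (real n * ?v)"
    by (simp add: algebra_simps)
  finally show ?thesis by (simp add: divide_right_mono)
qed

text \<open>These are the conditions that \<open>jump_sample\<close> imposes on the observations other than \<open>i\<close>.\<close>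

definition regular_away :: "nat \<Rightarrow> nat \<Rightarrow> real \<Rightarrow> real \<Rightarrow> 'a \<Rightarrow> bool" where
  "regular_away n i b \<eta> \<omega> \<longleftrightarrow> \<bar>(\<Sum>j\<in>{..<n} - {i}. G j \<omega> - 1) + b\<bar> \<le> \<eta> * b \<and>
     (\<Sum>j\<in>{..<n} - {i}. (G j \<omega> - 1)\<^sup>2) \<le> \<eta> * b\<^sup>2"

lemma regular_away_measurable[measurable]: "Measurable.pred M (regular_away n i b \<eta>)"
  unfolding regular_away_def by measurable

text \<open>Regularity fails only if another observation exceeds \<open>b\<close>, if the truncated sum deviates from its mean
(Chebyshev), or if the truncated squares are large (Markov).\<close>

lemma prob_not_regular_away:
  assumes b: "0 < b" and \<eta>: "0 < \<eta>" and i: "i < n"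
    and drift: "\<bar>real (n - 1) * ((\<integral>x. min x b \<partial>\<mu>) - 1) + b\<bar> \<le> \<eta> / 2 * b" and n: "real n \<le> \<eta> / 2 * b\<^sup>2"
  shows "prob {\<omega> \<in> space M. \<not> regular_away n i b \<eta> \<omega>}
    \<le> real n * measure \<mu> {b<..} + (4 / \<eta>\<^sup>2 + 2 / \<eta>) * (real n * (\<integral>x. (min x b)\<^sup>2 \<partial>\<mu>) / b\<^sup>2)"
proof -
  interpret \<mu>: real_distribution \<mu> by (rule real_distribution_law)
  let ?m = "\<integral>x. min x b \<partial>\<mu>" and ?v = "\<integral>x. (min x b)\<^sup>2 \<partial>\<mu>" and ?J = "{..<n} - {i}"
  let ?U = "\<lambda>j \<omega>. min (G j \<omega>) b"
  let ?A = "\<lambda>j. {\<omega> \<in> space M. G j \<omega> \<in> {b<..}}"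
  let ?B = "{\<omega> \<in> space M. \<eta> / 2 * b \<le> \<bar>\<Sum>j\<in>?J. ?U j \<omega> - ?m\<bar>}"
  let ?C = "{\<omega> \<in> space M. \<eta> / 2 * b\<^sup>2 \<le> (\<Sum>j\<in>?J. (?U j \<omega>)\<^sup>2)}"
  have card: "card ?J = n - 1" using i by simp
  have bnd: "\<bar>?U j \<omega>\<bar> \<le> b" if "\<omega> \<in> space M" for j \<omega>
    using nonneg[OF that, of j] b by auto
  have iM: "integrable M (?U j)" "integrable M (\<lambda>\<omega>. (?U j \<omega>)\<^sup>2)" for j
  proof -
    show "integrable M (?U j)" using bnd by (intro integrable_const_bound[where B = b]) auto
    have "(?U j \<omega>)\<^sup>2 \<le> b\<^sup>2" if "\<omega> \<in> space M" for \<omega> using power_mono[OF bnd[OF that, of j], of 2] by simp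
    then show "integrable M (\<lambda>\<omega>. (?U j \<omega>)\<^sup>2)" by (intro integrable_const_bound[where B = "b\<^sup>2"]) auto
  qed
  have Em: "expectation (?U j) = ?m" and Ev: "expectation (\<lambda>\<omega>. (?U j \<omega>)\<^sup>2) = ?v" for j
    using expectation_G[of "\<lambda>x. min x b" j] expectation_G[of "\<lambda>x. (min x b)\<^sup>2" j] by simp_all
  have v: "0 \<le> ?v" by (rule integral_nonneg_AE) auto
  have m: "\<bar>?m\<bar> \<le> b"
  proof -
    have "\<bar>?m\<bar> = \<bar>expectation (?U 0)\<bar>" by (simp add: Em)
    also have "\<dots> \<le> expectation (\<lambda>\<omega>. \<bar>?U 0 \<omega>\<bar>)" by (rule integral_abs_bound)
    also have "\<dots> \<le> expectation (\<lambda>\<omega>. b)" using iM bnd by (intro integral_mono) auto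
    finally show ?thesis by (simp add: prob_space)
  qed
  have sub: "{\<omega> \<in> space M. \<not> regular_away n i b \<eta> \<omega>} \<subseteq> (\<Union>j<n. ?A j) \<union> (?B \<union> ?C)"
  proof safe
    fix \<omega> assume \<omega>: "\<omega> \<in> space M" "\<not> regular_away n i b \<eta> \<omega>" "\<omega> \<notin> (\<Union>j<n. ?A j)"
      and C: "\<not> \<eta> / 2 * b\<^sup>2 \<le> (\<Sum>j\<in>?J. (?U j \<omega>)\<^sup>2)"
    show "\<eta> / 2 * b \<le> \<bar>\<Sum>j\<in>?J. ?U j \<omega> - ?m\<bar>"
    proof (rule ccontr)
      assume B: "\<not> \<eta> / 2 * b \<le> \<bar>\<Sum>j\<in>?J. ?U j \<omega> - ?m\<bar>"
      have U: "?U j \<omega> = G j \<omega>" if "j \<in> ?J" for j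
        using \<omega> that by (auto simp: min_def not_less)
      have "(\<Sum>j\<in>?J. G j \<omega> - 1) = (\<Sum>j\<in>?J. (?U j \<omega> - ?m) + (?m - 1))"
        using U by (intro sum.cong) auto
      also have "\<dots> = (\<Sum>j\<in>?J. ?U j \<omega> - ?m) + real (n - 1) * (?m - 1)"
        by (simp only: sum.distrib sum_constant card)
      finally have 0: "(\<Sum>j\<in>?J. G j \<omega> - 1) = (\<Sum>j\<in>?J. ?U j \<omega> - ?m) + real (n - 1) * (?m - 1)" .
      have 1: "\<bar>(\<Sum>j\<in>?J. G j \<omega> - 1) + b\<bar> \<le> \<eta> * b"
      proof -
        let ?D = "\<Sum>j\<in>?J. ?U j \<omega> - ?m" and ?E = "real (n - 1) * (?m - 1) + b"
        have "\<bar>?D + ?E\<bar> \<le> \<bar>?D\<bar> + \<bar>?E\<bar>" by (rule abs_triangle_ineq)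
        also have "\<dots> \<le> \<eta> / 2 * b + \<eta> / 2 * b" using B drift by linarith
        finally show ?thesis unfolding 0 by (simp add: add.assoc)
      qed
      have "(\<Sum>j\<in>?J. (G j \<omega> - 1)\<^sup>2) \<le> (\<Sum>j\<in>?J. (?U j \<omega>)\<^sup>2 + 1)"
      proof (rule sum_mono)
        fix j assume "j \<in> ?J"
        then show "(G j \<omega> - 1)\<^sup>2 \<le> (?U j \<omega>)\<^sup>2 + 1"
          using U[of j] nonneg[OF \<omega>(1), of j] by (simp add: power2_diff)
      qed
      also have "\<dots> = (\<Sum>j\<in>?J. (?U j \<omega>)\<^sup>2) + real (n - 1)"
        using card by (simp add: sum.distrib)
      also have "\<dots> \<le> \<eta> * b\<^sup>2" using C n i by simp
      finally show False using 1 \<omega>(2) by (simp add: regular_away_def)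
    qed
  qed
  have pA: "prob (\<Union>j<n. ?A j) \<le> real n * measure \<mu> {b<..}"
  proof -
    have "prob (\<Union>j<n. ?A j) \<le> (\<Sum>j<n. prob (?A j))"
      by (rule finite_measure_subadditive_finite) auto
    also have "\<dots> = real n * measure \<mu> {b<..}" by (subst prob_G) auto
    finally show ?thesis .
  qed
  have sq: "expectation (\<lambda>\<omega>. (\<Sum>j\<in>?J. ?U j \<omega> - ?m)\<^sup>2) = (\<Sum>j\<in>?J. expectation (\<lambda>\<omega>. (?U j \<omega> - ?m)\<^sup>2))"
  proof (rule second_moment_sum_indep[where B = "2 * b"])
    show "indep_vars (\<lambda>_. borel) (\<lambda>j \<omega>. ?U j \<omega> - ?m) ?J" by (rule indep_G) simp
    show "\<bar>?U j \<omega> - ?m\<bar> \<le> 2 * b" if "\<omega> \<in> space M" for j \<omega>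
      using bnd[OF that, of j] m by linarith
    show "expectation (\<lambda>\<omega>. ?U j \<omega> - ?m) = 0" for j using iM Em by (simp add: prob_space)
  qed simp
  have var: "expectation (\<lambda>\<omega>. (?U j \<omega> - ?m)\<^sup>2) \<le> ?v" for j
    using variance_eq[OF iM[of j]] unfolding Em Ev by simp
  have pB: "prob ?B \<le> real n * ?v / (\<eta> / 2 * b)\<^sup>2"
  proof -
    have bS: "(\<Sum>j\<in>?J. ?U j \<omega> - ?m)\<^sup>2 \<le> (real n * (2 * b))\<^sup>2" if "\<omega> \<in> space M" for \<omega>
    proof -
      have "\<bar>\<Sum>j\<in>?J. ?U j \<omega> - ?m\<bar> \<le> (\<Sum>j\<in>?J. \<bar>?U j \<omega> - ?m\<bar>)" by (rule sum_abs)
      also have "\<dots> \<le> (\<Sum>j\<in>?J. 2 * b)"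
      proof (rule sum_mono)
        fix j show "\<bar>?U j \<omega> - ?m\<bar> \<le> 2 * b" using bnd[OF that, of j] m by linarith
      qed
      also have "\<dots> \<le> real n * (2 * b)" using b i by (simp add: mult_right_mono)
      finally show ?thesis using power_mono[of "\<bar>\<Sum>j\<in>?J. ?U j \<omega> - ?m\<bar>" "real n * (2 * b)" 2] by simp
    qed
    have "prob ?B \<le> expectation (\<lambda>\<omega>. (\<Sum>j\<in>?J. ?U j \<omega> - ?m)\<^sup>2) / (\<eta> / 2 * b)\<^sup>2"
      using bS b \<eta> by (intro second_moment_method integrable_const_bound[where B = "(real n * (2 * b))\<^sup>2"]) auto
    also have "\<dots> \<le> (\<Sum>j\<in>?J. ?v) / (\<eta> / 2 * b)\<^sup>2"
      unfolding sq by (intro divide_right_mono sum_mono var) auto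
    also have "\<dots> \<le> real n * ?v / (\<eta> / 2 * b)\<^sup>2"
      using v i by (intro divide_right_mono) (auto intro!: mult_right_mono)
    finally show ?thesis .
  qed
  have pC: "prob ?C \<le> real n * ?v / (\<eta> / 2 * b\<^sup>2)"
  proof -
    have "prob ?C \<le> expectation (\<lambda>\<omega>. \<Sum>j\<in>?J. (?U j \<omega>)\<^sup>2) / (\<eta> / 2 * b\<^sup>2)"
      using iM b \<eta> by (intro integral_Markov_inequality_measure[where A = "{}"]) (auto intro!: sum_nonneg)
    also have "expectation (\<lambda>\<omega>. \<Sum>j\<in>?J. (?U j \<omega>)\<^sup>2) = (\<Sum>j\<in>?J. ?v)"
      using iM Ev by (subst Bochner_Integration.integral_sum) auto
    also have "\<dots> / (\<eta> / 2 * b\<^sup>2) \<le> real n * ?v / (\<eta> / 2 * b\<^sup>2)"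
      using v i \<eta> by (intro divide_right_mono) (auto intro!: mult_right_mono)
    finally show ?thesis .
  qed
  have "prob {\<omega> \<in> space M. \<not> regular_away n i b \<eta> \<omega>} \<le> prob ((\<Union>j<n. ?A j) \<union> (?B \<union> ?C))"
    by (rule finite_measure_mono[OF sub]) measurable
  also have "\<dots> \<le> prob (\<Union>j<n. ?A j) + prob (?B \<union> ?C)"
    by (rule measure_Un_le) auto
  also have "prob (?B \<union> ?C) \<le> prob ?B + prob ?C"
    by (rule measure_Un_le) auto
  also have "prob (\<Union>j<n. ?A j) + (prob ?B + prob ?C)
      \<le> real n * measure \<mu> {b<..} + (real n * ?v / (\<eta> / 2 * b)\<^sup>2 + real n * ?v / (\<eta> / 2 * b\<^sup>2))"
    using pA pB pC by linarith
  also have "real n * ?v / (\<eta> / 2 * b)\<^sup>2 + real n * ?v / (\<eta> / 2 * b\<^sup>2) = (4 / \<eta>\<^sup>2 + 2 / \<eta>) * (real n * ?v / b\<^sup>2)"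
    using b \<eta> by (simp add: field_simps power2_eq_square)
  finally show ?thesis by simp
qed

end

section \<open>The scale at which one jump decides\<close>

lemma (in prob_space) prob_one_coordinate_and_rest:
  fixes X :: "nat \<Rightarrow> 'a \<Rightarrow> real" and g k :: "real \<Rightarrow> real"
  assumes X: "indep_vars (\<lambda>_. borel) X UNIV" and J: "finite J" "i \<notin> J"
    and [measurable]: "g \<in> borel_measurable borel" "k \<in> borel_measurable borel" "A \<in> sets borel"
      "Measurable.pred (borel \<Otimes>\<^sub>M borel) P"
  shows "prob {\<omega> \<in> space M. X i \<omega> \<in> A \<and> P (\<Sum>j\<in>J. g (X j \<omega>), \<Sum>j\<in>J. k (X j \<omega>))}
    = prob {\<omega> \<in> space M. X i \<omega> \<in> A} * prob {\<omega> \<in> space M. P (\<Sum>j\<in>J. g (X j \<omega>), \<Sum>j\<in>J. k (X j \<omega>))}"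
proof -
  let ?Y = "\<lambda>f. (\<Sum>j\<in>J. g (f j), \<Sum>j\<in>J. k (f j))"
  let ?N = "\<Pi>\<^sub>M j\<in>J. (borel :: real measure)"
  have sum_meas: "(\<lambda>f. \<Sum>j\<in>J. h (f j)) \<in> borel_measurable ?N" if "h \<in> borel_measurable borel" for h :: "real \<Rightarrow> real"
  proof (rule borel_measurable_sum)
    fix j assume "j \<in> J"
    then have "(\<lambda>f. f j) \<in> ?N \<rightarrow>\<^sub>M borel"
      using measurable_component_singleton[of j J "\<lambda>_. borel"] by simp
    then show "(\<lambda>f. h (f j)) \<in> borel_measurable ?N" using that by (rule measurable_compose)
  qed
  have Y: "?Y \<in> ?N \<rightarrow>\<^sub>M borel \<Otimes>\<^sub>M borel"
    by (intro measurable_Pair sum_meas assms)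
  let ?A = "{f \<in> space (\<Pi>\<^sub>M j\<in>{i}. borel). f i \<in> A}" and ?B = "{f \<in> space ?N. P (?Y f)}"
  have ind: "indep_var (\<Pi>\<^sub>M j\<in>{i}. borel) (\<lambda>\<omega>. restrict (\<lambda>j. X j \<omega>) {i}) ?N (\<lambda>\<omega>. restrict (\<lambda>j. X j \<omega>) J)"
    using J by (intro indep_var_restrict[OF X]) auto
  have A: "?A \<in> sets (\<Pi>\<^sub>M j\<in>{i}. borel)" by simp
  have B: "?B \<in> sets ?N"
    using measurable_compose[OF Y assms(7)] by (simp add: pred_def)
  have "(\<lambda>\<omega>. (restrict (\<lambda>j. X j \<omega>) {i}, restrict (\<lambda>j. X j \<omega>) J)) -` (?A \<times> ?B) \<inter> space M
      = {\<omega> \<in> space M. X i \<omega> \<in> A \<and> P (\<Sum>j\<in>J. g (X j \<omega>), \<Sum>j\<in>J. k (X j \<omega>))}"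
    by (auto simp: space_PiM)
  moreover have "(\<lambda>\<omega>. restrict (\<lambda>j. X j \<omega>) {i}) -` ?A \<inter> space M = {\<omega> \<in> space M. X i \<omega> \<in> A}"
    by (auto simp: space_PiM)
  moreover have "(\<lambda>\<omega>. restrict (\<lambda>j. X j \<omega>) J) -` ?B \<inter> space M
      = {\<omega> \<in> space M. P (\<Sum>j\<in>J. g (X j \<omega>), \<Sum>j\<in>J. k (X j \<omega>))}"
    by (auto simp: space_PiM)
  ultimately show ?thesis using indep_varD[OF ind A B] by simp
qed

text \<open>The number \<open>\<tau> n\<close> bounds, up to constants, the expected number of observations beyond \<open>b n / 2\<close>, and
\<open>drift\<close> says that truncation at \<open>b n\<close> lowers the expected sum by about \<open>b n\<close>. The constants are left
free, so that two density ratios can share one \<open>\<tau>\<close>.\<close>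

locale jump_scale =
  fixes \<mu> :: "real measure" and b \<tau> :: "nat \<Rightarrow> real"
  assumes b_top: "filterlim b at_top sequentially"
    and \<tau>_pos: "\<forall>\<^sub>F n in sequentially. 0 < \<tau> n" and \<tau>_lim: "\<tau> \<longlonglongrightarrow> 0"
    and second: "\<exists>C. \<forall>\<^sub>F n in sequentially. real n * (\<integral>x. (min x (b n))\<^sup>2 \<partial>\<mu>) \<le> C * (b n)\<^sup>2 * \<tau> n"
    and drift: "(\<lambda>n. real n * (1 - (\<integral>x. min x (b n) \<partial>\<mu>)) / b n) \<longlonglongrightarrow> 1"
    and tail: "\<exists>C. \<forall>\<^sub>F n in sequentially. real n * measure \<mu> {b n / 2<..} \<le> C * \<tau> n"
    and small: "(\<lambda>n. real n / (b n)\<^sup>2) \<longlonglongrightarrow> 0"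

locale one_jump_scale = iid_nonneg M G \<mu> + jump_scale \<mu> b \<tau>
  for M :: "'a measure" and G \<mu> b \<tau>
begin

lemma b_eventually_gt: "\<forall>\<^sub>F n in sequentially. Z < b n"
  using b_top by (simp add: filterlim_at_top_dense)

text \<open>The sum has to make up for the drift \<open>b\<close> with steps of at most \<open>b / 2\<close>, that is with at least two of them.
At \<open>l = (3/2) ln (1/\<tau>) / b\<close> the drift contributes \<open>\<tau>\<close> to a power close to 3/2 in Chernoff's bound, for which
5/4 is a safe value, while the quadratic term vanishes like \<open>\<tau>\<^sup>1\<^sup>/\<^sup>4\<close> up to logarithms.\<close>

lemma no_jump_negligible:
  "(\<lambda>n. prob {\<omega> \<in> space M. (\<forall>j<n. G j \<omega> \<le> b n / 2) \<and> real n < (\<Sum>j<n. G j \<omega>)} / \<tau> n) \<longlonglongrightarrow> 0"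
proof -
  obtain C0 where C0: "\<forall>\<^sub>F n in sequentially. real n * (\<integral>x. (min x (b n))\<^sup>2 \<partial>\<mu>) \<le> C0 * (b n)\<^sup>2 * \<tau> n"
    using second by blast
  define C where "C = max C0 1"
  have C: "0 < C" "C0 \<le> C" by (auto simp: C_def)
  let ?p = "\<lambda>n. prob {\<omega> \<in> space M. (\<forall>j<n. G j \<omega> \<le> b n / 2) \<and> real n < (\<Sum>j<n. G j \<omega>)}"
  let ?g = "\<lambda>L. exp (- (1 / 4) * L + 9 / 4 * L\<^sup>2 * exp (- (1 / 4) * L) * C)"
  have L_top: "filterlim (\<lambda>n. - ln (\<tau> n)) at_top sequentially"
  proof -
    have "filterlim \<tau> (at_right 0) sequentially"
      by (rule tendsto_imp_filterlim_at_right[OF \<tau>_lim \<tau>_pos])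
    then have "filterlim (\<lambda>n. ln (\<tau> n)) at_bot sequentially"
      by (rule filterlim_compose[OF ln_at_0])
    then show ?thesis by (simp only: filterlim_uminus_at_bot)
  qed
  have "((\<lambda>L::real. 9 / 4 * L\<^sup>2 * exp (- (1 / 4) * L)) \<longlongrightarrow> 0) at_top" by real_asymp
  moreover have "((\<lambda>L::real. exp (- (1 / 4) * L)) \<longlongrightarrow> 0) at_top" by real_asymp
  ultimately have "((\<lambda>L. exp (- (1 / 4) * L) * exp (9 / 4 * L\<^sup>2 * exp (- (1 / 4) * L) * C)) \<longlongrightarrow> 0 * exp (0 * C)) at_top"
    by (intro tendsto_intros)
  then have "(?g \<longlongrightarrow> 0) at_top" by (simp only: exp_add mult_zero_left)
  then have lim: "(\<lambda>n. ?g (- ln (\<tau> n))) \<longlonglongrightarrow> 0" by (rule filterlim_compose[OF _ L_top])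
  have "\<forall>\<^sub>F n in sequentially. 5 / 6 < real n * (1 - (\<integral>x. min x (b n) \<partial>\<mu>)) / b n"
    using drift by (rule order_tendstoD) simp
  moreover have "\<forall>\<^sub>F n in sequentially. \<tau> n < 1"
    using \<tau>_lim by (rule order_tendstoD) simp
  ultimately have upper: "\<forall>\<^sub>F n in sequentially. ?p n / \<tau> n \<le> ?g (- ln (\<tau> n))"
    using C0 \<tau>_pos b_eventually_gt[of 0]
  proof eventually_elim
    case (elim n)
    define L where "L = - ln (\<tau> n)"
    define l where "l = 3 / 2 * L / b n"
    let ?m = "\<integral>x. min x (b n) \<partial>\<mu>" and ?v = "\<integral>x. (min x (b n))\<^sup>2 \<partial>\<mu>"
    have L: "0 < L" "\<tau> n = exp (- L)" using elim(2,4) by (auto simp: L_def)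
    have l: "0 \<le> l" "l * b n = 3 / 2 * L" using L elim(5) by (auto simp: l_def)
    have "?p n \<le> exp (- l * (real n * (1 - ?m)) + l\<^sup>2 * exp (l * (b n / 2)) * (real n * ?v))"
      using l elim(5) by (intro prob_sum_exceeds_without_jump_le) auto
    also have "\<dots> \<le> exp (- (5 / 4) * L + 9 / 4 * L\<^sup>2 * exp (- (1 / 4) * L) * C)"
    proof (subst exp_le_cancel_iff, rule add_mono)
      have "5 / 6 * b n \<le> real n * (1 - ?m)" using elim(1,5) by (simp add: less_divide_eq)
      then have "l * (5 / 6 * b n) \<le> l * (real n * (1 - ?m))" using l by (intro mult_left_mono)
      moreover have "l * (5 / 6 * b n) = 5 / 4 * L" using l by simp
      ultimately show "- l * (real n * (1 - ?m)) \<le> - (5 / 4) * L" by simp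
      have "real n * ?v \<le> C0 * ((b n)\<^sup>2 * \<tau> n)" using elim(3) by (simp only: mult.assoc)
      also have "\<dots> \<le> C * ((b n)\<^sup>2 * \<tau> n)" using C elim(4) by (intro mult_right_mono) auto
      finally have "l\<^sup>2 * exp (l * (b n / 2)) * (real n * ?v) \<le> l\<^sup>2 * exp (l * (b n / 2)) * (C * ((b n)\<^sup>2 * \<tau> n))"
        by (intro mult_left_mono) auto
      also have "\<dots> = (l * b n)\<^sup>2 * (exp (l * b n / 2) * \<tau> n) * C"
        by (simp add: power_mult_distrib mult_ac)
      also have "exp (l * b n / 2) * \<tau> n = exp (- (1 / 4) * L)"
        unfolding l(2) L(2) by (simp flip: exp_add)
      also have "(l * b n)\<^sup>2 = 9 / 4 * L\<^sup>2" unfolding l(2) by (simp add: power2_eq_square)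
      finally show "l\<^sup>2 * exp (l * (b n / 2)) * (real n * ?v) \<le> 9 / 4 * L\<^sup>2 * exp (- (1 / 4) * L) * C" .
    qed
    finally have "?p n / \<tau> n \<le> exp (- (5 / 4) * L + 9 / 4 * L\<^sup>2 * exp (- (1 / 4) * L) * C) / \<tau> n"
      using elim(4) by (intro divide_right_mono) auto
    also have "\<dots> = ?g L"
      unfolding L(2) exp_diff[symmetric] by (simp add: algebra_simps)
    finally show ?case by (simp add: L_def)
  qed
  have lower: "\<forall>\<^sub>F n in sequentially. 0 \<le> ?p n / \<tau> n"
    using \<tau>_pos by eventually_elim (intro divide_nonneg_pos measure_nonneg)
  show ?thesis by (rule tendsto_sandwich[OF lower upper tendsto_const lim])
qed

lemma prob_not_regular_away_vanishes:
  assumes \<eta>: "0 < \<eta>"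
  obtains \<delta> where "\<delta> \<longlonglongrightarrow> 0"
    "\<forall>\<^sub>F n in sequentially. \<forall>i<n. prob {\<omega> \<in> space M. \<not> regular_away n i (b n) \<eta> \<omega>} \<le> \<delta> n"
proof -
  interpret \<mu>: real_distribution \<mu> by (rule real_distribution_law)
  obtain C1 where C1: "\<forall>\<^sub>F n in sequentially. real n * measure \<mu> {b n / 2<..} \<le> C1 * \<tau> n" using tail by blast
  obtain C2 where C2: "\<forall>\<^sub>F n in sequentially. real n * (\<integral>x. (min x (b n))\<^sup>2 \<partial>\<mu>) \<le> C2 * (b n)\<^sup>2 * \<tau> n"
    using second by blast
  define \<delta> where "\<delta> n = C1 * \<tau> n + (4 / \<eta>\<^sup>2 + 2 / \<eta>) * (C2 * \<tau> n)" for n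
  have "\<delta> \<longlonglongrightarrow> C1 * 0 + (4 / \<eta>\<^sup>2 + 2 / \<eta>) * (C2 * 0)"
    unfolding \<delta>_def by (intro tendsto_intros \<tau>_lim)
  then have lim: "\<delta> \<longlonglongrightarrow> 0" by simp
  have "\<forall>\<^sub>F n in sequentially. 1 - min (1 / 2) (\<eta> / 4) < real n * (1 - (\<integral>x. min x (b n) \<partial>\<mu>)) / b n"
    using drift by (rule order_tendstoD) (use \<eta> in auto)
  moreover have "\<forall>\<^sub>F n in sequentially. real n * (1 - (\<integral>x. min x (b n) \<partial>\<mu>)) / b n < 1 + \<eta> / 4"
    using drift by (rule order_tendstoD) (use \<eta> in auto)
  moreover have "\<forall>\<^sub>F n in sequentially. real n / (b n)\<^sup>2 < \<eta> / 2"
    using small by (rule order_tendstoD) (use \<eta> in auto)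
  ultimately have "\<forall>\<^sub>F n in sequentially. \<forall>i<n. prob {\<omega> \<in> space M. \<not> regular_away n i (b n) \<eta> \<omega>} \<le> \<delta> n"
    using C1 C2 b_eventually_gt[of 0] b_eventually_gt[of "4 / \<eta>"] eventually_ge_at_top[of 1]
  proof eventually_elim
    case (elim n)
    let ?m = "\<integral>x. min x (b n) \<partial>\<mu>" and ?v = "\<integral>x. (min x (b n))\<^sup>2 \<partial>\<mu>"
    define r where "r = real n * (1 - ?m) / b n"
    have "1 - min (1 / 2) (\<eta> / 4) < r" "r < 1 + \<eta> / 4" using elim(1,2) unfolding r_def .
    then have r: "1 - \<eta> / 4 < r" "1 / 2 < r" "r < 1 + \<eta> / 4" by (linarith+)
    have rb: "real n * (1 - ?m) = r * b n" using elim(6) by (simp add: r_def)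
    have "0 \<le> ?m" using nonneg_law elim(6) by (intro integral_nonneg_AE) auto
    moreover have "0 < real n * (1 - ?m)" unfolding rb using r elim(6) by (intro mult_pos_pos) auto
    then have "0 < 1 - ?m" using elim(8) by (simp add: zero_less_mult_iff)
    ultimately have m: "0 < 1 - ?m" "1 - ?m \<le> 1" by auto
    have one: "1 \<le> \<eta> / 4 * b n" using elim(7) \<eta> by (simp add: field_simps)
    have "real (n - 1) * (?m - 1) + b n = (1 - r) * b n + (1 - ?m)"
      using rb elim(8) by (simp add: algebra_simps of_nat_diff)
    moreover have "\<bar>(1 - r) * b n\<bar> \<le> \<eta> / 4 * b n"
    proof -
      have "\<bar>(1 - r) * b n\<bar> = \<bar>1 - r\<bar> * b n" using elim(6) by (simp add: abs_mult)
      also have "\<dots> \<le> \<eta> / 4 * b n" using r elim(6) by (intro mult_right_mono) (linarith+)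
      finally show ?thesis .
    qed
    ultimately have d: "\<bar>real (n - 1) * (?m - 1) + b n\<bar> \<le> \<eta> / 2 * b n"
      using m one by linarith
    have nb: "real n \<le> \<eta> / 2 * (b n)\<^sup>2" using elim(3,6) by (simp add: divide_less_eq)
    show ?case
    proof (intro allI impI)
      fix i assume "i < n"
      then have "prob {\<omega> \<in> space M. \<not> regular_away n i (b n) \<eta> \<omega>}
          \<le> real n * measure \<mu> {b n<..} + (4 / \<eta>\<^sup>2 + 2 / \<eta>) * (real n * ?v / (b n)\<^sup>2)"
        using elim(6) \<eta> d nb by (intro prob_not_regular_away) auto
      also have "\<dots> \<le> C1 * \<tau> n + (4 / \<eta>\<^sup>2 + 2 / \<eta>) * (C2 * \<tau> n)"
      proof (rule add_mono)
        have "measure \<mu> {b n<..} \<le> measure \<mu> {b n / 2<..}"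
          using elim(6) by (intro \<mu>.finite_measure_mono) auto
        then have "real n * measure \<mu> {b n<..} \<le> real n * measure \<mu> {b n / 2<..}" by (intro mult_left_mono) auto
        then show "real n * measure \<mu> {b n<..} \<le> C1 * \<tau> n" using elim(4) by linarith
        have "real n * ?v / (b n)\<^sup>2 \<le> C2 * \<tau> n" using elim(5,6) by (simp add: divide_le_eq mult_ac)
        then show "(4 / \<eta>\<^sup>2 + 2 / \<eta>) * (real n * ?v / (b n)\<^sup>2) \<le> (4 / \<eta>\<^sup>2 + 2 / \<eta>) * (C2 * \<tau> n)"
          using \<eta> by (intro mult_left_mono) auto
      qed
      finally show "prob {\<omega> \<in> space M. \<not> regular_away n i (b n) \<eta> \<omega>} \<le> \<delta> n" by (simp add: \<delta>_def)
    qed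
  qed
  then show thesis using lim that by blast
qed

text \<open>An observation beyond \<open>4 b\<close> carries the sum past \<open>n\<close> when the others are regular. These events are disjoint
for different \<open>i\<close>, because regularity keeps all other observations below \<open>1 + b\<close>; so their
probabilities add up.\<close>

lemma prob_sum_exceeds_lower:
  assumes "\<exists>c>0. \<forall>\<^sub>F n in sequentially. c * \<tau> n \<le> real n * measure \<mu> {4 * b n<..}"
  shows "\<exists>c>0. \<forall>\<^sub>F n in sequentially. c * \<tau> n \<le> prob {\<omega> \<in> space M. real n < (\<Sum>j<n. G j \<omega>)}"
proof -
  obtain c where c: "0 < c" "\<forall>\<^sub>F n in sequentially. c * \<tau> n \<le> real n * measure \<mu> {4 * b n<..}"
    using assms by blast
  obtain \<delta> where \<delta>: "\<delta> \<longlonglongrightarrow> 0"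
    "\<forall>\<^sub>F n in sequentially. \<forall>i<n. prob {\<omega> \<in> space M. \<not> regular_away n i (b n) 1 \<omega>} \<le> \<delta> n"
    using prob_not_regular_away_vanishes[of 1] by auto
  have "\<forall>\<^sub>F n in sequentially. \<delta> n < 1 / 2" using \<delta>(1) by (rule order_tendstoD) simp
  then have "\<forall>\<^sub>F n in sequentially. c / 2 * \<tau> n \<le> prob {\<omega> \<in> space M. real n < (\<Sum>j<n. G j \<omega>)}"
    using c(2) \<delta>(2) b_eventually_gt[of 1]
  proof eventually_elim
    case (elim n)
    let ?A = "\<lambda>i. {\<omega> \<in> space M. G i \<omega> \<in> {4 * b n<..} \<and> regular_away n i (b n) 1 \<omega>}"
    have disj: "disjoint_family_on ?A {..<n}"
      unfolding disjoint_family_on_def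
    proof (intro ballI impI equals0I)
      fix i k \<omega> assume ik: "i \<in> {..<n}" "k \<in> {..<n}" "i \<noteq> k" and \<omega>: "\<omega> \<in> ?A i \<inter> ?A k"
      have "(G k \<omega> - 1)\<^sup>2 \<le> (\<Sum>j\<in>{..<n} - {i}. (G j \<omega> - 1)\<^sup>2)"
        using ik by (intro member_le_sum) auto
      also have "\<dots> \<le> (b n)\<^sup>2" using \<omega> by (simp add: regular_away_def)
      finally have "\<bar>G k \<omega> - 1\<bar> \<le> \<bar>b n\<bar>" by (simp add: abs_le_square_iff)
      then show False using \<omega> elim by auto
    qed
    have pA: "measure \<mu> {4 * b n<..} / 2 \<le> prob (?A i)" if i: "i < n" for i
    proof -
      let ?R = "{\<omega> \<in> space M. regular_away n i (b n) 1 \<omega>}"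
      have "prob (?A i) = prob {\<omega> \<in> space M. G i \<omega> \<in> {4 * b n<..}} * prob ?R"
        using prob_one_coordinate_and_rest[OF indep, of "{..<n} - {i}" i "\<lambda>x. x - 1" "\<lambda>x. (x - 1)\<^sup>2" "{4 * b n<..}"
            "\<lambda>p. \<bar>fst p + b n\<bar> \<le> 1 * b n \<and> snd p \<le> 1 * (b n)\<^sup>2"]
        by (simp add: regular_away_def)
      moreover have "prob {\<omega> \<in> space M. G i \<omega> \<in> {4 * b n<..}} = measure \<mu> {4 * b n<..}"
        by (rule prob_G) simp
      moreover have "1 / 2 \<le> prob ?R"
      proof -
        have "prob (space M - ?R) = 1 - prob ?R" by (rule prob_compl) measurable
        moreover have "space M - ?R = {\<omega> \<in> space M. \<not> regular_away n i (b n) 1 \<omega>}" by auto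
        ultimately have "prob ?R = 1 - prob {\<omega> \<in> space M. \<not> regular_away n i (b n) 1 \<omega>}" by simp
        moreover have "prob {\<omega> \<in> space M. \<not> regular_away n i (b n) 1 \<omega>} \<le> \<delta> n" using elim i by blast
        ultimately show ?thesis using elim by linarith
      qed
      then have "measure \<mu> {4 * b n<..} * (1 / 2) \<le> measure \<mu> {4 * b n<..} * prob ?R"
        by (intro mult_left_mono) auto
      ultimately show ?thesis by simp
    qed
    have "c / 2 * \<tau> n \<le> (\<Sum>i<n. measure \<mu> {4 * b n<..} / 2)" using elim by simp
    also have "\<dots> \<le> (\<Sum>i<n. prob (?A i))" using pA by (intro sum_mono) auto
    also have "\<dots> = prob (\<Union>i<n. ?A i)"
      using disj by (intro finite_measure_finite_Union[symmetric]) auto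
    also have "\<dots> \<le> prob {\<omega> \<in> space M. real n < (\<Sum>j<n. G j \<omega>)}"
    proof (rule finite_measure_mono)
      show "(\<Union>i<n. ?A i) \<subseteq> {\<omega> \<in> space M. real n < (\<Sum>j<n. G j \<omega>)}"
      proof
        fix \<omega> assume "\<omega> \<in> (\<Union>i<n. ?A i)"
        then obtain i where i: "i < n" and \<omega>: "\<omega> \<in> space M" "G i \<omega> \<in> {4 * b n<..}" "regular_away n i (b n) 1 \<omega>"
          by blast
        have "(\<Sum>j<n. G j \<omega> - 1) = (G i \<omega> - 1) + (\<Sum>j\<in>{..<n} - {i}. G j \<omega> - 1)"
          using i by (intro sum.remove) auto
        moreover have "\<bar>(\<Sum>j\<in>{..<n} - {i}. G j \<omega> - 1) + b n\<bar> \<le> b n"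
          using \<omega> by (simp add: regular_away_def)
        moreover have "4 * b n < G i \<omega>" using \<omega> by simp
        ultimately have "0 < (\<Sum>j<n. G j \<omega> - 1)" using elim by linarith
        then show "\<omega> \<in> {\<omega> \<in> space M. real n < (\<Sum>j<n. G j \<omega>)}" using \<omega>(1) by (simp add: sum_subtractf)
      qed
    qed measurable
    finally show ?case .
  qed
  then show ?thesis using c(1) by (intro exI[of _ "c / 2"]) auto
qed

end

section \<open>Existence and transfer of the scale\<close>

text \<open>The scale solves \<open>b = n E (Y - b)\<^sup>+\<close>, by the intermediate value theorem. Then
\<open>\<tau> = n P(Y > b) = b P(Y > b) / E (Y - b)\<^sup>+\<close>, which vanishes because the mean excess dominates.\<close>

lemma cauchy_jump_scale:
  assumes doa: "cauchy_domain_of_attraction \<mu>" and int: "integrable \<mu> (\<lambda>x. x)" and mean: "(\<integral>x. x \<partial>\<mu>) = 1"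
  obtains b \<tau> :: "nat \<Rightarrow> real" where "jump_scale \<mu> b \<tau>"
    "\<forall>n. real n * (\<integral>x. max 0 (x - b n) \<partial>\<mu>) = b n"
    "\<exists>c>0. \<forall>\<^sub>F n in sequentially. c * \<tau> n \<le> real n * measure \<mu> {4 * b n<..}"
    "\<exists>C. \<forall>\<^sub>F n in sequentially. real n * measure \<mu> {b n / 4<..} \<le> C * \<tau> n"
    "\<exists>C. \<forall>\<^sub>F n in sequentially. real n \<le> C * (b n)\<^sup>2 * \<tau> n"
proof -
  from doa have rd: "real_distribution \<mu>" and nn: "AE x in \<mu>. 0 \<le> x"
    by (auto simp: cauchy_domain_of_attraction_def)
  interpret real_distribution \<mu> by (rule rd)
  obtain C where C: "1 \<le> C" and
    Tpos: "\<forall>\<^sub>F y in at_top. 0 < prob {y<..}" and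
    T8: "\<forall>\<^sub>F y in at_top. prob {y<..} \<le> C * prob {8 * y<..}" and
    TC: "\<forall>\<^sub>F y in at_top. trunc2 \<mu> (1 / y) \<le> C * prob {y<..}" and
    Tl: "((\<lambda>y. y * prob {y<..} / (\<integral>x. max 0 (x - y) \<partial>\<mu>)) \<longlongrightarrow> 0) at_top"
    using cauchy_domain_tail[OF doa int] by blast
  define T where "T y = prob {y<..}" for y
  define l where "l y = (\<integral>x. max 0 (x - y) \<partial>\<mu>)" for y
  have int_l: "integrable \<mu> (\<lambda>x. max 0 (x - y))" for y
    using int by auto
  have int_ind: "integrable \<mu> (indicator {y<..} :: real \<Rightarrow> real)" for y
    by (rule integrable_const_bound[where B = 1]) (auto simp: indicator_def)
  have T_mono: "T y \<le> T x" if "x \<le> y" for x y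
    unfolding T_def using that by (intro finite_measure_mono) auto
  have T_pos: "0 < T y" for y
  proof -
    have "\<forall>\<^sub>F z in at_top. 0 < T z \<and> y \<le> z"
      using Tpos eventually_ge_at_top[of y] unfolding T_def by eventually_elim simp
    then obtain z where "0 < T z" "y \<le> z" by (auto simp: eventually_at_top_linorder)
    then show ?thesis using T_mono[of y z] by simp
  qed
  have l_mono: "l y \<le> l x" if "x \<le> y" for x y
    unfolding l_def using that int_l by (intro integral_mono) auto
  have l_pos: "0 < l y" for y
  proof -
    have "T (y + 1) = (\<integral>x. indicator {y + 1<..} x \<partial>\<mu>)" by (simp add: T_def)
    also have "\<dots> \<le> l y"
      unfolding l_def by (rule integral_mono[OF int_ind int_l]) (auto simp: indicator_def)
    finally show ?thesis using T_pos[of "y + 1"] by simp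
  qed
  have l_lip: "\<bar>l x - l y\<bar> \<le> \<bar>x - y\<bar>" for x y
  proof -
    have "l x - l y = (\<integral>z. max 0 (z - x) - max 0 (z - y) \<partial>\<mu>)"
      unfolding l_def using int_l by simp
    then have "\<bar>l x - l y\<bar> \<le> (\<integral>z. \<bar>max 0 (z - x) - max 0 (z - y)\<bar> \<partial>\<mu>)"
      using integral_abs_bound[of \<mu> "\<lambda>z. max 0 (z - x) - max 0 (z - y)"] by simp
    also have "\<dots> \<le> (\<integral>z. \<bar>x - y\<bar> \<partial>\<mu>)"
      using int_l by (intro integral_mono) auto
    finally show ?thesis using prob_space by simp
  qed
  have l_cont: "continuous_on S l" for S
    by (rule lipschitz_on_continuous_on[of 1]) (auto intro!: lipschitz_onI simp: dist_real_def l_lip)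
  have "\<exists>y. 0 \<le> y \<and> real n * l y = y" for n
  proof -
    have "l 0 = (\<integral>x. x \<partial>\<mu>)"
      unfolding l_def using nn by (intro integral_cong_AE) (auto elim!: eventually_mono)
    then have "l (real n) \<le> 1" using l_mono[of 0 "real n"] mean by simp
    then have "real n * l (real n) \<le> real n * 1" by (intro mult_left_mono) auto
    then have "\<exists>y\<ge>0. y \<le> real n \<and> y - real n * l y = 0"
      using l_pos[of 0] by (intro IVT') (auto intro!: continuous_intros l_cont)
    then show ?thesis by (metis eq_iff_diff_eq_0)
  qed
  then obtain b where b0: "\<And>n. 0 \<le> b n" and b: "\<And>n. real n * l (b n) = b n" by metis
  define \<tau> where "\<tau> n = real n * T (b n)" for n
  have b_gt: "\<forall>\<^sub>F n in sequentially. Z < b n" for Z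
  proof -
    obtain n0 where n0: "\<bar>Z\<bar> / l Z < real n0" using reals_Archimedean2 by blast
    show ?thesis
      using eventually_ge_at_top[of n0]
    proof eventually_elim
      case (elim n)
      show ?case
      proof (rule ccontr)
        assume "\<not> Z < b n"
        then have "real n * l Z \<le> real n * l (b n)" by (intro mult_left_mono l_mono) auto
        also have "\<dots> = b n" by (rule b)
        finally have "real n * l Z \<le> \<bar>Z\<bar>" using \<open>\<not> Z < b n\<close> by linarith
        then have "real n \<le> \<bar>Z\<bar> / l Z" using l_pos[of Z] by (simp add: pos_le_divide_eq)
        then show False using n0 elim by simp
      qed
    qed
  qed
  then have b_top: "filterlim b at_top sequentially" by (simp add: filterlim_at_top_dense)
  have \<tau>_pos: "\<forall>\<^sub>F n in sequentially. 0 < \<tau> n"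
    using eventually_gt_at_top[of 0] by eventually_elim (simp add: \<tau>_def T_pos)
  have \<tau>_lim: "\<tau> \<longlonglongrightarrow> 0"
  proof -
    have "(\<lambda>n. b n * prob {b n<..} / (\<integral>x. max 0 (x - b n) \<partial>\<mu>)) \<longlonglongrightarrow> 0"
      by (rule filterlim_compose[OF Tl b_top])
    moreover have "b n * prob {b n<..} / (\<integral>x. max 0 (x - b n) \<partial>\<mu>) = \<tau> n" for n
    proof -
      have "b n * T (b n) / l (b n) = real n * l (b n) * T (b n) / l (b n)" by (simp only: b)
      also have "\<dots> = \<tau> n" using l_pos[of "b n"] by (simp add: \<tau>_def)
      finally show ?thesis by (simp add: T_def l_def)
    qed
    ultimately show ?thesis by simp
  qed
  have trunc: "(\<integral>x. (min x y)\<^sup>2 \<partial>\<mu>) = y\<^sup>2 * trunc2 \<mu> (1 / y)" if y: "0 < y" for y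
  proof -
    have "(\<integral>x. (min x y)\<^sup>2 \<partial>\<mu>) = (\<integral>x. y\<^sup>2 * min 1 ((1 / y * x)\<^sup>2) \<partial>\<mu>)"
    proof (rule integral_cong_AE)
      show "AE x in \<mu>. (min x y)\<^sup>2 = y\<^sup>2 * min 1 ((1 / y * x)\<^sup>2)"
        using nn
      proof eventually_elim
        case (elim x)
        show ?case
        proof (cases "x \<le> y")
          case True
          then have "(1 / y * x)\<^sup>2 \<le> 1" using elim y by (intro power_le_one) (auto simp: field_simps)
          then show ?thesis using True y by (simp add: min_absorb2 power_divide)
        next
          case False
          then have "1 \<le> (1 / y * x)\<^sup>2" using y by (intro one_le_power) (auto simp: field_simps)
          then show ?thesis using False by (simp add: min_absorb1)
        qed
      qed
    qed auto
    then show ?thesis by (simp add: trunc2_def)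
  qed
  have second: "\<forall>\<^sub>F n in sequentially. real n * (\<integral>x. (min x (b n))\<^sup>2 \<partial>\<mu>) \<le> C * (b n)\<^sup>2 * \<tau> n"
    using eventually_compose_filterlim[OF TC b_top] b_gt[of 0]
  proof eventually_elim
    case (elim n)
    have "real n * ((b n)\<^sup>2 * trunc2 \<mu> (1 / b n)) \<le> real n * ((b n)\<^sup>2 * (C * T (b n)))"
      using elim(1) unfolding T_def by (intro mult_left_mono) auto
    then show ?case unfolding trunc[OF elim(2)] by (simp add: \<tau>_def mult_ac)
  qed
  have n_le: "\<forall>\<^sub>F n in sequentially. real n \<le> C / T 1 * (b n)\<^sup>2 * \<tau> n"
    using second b_gt[of 1]
  proof eventually_elim
    case (elim n)
    have i2: "integrable \<mu> (\<lambda>x. (min x (b n))\<^sup>2)"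
      using nn elim(2)
      by (intro integrable_const_bound[where B = "(b n)\<^sup>2"]) (auto elim!: eventually_mono intro!: power_mono)
    have "T 1 = (\<integral>x. indicator {1<..} x \<partial>\<mu>)" by (simp add: T_def)
    also have "\<dots> \<le> (\<integral>x. (min x (b n))\<^sup>2 \<partial>\<mu>)"
      using elim(2) by (intro integral_mono[OF int_ind i2]) (auto simp: indicator_def intro!: one_le_power)
    finally have "real n * T 1 \<le> real n * (\<integral>x. (min x (b n))\<^sup>2 \<partial>\<mu>)" by (intro mult_left_mono) auto
    then have "real n * T 1 \<le> C * (b n)\<^sup>2 * \<tau> n" using elim(1) by linarith
    then show ?case using T_pos[of 1] by (simp add: pos_le_divide_eq)
  qed
  have drift: "(\<lambda>n. real n * (1 - (\<integral>x. min x (b n) \<partial>\<mu>)) / b n) \<longlonglongrightarrow> 1"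
  proof (rule tendsto_eventually)
    show "\<forall>\<^sub>F n in sequentially. real n * (1 - (\<integral>x. min x (b n) \<partial>\<mu>)) / b n = 1"
      using b_gt[of 0]
    proof eventually_elim
      case (elim n)
      have "1 - (\<integral>x. min x (b n) \<partial>\<mu>) = (\<integral>x. x - min x (b n) \<partial>\<mu>)"
        using int mean by simp
      also have "\<dots> = l (b n)"
        unfolding l_def by (intro Bochner_Integration.integral_cong) auto
      finally show ?case using b[of n] elim by simp
    qed
  qed
  have half_top: "filterlim (\<lambda>n. b n / 4) at_top sequentially"
    using b_top by (rule filterlim_compose[rotated]) (real_asymp)
  have T4: "\<forall>\<^sub>F n in sequentially. real n * T (b n / 4) \<le> C * \<tau> n"
    using eventually_compose_filterlim[OF T8 half_top] b_gt[of 0]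
  proof eventually_elim
    case (elim n)
    have "T (b n / 4) \<le> C * T (8 * (b n / 4))" using elim(1) unfolding T_def .
    also have "\<dots> \<le> C * T (b n)" using C elim(2) by (intro mult_left_mono T_mono) auto
    finally have "real n * T (b n / 4) \<le> real n * (C * T (b n))" by (intro mult_left_mono) auto
    then show ?case by (simp add: \<tau>_def mult_ac)
  qed
  have T2: "\<forall>\<^sub>F n in sequentially. real n * T (b n / 2) \<le> C * \<tau> n"
    using T4
  proof eventually_elim
    case (elim n)
    have "real n * T (b n / 2) \<le> real n * T (b n / 4)"
      using b0[of n] by (intro mult_left_mono T_mono) auto
    then show ?case using elim by linarith
  qed
  have lower: "\<forall>\<^sub>F n in sequentially. 1 / C * \<tau> n \<le> real n * T (4 * b n)"
    using eventually_compose_filterlim[OF T8 b_top]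
  proof eventually_elim
    case (elim n)
    have "T (b n) \<le> C * T (8 * b n)" using elim unfolding T_def .
    also have "\<dots> \<le> C * T (4 * b n)" using C b0[of n] by (intro mult_left_mono T_mono) auto
    finally have "real n * T (b n) \<le> real n * (C * T (4 * b n))" by (intro mult_left_mono) auto
    then show ?case using C by (simp add: \<tau>_def field_simps)
  qed
  have small: "(\<lambda>n. real n / (b n)\<^sup>2) \<longlonglongrightarrow> 0"
  proof (rule tendsto_sandwich)
    show "\<forall>\<^sub>F n in sequentially. 0 \<le> real n / (b n)\<^sup>2" by simp
    show "\<forall>\<^sub>F n in sequentially. real n / (b n)\<^sup>2 \<le> C / T 1 * \<tau> n"
      using n_le b_gt[of 0]
    proof eventually_elim
      case (elim n)
      then have "real n \<le> C / T 1 * \<tau> n * (b n)\<^sup>2" by (simp only: mult_ac)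
      then show ?case using elim(2) by (simp add: pos_divide_le_eq)
    qed
    show "(\<lambda>n. C / T 1 * \<tau> n) \<longlonglongrightarrow> 0"
      using tendsto_mult_left[OF \<tau>_lim, of "C / T 1"] by simp
  qed simp
  show thesis
  proof (rule that)
    show "jump_scale \<mu> b \<tau>"
    proof (rule jump_scale.intro[OF b_top \<tau>_pos \<tau>_lim _ drift _ small])
      show "\<exists>C. \<forall>\<^sub>F n in sequentially. real n * (\<integral>x. (min x (b n))\<^sup>2 \<partial>\<mu>) \<le> C * (b n)\<^sup>2 * \<tau> n"
        by (rule exI) (rule second)
      show "\<exists>C. \<forall>\<^sub>F n in sequentially. real n * prob {b n / 2<..} \<le> C * \<tau> n"
        using T2 unfolding T_def by (rule exI)
    qed
    show "\<forall>n. real n * (\<integral>x. max 0 (x - b n) \<partial>\<mu>) = b n" using b by (simp add: l_def)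
    have "0 < 1 / C" using C by simp
    with lower show "\<exists>c>0. \<forall>\<^sub>F n in sequentially. c * \<tau> n \<le> real n * prob {4 * b n<..}"
      unfolding T_def by blast
    show "\<exists>C. \<forall>\<^sub>F n in sequentially. real n * prob {b n / 4<..} \<le> C * \<tau> n"
      using T4 unfolding T_def by blast
    show "\<exists>C. \<forall>\<^sub>F n in sequentially. real n \<le> C * (b n)\<^sup>2 * \<tau> n"
      using n_le by blast
  qed
qed

text \<open>Where \<open>h\<close> or \<open>K k\<close> is large, they differ by at most \<open>\<kappa> h\<close>; so their mean excesses over \<open>b\<close> differ by at
most \<open>\<kappa>\<close> times the integral of \<open>h\<close> over \<open>h > b / 2\<close>. That integral is of the order of the mean excess
of \<open>h\<close> itself, and \<open>\<kappa>\<close> is arbitrary.\<close>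

lemma jump_scale_transfer:
  fixes N :: "real measure" and h k :: "real \<Rightarrow> real"
  assumes N: "prob_space N" and sN: "sets N = sets borel"
    and hm: "h \<in> borel_measurable borel" and km: "k \<in> borel_measurable borel"
    and h0: "\<And>x. 0 \<le> h x" and k0: "\<And>x. 0 \<le> k x"
    and inth: "integrable N h" and intk: "integrable N k" "(\<integral>x. k x \<partial>N) = 1"
    and K: "0 < K"
    and close: "\<And>\<kappa>. 0 < \<kappa> \<Longrightarrow> \<exists>r. \<forall>x. r \<le> h x \<or> r \<le> K * k x \<longrightarrow> \<bar>K * k x - h x\<bar> \<le> \<kappa> * h x"
    and scale: "jump_scale (distr N borel h) b \<tau>"
    and b: "\<forall>n. real n * (\<integral>x. max 0 (x - b n) \<partial>distr N borel h) = b n"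
    and T4: "\<exists>C. \<forall>\<^sub>F n in sequentially. real n * measure (distr N borel h) {b n / 4<..} \<le> C * \<tau> n"
    and n_le: "\<exists>C. \<forall>\<^sub>F n in sequentially. real n \<le> C * (b n)\<^sup>2 * \<tau> n"
  shows "jump_scale (distr N borel k) (\<lambda>n. b n / K) \<tau>"
proof -
  interpret prob_space N by (rule N)
  interpret s: jump_scale "distr N borel h" b \<tau> by (rule scale)
  have [measurable_cong]: "sets N = sets borel" by (rule sN)
  have [measurable]: "h \<in> borel_measurable N" "k \<in> borel_measurable N"
    using hm km by (simp_all add: measurable_cong_sets[OF sN refl])
  have Eh: "(\<integral>x. \<phi> x \<partial>distr N borel h) = (\<integral>x. \<phi> (h x) \<partial>N)" if "\<phi> \<in> borel_measurable borel" for \<phi> :: "real \<Rightarrow> real"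
    using that by (intro integral_distr) auto
  have Ek: "(\<integral>x. \<phi> x \<partial>distr N borel k) = (\<integral>x. \<phi> (k x) \<partial>N)" if "\<phi> \<in> borel_measurable borel" for \<phi> :: "real \<Rightarrow> real"
    using that by (intro integral_distr) auto
  have Ph: "measure (distr N borel h) {y<..} = prob {x \<in> space N. y < h x}" for y
    by (subst measure_distr) (auto intro!: arg_cong[where f = prob])
  have Pk: "measure (distr N borel k) {y<..} = prob {x \<in> space N. y < k x}" for y
    by (subst measure_distr) (auto intro!: arg_cong[where f = prob])
  have b_gt: "\<forall>\<^sub>F n in sequentially. Z < b n" for Z
    using s.b_top by (simp add: filterlim_at_top_dense)
  obtain r where r: "\<And>x. r \<le> h x \<or> r \<le> K * k x \<Longrightarrow> \<bar>K * k x - h x\<bar> \<le> 1 * h x"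
    using close[of 1] by auto
  have k_le: "K * k x \<le> 2 * h x" if "r \<le> K * k x" for x
    using r[of x] that by linarith
  define m where "m = max 0 r"
  have k_le_m: "K * k x \<le> 2 * h x + m" for x
    using k_le[of x] h0[of x] by (cases "r \<le> K * k x") (auto simp: m_def)
  obtain C1 where C1: "\<forall>\<^sub>F n in sequentially. real n * (\<integral>x. (min x (b n))\<^sup>2 \<partial>distr N borel h) \<le> C1 * (b n)\<^sup>2 * \<tau> n"
    using s.second by blast
  obtain C2 where C2: "\<forall>\<^sub>F n in sequentially. real n \<le> C2 * (b n)\<^sup>2 * \<tau> n" using n_le by blast
  obtain C3 where C3: "\<forall>\<^sub>F n in sequentially. real n * measure (distr N borel h) {b n / 4<..} \<le> C3 * \<tau> n"
    using T4 by blast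
  obtain C4 where C4: "\<forall>\<^sub>F n in sequentially. real n * measure (distr N borel h) {b n / 2<..} \<le> C4 * \<tau> n"
    using s.tail by blast
  have second: "\<forall>\<^sub>F n in sequentially. real n * (\<integral>x. (min x (b n / K))\<^sup>2 \<partial>distr N borel k)
      \<le> (8 * C1 + 2 * m\<^sup>2 * C2) * (b n / K)\<^sup>2 * \<tau> n"
    using C1 C2 b_gt[of 0]
  proof eventually_elim
    case (elim n)
    let ?v = "\<integral>x. (min (h x) (b n))\<^sup>2 \<partial>N"
    have ih: "integrable N (\<lambda>x. (min (h x) (b n))\<^sup>2)"
      using h0 elim(3) by (intro integrable_const_bound[where B = "(b n)\<^sup>2"]) (auto intro!: power_mono)
    have ik: "integrable N (\<lambda>x. (min (k x) (b n / K))\<^sup>2)"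
      using k0 elim(3) K by (intro integrable_const_bound[where B = "(b n / K)\<^sup>2"]) (auto intro!: power_mono)
    have "(\<integral>x. (min x (b n / K))\<^sup>2 \<partial>distr N borel k) = (\<integral>x. (min (k x) (b n / K))\<^sup>2 \<partial>N)"
      by (rule Ek) simp
    also have "\<dots> \<le> (\<integral>x. (8 * (min (h x) (b n))\<^sup>2 + 2 * m\<^sup>2) / K\<^sup>2 \<partial>N)"
    proof (rule integral_mono)
      fix x
      have "K * min (k x) (b n / K) = min (K * k x) (b n)"
        using K by (simp add: min_def field_simps)
      also have "\<dots> \<le> 2 * min (h x) (b n) + m"
        using k_le_m[of x] elim(3) by (auto simp: min_def m_def)
      finally have "(K * min (k x) (b n / K))\<^sup>2 \<le> (2 * min (h x) (b n) + m)\<^sup>2"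
        using K k0[of x] elim(3) by (intro power_mono) auto
      also have "\<dots> \<le> 8 * (min (h x) (b n))\<^sup>2 + 2 * m\<^sup>2"
        using zero_le_power2[of "2 * min (h x) (b n) - m"] by (simp add: power2_eq_square algebra_simps)
      finally show "(min (k x) (b n / K))\<^sup>2 \<le> (8 * (min (h x) (b n))\<^sup>2 + 2 * m\<^sup>2) / K\<^sup>2"
        using K by (simp add: pos_le_divide_eq power_mult_distrib mult.commute)
    qed (use ih ik in auto)
    also have "\<dots> = (8 * ?v + 2 * m\<^sup>2) / K\<^sup>2"
      using ih by (simp add: prob_space)
    finally have "real n * (\<integral>x. (min x (b n / K))\<^sup>2 \<partial>distr N borel k) \<le> real n * ((8 * ?v + 2 * m\<^sup>2) / K\<^sup>2)"
      by (intro mult_left_mono) auto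
    also have "\<dots> = (8 * (real n * ?v) + 2 * m\<^sup>2 * real n) / K\<^sup>2" by (simp add: algebra_simps)
    also have "\<dots> \<le> (8 * (C1 * (b n)\<^sup>2 * \<tau> n) + 2 * m\<^sup>2 * (C2 * (b n)\<^sup>2 * \<tau> n)) / K\<^sup>2"
    proof (intro divide_right_mono add_mono mult_left_mono)
      have "?v = (\<integral>x. (min x (b n))\<^sup>2 \<partial>distr N borel h)" by (rule Eh[symmetric]) simp
      then show "real n * ?v \<le> C1 * (b n)\<^sup>2 * \<tau> n" using elim(1) by simp
    qed (use elim(2) in auto)
    also have "\<dots> = (8 * C1 + 2 * m\<^sup>2 * C2) * (b n / K)\<^sup>2 * \<tau> n"
      by (simp add: power_divide algebra_simps add_divide_distrib)
    finally show ?case .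
  qed
  have tail: "\<forall>\<^sub>F n in sequentially. real n * measure (distr N borel k) {b n / K / 2<..} \<le> C3 * \<tau> n"
    using C3 b_gt[of "2 * r"]
  proof eventually_elim
    case (elim n)
    have "prob {x \<in> space N. b n / K / 2 < k x} \<le> prob {x \<in> space N. b n / 4 < h x}"
    proof (rule finite_measure_mono)
      show "{x \<in> space N. b n / K / 2 < k x} \<subseteq> {x \<in> space N. b n / 4 < h x}"
      proof
        fix x assume "x \<in> {x \<in> space N. b n / K / 2 < k x}"
        then have x: "x \<in> space N" "b n / 2 < K * k x" using K by (auto simp: field_simps)
        then have "K * k x \<le> 2 * h x" using elim(2) by (intro k_le) auto
        then show "x \<in> {x \<in> space N. b n / 4 < h x}" using x by auto
      qed
    qed measurable
    then have "real n * measure (distr N borel k) {b n / K / 2<..} \<le> real n * measure (distr N borel h) {b n / 4<..}"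
      unfolding Ph Pk by (intro mult_left_mono) auto
    then show ?case using elim(1) by linarith
  qed
  have drift: "(\<lambda>n. real n * (1 - (\<integral>x. min x (b n / K) \<partial>distr N borel k)) / (b n / K)) \<longlonglongrightarrow> 1"
    unfolding tendsto_iff dist_real_def
  proof (intro allI impI)
    fix e :: real assume e: "0 < e"
    define \<kappa> where "\<kappa> = min 1 (e / 8)"
    have \<kappa>: "0 < \<kappa>" "\<kappa> \<le> 1" "4 * \<kappa> < e" using e by (auto simp: \<kappa>_def)
    obtain q where q: "\<And>x. q \<le> h x \<or> q \<le> K * k x \<Longrightarrow> \<bar>K * k x - h x\<bar> \<le> \<kappa> * h x"
      using close[OF \<kappa>(1)] by auto
    have "(\<lambda>n. 2 * C4 * \<tau> n) \<longlonglongrightarrow> 0" using tendsto_mult_left[OF s.\<tau>_lim, of "2 * C4"] by simp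
    then have "\<forall>\<^sub>F n in sequentially. 2 * C4 * \<tau> n < 2" by (rule order_tendstoD) simp
    then show "\<forall>\<^sub>F n in sequentially. \<bar>real n * (1 - (\<integral>x. min x (b n / K) \<partial>distr N borel k)) / (b n / K) - 1\<bar> < e"
      using C4 b_gt[of 0] b_gt[of q]
    proof eventually_elim
      case (elim n)
      let ?H = "\<integral>x. max 0 (h x - b n) \<partial>N" and ?Kk = "\<integral>x. max 0 (K * k x - b n) \<partial>N"
      have iH: "integrable N (\<lambda>x. max 0 (h x - b n))" and iK: "integrable N (\<lambda>x. max 0 (K * k x - b n))"
        using inth intk by auto
      have ind: "integrable N (indicator {x \<in> space N. b n / 2 < h x} :: real \<Rightarrow> real)"
        by (rule integrable_const_bound[where B = 1]) (auto simp: indicator_def)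
      have H: "real n * ?H = b n"
        using b[rule_format, of n] by (subst (asm) Eh) auto
      have "\<bar>?Kk - ?H\<bar> \<le> (\<integral>x. \<bar>max 0 (K * k x - b n) - max 0 (h x - b n)\<bar> \<partial>N)"
        using integral_abs_bound[of N "\<lambda>x. max 0 (K * k x - b n) - max 0 (h x - b n)"] iH iK by simp
      also have "\<dots> \<le> (\<integral>x. \<kappa> * (2 * b n * indicator {x \<in> space N. b n / 2 < h x} x + 2 * max 0 (h x - b n)) \<partial>N)"
      proof (rule integral_mono)
        fix x assume x: "x \<in> space N"
        let ?I = "indicator {x \<in> space N. b n / 2 < h x} x :: real"
        have I: "h x \<le> 2 * b n * ?I + 2 * max 0 (h x - b n)" if "b n / 2 < h x"
          using that x h0[of x] by (simp add: max_def)
        show "\<bar>max 0 (K * k x - b n) - max 0 (h x - b n)\<bar> \<le> \<kappa> * (2 * b n * ?I + 2 * max 0 (h x - b n))"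
        proof (cases "b n < h x \<or> b n < K * k x")
          case True
          then have d: "\<bar>K * k x - h x\<bar> \<le> \<kappa> * h x" using elim(4) by (intro q) auto
          have "\<kappa> * h x \<le> 1 * h x" using \<kappa> h0 by (intro mult_right_mono) auto
          then have "b n / 2 < h x" using True d elim(3) by auto
          then have "\<kappa> * h x \<le> \<kappa> * (2 * b n * ?I + 2 * max 0 (h x - b n))"
            using \<kappa> by (intro mult_left_mono I) auto
          moreover have "\<bar>max 0 (K * k x - b n) - max 0 (h x - b n)\<bar> \<le> \<bar>K * k x - h x\<bar>"
            by (simp add: max_def)
          ultimately show ?thesis using d by linarith
        next
          case False
          have "0 \<le> \<kappa> * (2 * b n * ?I + 2 * max 0 (h x - b n))" using \<kappa> elim(3) by simp
          then show ?thesis using False by simp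
        qed
      qed (use iH iK ind in auto)
      also have "\<dots> = \<kappa> * (2 * b n * prob {x \<in> space N. b n / 2 < h x} + 2 * ?H)"
        using iH ind by simp
      finally have "real n * \<bar>?Kk - ?H\<bar> \<le> real n * (\<kappa> * (2 * b n * prob {x \<in> space N. b n / 2 < h x} + 2 * ?H))"
        by (intro mult_left_mono) auto
      also have "\<dots> = \<kappa> * b n * (2 * (real n * prob {x \<in> space N. b n / 2 < h x})) + 2 * \<kappa> * (real n * ?H)"
        by (simp add: algebra_simps)
      also have "\<dots> \<le> \<kappa> * b n * 2 + 2 * \<kappa> * b n"
        using elim \<kappa> H unfolding Ph by (intro add_mono mult_left_mono) auto
      finally have "real n * \<bar>?Kk - ?H\<bar> \<le> \<kappa> * b n * 2 + 2 * \<kappa> * b n" .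
      have diff: "\<bar>real n * ?Kk - b n\<bar> \<le> 4 * \<kappa> * b n"
      proof -
        have "real n * ?Kk - b n = real n * (?Kk - ?H)" using H by (simp add: right_diff_distrib)
        then have "\<bar>real n * ?Kk - b n\<bar> = real n * \<bar>?Kk - ?H\<bar>" by (simp add: abs_mult)
        then show ?thesis using \<open>real n * \<bar>?Kk - ?H\<bar> \<le> \<kappa> * b n * 2 + 2 * \<kappa> * b n\<close> by simp
      qed
      have "1 - (\<integral>x. min x (b n / K) \<partial>distr N borel k) = (\<integral>x. k x - min (k x) (b n / K) \<partial>N)"
        using intk Ek[of "\<lambda>x. min x (b n / K)"] by simp
      also have "\<dots> = (\<integral>x. max 0 (K * k x - b n) / K \<partial>N)"
        using K by (intro Bochner_Integration.integral_cong) (auto simp: min_def max_def field_simps)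
      finally have X: "1 - (\<integral>x. min x (b n / K) \<partial>distr N borel k) = ?Kk / K" by simp
      have "real n * (1 - (\<integral>x. min x (b n / K) \<partial>distr N borel k)) / (b n / K) - 1 = (real n * ?Kk - b n) / b n"
        unfolding X using K elim(3) by (simp add: field_simps)
      then have "\<bar>real n * (1 - (\<integral>x. min x (b n / K) \<partial>distr N borel k)) / (b n / K) - 1\<bar> \<le> 4 * \<kappa>"
        using diff elim(3) by (simp add: abs_divide pos_divide_le_eq)
      then show ?case using \<kappa> by linarith
    qed
  qed
  have small: "(\<lambda>n. real n / (b n / K)\<^sup>2) \<longlonglongrightarrow> 0"
    using tendsto_mult_left[OF s.small, of "K\<^sup>2"] by (simp add: power_divide mult.commute)
  have top: "filterlim (\<lambda>n. b n / K) at_top sequentially"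
    using s.b_top by (rule filterlim_compose[rotated]) (use K in real_asymp)
  show ?thesis
  proof (rule jump_scale.intro[OF top s.\<tau>_pos s.\<tau>_lim _ drift _ small])
    show "\<exists>C. \<forall>\<^sub>F n in sequentially. real n * (\<integral>x. (min x (b n / K))\<^sup>2 \<partial>distr N borel k)
        \<le> C * (b n / K)\<^sup>2 * \<tau> n"
      by (rule exI) (rule second)
    show "\<exists>C. \<forall>\<^sub>F n in sequentially. real n * measure (distr N borel k) {b n / K / 2<..} \<le> C * \<tau> n"
      by (rule exI) (rule tail)
  qed
qed

section \<open>Density ratios against the normal density\<close>

lemma continuous_AE_zero_imp_zero:
  fixes g :: "real \<Rightarrow> real"
  assumes g: "continuous_on UNIV g" and AE: "AE x in lborel. g x = 0"
  shows "g x = 0"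
proof (rule ccontr)
  assume "g x \<noteq> 0"
  have "open (g -` (- {0}))" using g by (intro open_vimage) auto
  then obtain d where d: "0 < d" "ball x d \<subseteq> g -` (- {0})"
    using \<open>g x \<noteq> 0\<close> by (metis ComplI open_contains_ball singletonD vimageI)
  have "AE y in lborel. y \<notin> ball x d" using AE d(2) by (auto elim!: eventually_mono)
  then have "ball x d \<in> null_sets lborel" by (subst AE_iff_null_sets) auto
  then have "emeasure lborel {x - d<..<x + d} = 0" by (simp add: ball_eq_greaterThanLessThan null_sets_def)
  then show False using d(1) by simp
qed

lemma symmetric_density_even:
  assumes sym: "symmetric_distribution F" and dens: "has_bounded_continuous_density F f"
  shows "f (- x) = f x"
proof -
  from dens have cont: "continuous_on UNIV f" and f0: "\<And>x. 0 \<le> f x" and F: "F = density lborel f"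
    by (auto simp: has_bounded_continuous_density_def)
  have [measurable]: "f \<in> borel_measurable borel" using cont by (rule borel_measurable_continuous_onI)
  have cont': "continuous_on UNIV (\<lambda>x. f (- x))"
    by (intro continuous_on_compose2[OF cont] continuous_intros) auto
  have "density lborel (\<lambda>x. ennreal (f (- x))) = density (distr lborel borel uminus) (\<lambda>x. ennreal (f (- x)))"
    by (simp add: lborel_distr_uminus)
  also have "\<dots> = distr (density lborel (\<lambda>x. ennreal (f x))) borel uminus"
    by (subst density_distr) auto
  also have "\<dots> = F" using sym unfolding symmetric_distribution_def F by simp
  finally have "density lborel (\<lambda>x. ennreal (f (- x))) = density lborel (\<lambda>x. ennreal (f x))" by (simp add: F)
  then have "AE x in lborel. ennreal (f (- x)) = ennreal (f x)"
    by (subst (asm) sigma_finite_measure.density_unique_iff[OF sigma_finite_lborel]) auto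
  then have AE: "AE x in lborel. f (- x) - f x = 0" using f0 by auto
  have "continuous_on UNIV (\<lambda>x. f (- x) - f x)" by (intro continuous_intros cont cont')
  from continuous_AE_zero_imp_zero[OF this AE, of x] show ?thesis by simp
qed

lemma normal_ratio_properties:
  assumes F: "real_distribution F" and dens: "has_bounded_continuous_density F f"
  shows "continuous_on UNIV (normal_ratio f)" and "0 \<le> normal_ratio f x"
    and "integrable (density lborel std_normal_density) (normal_ratio f)"
    and "(\<integral>x. normal_ratio f x \<partial>density lborel std_normal_density) = 1"
proof -
  from dens have cont: "continuous_on UNIV f" and f0: "\<And>x. 0 \<le> f x" and FD: "F = density lborel f"
    by (auto simp: has_bounded_continuous_density_def)
  interpret real_distribution F by (rule F)
  have [measurable]: "f \<in> borel_measurable borel" using cont by (rule borel_measurable_continuous_onI)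
  have \<phi>: "0 < std_normal_density x" for x by (rule normal_density_pos) simp
  have \<phi>_cont: "continuous_on UNIV std_normal_density"
    unfolding std_normal_density_def by (intro continuous_intros) auto
  show "continuous_on UNIV (normal_ratio f)"
    using cont \<phi>_cont \<phi> by (intro continuous_intros) (auto simp: less_imp_neq[symmetric])
  show "0 \<le> normal_ratio f x" using f0[of x] \<phi>[of x] by simp
  have "(\<integral>\<^sup>+x. ennreal (f x) \<partial>lborel) = emeasure F (space F)"
    unfolding FD by (simp add: emeasure_density)
  then have "(\<integral>\<^sup>+x. ennreal (f x) \<partial>lborel) = 1" by (simp only: emeasure_space_1)
  then have f: "has_bochner_integral lborel f 1"
    using f0 by (intro has_bochner_integral_nn_integral) auto
  have eq: "(\<lambda>x. std_normal_density x *\<^sub>R normal_ratio f x) = f"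
    using \<phi> by (auto simp: fun_eq_iff less_imp_neq[symmetric])
  have [measurable]: "normal_ratio f \<in> borel_measurable lborel" by measurable
  have \<phi>_nonneg: "AE x in lborel. 0 \<le> std_normal_density x" using \<phi> by (auto intro!: AE_I2 less_imp_le)
  have "integrable (density lborel std_normal_density) (normal_ratio f)
      \<longleftrightarrow> integrable lborel (\<lambda>x. std_normal_density x *\<^sub>R normal_ratio f x)"
    by (rule integrable_density) (use \<phi>_nonneg in auto)
  then show "integrable (density lborel std_normal_density) (normal_ratio f)"
    unfolding eq using f by (simp add: has_bochner_integral_iff)
  have "(\<integral>x. normal_ratio f x \<partial>density lborel std_normal_density)
      = (\<integral>x. std_normal_density x *\<^sub>R normal_ratio f x \<partial>lborel)"
    by (rule integral_density) (use \<phi>_nonneg in auto)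
  then show "(\<integral>x. normal_ratio f x \<partial>density lborel std_normal_density) = 1"
    unfolding eq using f by (simp add: has_bochner_integral_iff)
qed

lemma ratio_limit_positive:
  fixes f1 f2 :: "real \<Rightarrow> real"
  assumes "\<And>x. 0 \<le> f1 x" "\<And>x. 0 \<le> f2 x" "((\<lambda>x. f1 x / f2 x) \<longlongrightarrow> K) at_top" "K \<noteq> 0"
  shows "0 < K"
proof -
  have "0 \<le> K" using assms by (intro tendsto_lowerbound[OF assms(3)]) (auto intro!: always_eventually)
  then show ?thesis using assms(4) by simp
qed

text \<open>The quotient \<open>h / k\<close> is \<open>f1 / f2\<close>. As \<open>h\<close> and \<open>k\<close> are bounded on compact intervals, large values occur
only far out, where the limit of the quotient applies; evenness covers the negative half-line.\<close>

lemma normal_ratios_close_when_large: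
  fixes f1 f2 :: "real \<Rightarrow> real"
  defines "h \<equiv> normal_ratio f1" and "k \<equiv> normal_ratio f2"
  assumes nonneg: "\<And>x. 0 \<le> h x" "\<And>x. 0 \<le> k x"
    and cont: "continuous_on UNIV h" "continuous_on UNIV k"
    and even: "\<And>x. h (- x) = h x" "\<And>x. k (- x) = k x"
    and ratio: "((\<lambda>x. f1 x / f2 x) \<longlongrightarrow> K) at_top" and K: "0 < K" and \<kappa>: "0 < \<kappa>"
  shows "\<exists>r. \<forall>x. r \<le> h x \<or> r \<le> K * k x \<longrightarrow> \<bar>K * k x - h x\<bar> \<le> \<kappa> * h x"
proof -
  define \<kappa>' where "\<kappa>' = min (K / 2) (\<kappa> * K / 2)"
  have \<kappa>': "0 < \<kappa>'" "\<kappa>' \<le> K / 2" "\<kappa>' \<le> \<kappa> * K / 2" using K \<kappa> by (auto simp: \<kappa>'_def)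
  have hk: "h x / k x = f1 x / f2 x" for x
  proof -
    have "0 < std_normal_density x" by (rule normal_density_pos) simp
    then show ?thesis by (simp add: h_def k_def)
  qed
  from ratio have "\<forall>\<^sub>F x in at_top. \<bar>h x / k x - K\<bar> < \<kappa>'"
    using \<kappa>'(1) unfolding hk tendsto_iff dist_real_def by blast
  then obtain R where R: "\<And>x. R \<le> x \<Longrightarrow> \<bar>h x / k x - K\<bar> < \<kappa>'" by (auto simp: eventually_at_top_linorder)
  have far: "\<bar>K * k x - h x\<bar> \<le> \<kappa> * h x" if "R \<le> x" for x
  proof -
    have "k x \<noteq> 0" using R[OF that] \<kappa>' K by auto
    then have k: "0 < k x" using nonneg(2)[of x] by simp
    have "\<bar>h x / k x - K\<bar> * k x \<le> \<kappa>' * k x" using R[OF that] k by (intro mult_right_mono) auto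
    moreover have "\<bar>h x / k x - K\<bar> * k x = \<bar>K * k x - h x\<bar>"
    proof -
      have "\<bar>h x / k x - K\<bar> * k x = \<bar>(h x / k x - K) * k x\<bar>" using k by (simp add: abs_mult)
      also have "(h x / k x - K) * k x = h x - K * k x" using k by (simp add: left_diff_distrib)
      finally show ?thesis by (simp only: abs_minus_commute)
    qed
    ultimately have d: "\<bar>K * k x - h x\<bar> \<le> \<kappa>' * k x" by simp
    have "\<kappa>' * k x \<le> K / 2 * k x" using \<kappa>' k by (intro mult_right_mono) auto
    then have "K / 2 * k x \<le> h x" using d by linarith
    then have "\<kappa> * (K / 2 * k x) \<le> \<kappa> * h x" using \<kappa> by (intro mult_left_mono) auto
    moreover have "\<kappa>' * k x \<le> \<kappa> * K / 2 * k x" using \<kappa>' k by (intro mult_right_mono) auto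
    ultimately show ?thesis using d by simp
  qed
  have comp: "compact {- \<bar>R\<bar>..\<bar>R\<bar>}" by simp
  obtain m1 where m1: "\<forall>x\<in>{- \<bar>R\<bar>..\<bar>R\<bar>}. h x \<le> m1"
    using compact_imp_bounded[OF compact_continuous_image[OF continuous_on_subset[OF cont(1) subset_UNIV] comp]]
    by (auto simp: bounded_real abs_le_iff)
  obtain m2 where m2: "\<forall>x\<in>{- \<bar>R\<bar>..\<bar>R\<bar>}. k x \<le> m2"
    using compact_imp_bounded[OF compact_continuous_image[OF continuous_on_subset[OF cont(2) subset_UNIV] comp]]
    by (auto simp: bounded_real abs_le_iff)
  show ?thesis
  proof (intro exI allI impI)
    fix x assume x: "max m1 (K * m2) + 1 \<le> h x \<or> max m1 (K * m2) + 1 \<le> K * k x"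
    have "x \<notin> {- \<bar>R\<bar>..\<bar>R\<bar>}"
    proof
      assume "x \<in> {- \<bar>R\<bar>..\<bar>R\<bar>}"
      then have "h x \<le> m1" "K * k x \<le> K * m2" using m1 m2 K by auto
      then show False using x by linarith
    qed
    then have "R \<le> x \<or> R \<le> - x" by auto
    then show "\<bar>K * k x - h x\<bar> \<le> \<kappa> * h x" using far[of x] far[of "- x"] even by auto
  qed
qed

text \<open>The profiles involve \<open>h - 1\<close> and \<open>k - 1\<close>; subtracting 1 costs a relative error that large values absorb.\<close>

lemma excesses_comparable:
  fixes h k :: "'x \<Rightarrow> real"
  assumes close: "\<And>\<kappa>. 0 < \<kappa> \<Longrightarrow> \<exists>r. \<forall>x. r \<le> h x \<or> r \<le> K * k x \<longrightarrow> \<bar>K * k x - h x\<bar> \<le> \<kappa> * h x"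
    and h0: "\<And>x. 0 \<le> h x" and K: "0 < K" and \<kappa>: "0 < \<kappa>" "\<kappa> \<le> 1"
  shows "\<exists>r. \<forall>x. r \<le> h x \<or> r \<le> K * k x \<longrightarrow> 1 \<le> h x \<and> 1 \<le> k x \<and>
    h x - 1 \<le> (1 + \<kappa>) * (K * k x - K) \<and> K * k x - K \<le> (1 + \<kappa>) * (h x - 1)"
proof -
  have "0 < \<kappa> / 4" using \<kappa> by simp
  then obtain r0 where r0: "\<And>x. r0 \<le> h x \<or> r0 \<le> K * k x \<Longrightarrow> \<bar>K * k x - h x\<bar> \<le> \<kappa> / 4 * h x"
    using close by blast
  \<comment> \<open>Beyond \<open>y0\<close>, \<open>\<kappa> / 2\<close> times the value exceeds the constants that the subtraction introduces.\<close>
  define y0 where "y0 = 2 * (1 + \<kappa>) * (1 + K) / \<kappa>"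
  have y0: "\<kappa> / 2 * y0 = (1 + \<kappa>) * (1 + K)" using \<kappa> by (simp add: y0_def)
  have "0 \<le> y0" using \<kappa> K by (simp add: y0_def)
  have "1 + K \<le> (1 + \<kappa>) * (1 + K)" using \<kappa> K mult_right_mono[of 1 "1 + \<kappa>" "1 + K"] by simp
  also have "\<dots> = \<kappa> / 2 * y0" by (rule y0[symmetric])
  also have "\<dots> \<le> 1 / 2 * y0" using \<kappa> \<open>0 \<le> y0\<close> by (intro mult_right_mono) auto
  finally have y0': "2 * (1 + K) \<le> y0" by simp
  show ?thesis
  proof (intro exI allI impI)
    fix x assume x: "max r0 (2 * y0) \<le> h x \<or> max r0 (2 * y0) \<le> K * k x"
    then have d: "\<bar>K * k x - h x\<bar> \<le> \<kappa> / 4 * h x" by (intro r0) auto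
    have "\<kappa> / 4 * h x \<le> 1 / 4 * h x" using \<kappa> h0 by (intro mult_right_mono) auto
    then have y: "y0 \<le> h x" using x d \<open>0 \<le> y0\<close> h0[of x] by linarith
    have yk: "3 / 4 * h x \<le> K * k x" using d \<open>\<kappa> / 4 * h x \<le> 1 / 4 * h x\<close> by linarith
    have big: "(1 + \<kappa>) * (1 + K) \<le> \<kappa> / 2 * h x"
      using y y0 \<kappa> mult_left_mono[of y0 "h x" "\<kappa> / 2"] by linarith
    have "2 * (1 + K) \<le> h x" using y y0' by linarith
    then have "K \<le> 3 / 4 * h x" using K by simp
    then have "K \<le> K * k x" using yk by (rule order_trans)
    then have k1: "1 \<le> k x" using K by simp
    have \<kappa>2: "\<kappa> * (\<kappa> * h x) \<le> \<kappa> * h x"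
      using \<kappa> h0[of x] mult_right_mono[of \<kappa> 1 "\<kappa> * h x"] by simp
    have "h x - \<kappa> / 4 * h x \<le> K * k x" using d by linarith
    then have "(1 + \<kappa>) * (h x - \<kappa> / 4 * h x - K) \<le> (1 + \<kappa>) * (K * k x - K)"
      using \<kappa> by (intro mult_left_mono) auto
    moreover have "h x - 1 \<le> (1 + \<kappa>) * (h x - \<kappa> / 4 * h x - K)"
    proof -
      have "(1 + \<kappa>) * (h x - \<kappa> / 4 * h x - K) = h x + 3 / 4 * (\<kappa> * h x) - \<kappa> * (\<kappa> * h x) / 4 - K - \<kappa> * K"
        by (simp add: field_simps)
      moreover have "1 + \<kappa> + K + \<kappa> * K \<le> (\<kappa> * h x) / 2"
        using big by (simp add: algebra_simps)
      ultimately show ?thesis using \<kappa>2 \<kappa> by linarith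
    qed
    ultimately have 1: "h x - 1 \<le> (1 + \<kappa>) * (K * k x - K)" by linarith
    have "K * k x - K \<le> h x + \<kappa> / 4 * h x - K" using d by linarith
    also have "\<dots> \<le> (1 + \<kappa>) * (h x - 1)"
    proof -
      have "0 \<le> \<kappa> * K" using \<kappa> K by simp
      moreover have "0 \<le> \<kappa> * h x" using \<kappa> h0[of x] by simp
      ultimately show ?thesis using big K by (simp add: algebra_simps)
    qed
    finally show "1 \<le> h x \<and> 1 \<le> k x \<and> h x - 1 \<le> (1 + \<kappa>) * (K * k x - K) \<and> K * k x - K \<le> (1 + \<kappa>) * (h x - 1)"
      using 1 k1 y y0' K by simp
  qed
qed

section \<open>Coupling the two likelihood ratios\<close>

lemma lr_statistics_close:
  assumes f: "\<And>x. 0 \<le> f1 x" "\<And>x. 0 \<le> f2 x"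
    and mle: "is_mixture_mle f1 n x \<theta>1" "is_mixture_mle f2 n x \<theta>2"
    and js: "jump_sample (\<lambda>j. normal_ratio f1 (x j)) n i b \<eta>" "jump_sample (\<lambda>j. normal_ratio f2 (x j)) n i (b / K) \<eta>"
    and K: "0 < K" and \<kappa>: "0 \<le> \<kappa>"
    and cmp: "normal_ratio f1 (x i) - 1 \<le> (1 + \<kappa>) * (K * normal_ratio f2 (x i) - K)"
      "K * normal_ratio f2 (x i) - K \<le> (1 + \<kappa>) * (normal_ratio f1 (x i) - 1)"
  shows "\<bar>lr_statistic f1 n x \<theta>1 - lr_statistic f2 n x \<theta>2\<bar> \<le> 2 * \<kappa> + 40 * \<eta>"
proof -
  interpret h: jump_sample "\<lambda>j. normal_ratio f1 (x j)" n i b \<eta> by fact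
  interpret k: jump_sample "\<lambda>j. normal_ratio f2 (x j)" n i "b / K" \<eta> by fact
  have pos: "0 < 1 + t * (y - 1)" if "0 \<le> t" "t < 1" "0 \<le> y" for t y :: real
  proof -
    have "t * (- 1) \<le> t * (y - 1)" using that by (intro mult_left_mono) auto
    then show ?thesis using that by linarith
  qed
  note m1 = mle_maximizes_lr[OF f(1) mle(1)] and m2 = mle_maximizes_lr[OF f(2) mle(2)]
  have max1: "(\<Sum>j<n. ln (1 + t * (normal_ratio f1 (x j) - 1))) \<le> lr_statistic f1 n x \<theta>1 / 2" if "0 \<le> t" "t < 1" for t
    using m1(3)[of t] pos[OF that h.y] that by (simp add: lr_statistic_def)
  have max2: "(\<Sum>j<n. ln (1 + t * (normal_ratio f2 (x j) - 1))) \<le> lr_statistic f2 n x \<theta>2 / 2" if "0 \<le> t" "t < 1" for t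
    using m2(3)[of t] pos[OF that k.y] that by (simp add: lr_statistic_def)
  have bK: "0 < b" using h.b by linarith
  have c1: "(normal_ratio f1 (x i) - 1) / b \<le> (1 + \<kappa>) * ((normal_ratio f2 (x i) - 1) / (b / K))"
  proof -
    have "(normal_ratio f1 (x i) - 1) / b \<le> (1 + \<kappa>) * (K * normal_ratio f2 (x i) - K) / b"
      using cmp bK by (intro divide_right_mono) auto
    also have "\<dots> = (1 + \<kappa>) * ((normal_ratio f2 (x i) - 1) / (b / K))"
      by (simp add: right_diff_distrib mult.commute)
    finally show ?thesis .
  qed
  have c2: "(normal_ratio f2 (x i) - 1) / (b / K) \<le> (1 + \<kappa>) * ((normal_ratio f1 (x i) - 1) / b)"
  proof -
    have "(normal_ratio f2 (x i) - 1) / (b / K) = (K * normal_ratio f2 (x i) - K) / b"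
      by (simp add: right_diff_distrib left_diff_distrib mult.commute)
    also have "\<dots> \<le> (1 + \<kappa>) * (normal_ratio f1 (x i) - 1) / b"
      using cmp bK by (intro divide_right_mono) auto
    finally show ?thesis by simp
  qed
  have "lr_statistic f1 n x \<theta>1 / 2 \<le> lr_statistic f2 n x \<theta>2 / 2 + \<kappa> + 20 * \<eta>"
    using jump_sample_compare[OF js _ _ m1(2) max2 \<kappa> c1] m1(1) by (simp add: lr_statistic_def)
  moreover have "lr_statistic f2 n x \<theta>2 / 2 \<le> lr_statistic f1 n x \<theta>1 / 2 + \<kappa> + 20 * \<eta>"
    using jump_sample_compare[OF js(2,1) _ _ m2(2) max1 \<kappa> c2] m2(1) by (simp add: lr_statistic_def)
  ultimately show ?thesis by (simp add: abs_le_iff)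
qed

lemma lr_statistic_zero:
  assumes f: "\<And>x. 0 \<le> f x" and mle: "is_mixture_mle f n x \<theta>" and S: "(\<Sum>j<n. normal_ratio f (x j)) \<le> real n"
  shows "lr_statistic f n x \<theta> = 0"
proof -
  note m = mle_maximizes_lr[OF f mle]
  have "(\<Sum>j<n. ln (1 + \<theta> * (normal_ratio f (x j) - 1))) \<le> (\<Sum>j<n. \<theta> * (normal_ratio f (x j) - 1))"
    using m(2) by (intro sum_mono ln_add_one_self_le_self2) (auto simp: field_simps)
  also have "\<dots> = \<theta> * ((\<Sum>j<n. normal_ratio f (x j)) - real n)"
    by (simp add: sum_distrib_left[symmetric] sum_subtractf)
  also have "\<dots> \<le> 0" using m(1) S by (intro mult_nonneg_nonpos) auto
  finally have "lr_statistic f n x \<theta> \<le> 0" by (simp add: lr_statistic_def)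
  moreover have "lr_statistic f n x 0 \<le> lr_statistic f n x \<theta>" using m(3)[of 0] by simp
  ultimately show ?thesis by (simp add: lr_statistic_def)
qed

text \<open>The log-likelihood ratio has a positive slope at 0, hence is positive at some small \<open>t\<close>, whereas it is 0
at \<open>\<theta> = 0\<close>.\<close>

lemma mle_pos:
  assumes f: "\<And>x. 0 \<le> f x" and mle: "is_mixture_mle f n x \<theta>" and S: "real n < (\<Sum>j<n. normal_ratio f (x j))"
  shows "0 < \<theta>"
proof (rule ccontr)
  note m = mle_maximizes_lr[OF f mle]
  let ?y = "\<lambda>j. normal_ratio f (x j)"
  assume "\<not> 0 < \<theta>"
  then have "\<theta> = 0" using m(1) by simp
  define D Q where "D = (\<Sum>j<n. ?y j - 1)" and "Q = (\<Sum>j<n. (?y j - 1)\<^sup>2)"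
  have D: "0 < D" using S by (simp add: D_def sum_subtractf)
  have Q: "0 \<le> Q" by (simp add: Q_def sum_nonneg)
  \<comment> \<open>The quadratic loss \<open>2 t\<^sup>2 Q\<close> stays below the linear gain \<open>t D\<close>.\<close>
  define t where "t = min (1 / 2) (D / (4 * Q + 1))"
  have t: "0 < t" "t \<le> 1 / 2" using D Q by (auto simp: t_def min_def)
  have y: "- 1 \<le> ?y j - 1" for j
    using f[of "x j"] normal_density_pos[of 1 0 "x j"] by simp
  have ty: "- (1 / 2) \<le> t * (?y j - 1)" for j
    using mult_left_mono[OF y[of j], of t] t by linarith
  have "t * (4 * Q + 1) \<le> D"
  proof -
    have "t * (4 * Q + 1) \<le> D / (4 * Q + 1) * (4 * Q + 1)"
      using Q by (intro mult_right_mono) (auto simp: t_def)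
    then show ?thesis using Q by simp
  qed
  then have "2 * (t * Q) < D" using t Q D mult_nonneg_nonneg[of t Q] by (simp add: algebra_simps)
  then have "0 < t * (D - 2 * (t * Q))" using t by simp
  also have "\<dots> = (\<Sum>j<n. t * (?y j - 1) - 2 * (t * (?y j - 1))\<^sup>2)"
  proof -
    have "(\<Sum>j<n. t * (?y j - 1)) = t * D" by (simp only: D_def sum_distrib_left)
    moreover have "(\<Sum>j<n. 2 * (t * (?y j - 1))\<^sup>2) = 2 * (t\<^sup>2 * Q)"
      by (simp only: Q_def sum_distrib_left power_mult_distrib)
    ultimately show ?thesis
      unfolding sum_subtractf[of "\<lambda>j. t * (?y j - 1)" "\<lambda>j. 2 * (t * (?y j - 1))\<^sup>2"]
      by (simp only:) (simp add: power2_eq_square algebra_simps)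
  qed
  also have "\<dots> \<le> (\<Sum>j<n. ln (1 + t * (?y j - 1)))" by (intro sum_mono ln_one_plus_lower ty)
  finally have "0 < lr_statistic f n x t" by (simp add: lr_statistic_def)
  moreover have "lr_statistic f n x t \<le> lr_statistic f n x \<theta>"
  proof (rule m(3))
    show "t \<in> {0..1}" using t by simp
    show "0 < 1 + t * (?y j - 1)" for j using ty[of j] by linarith
  qed
  ultimately show False using \<open>\<theta> = 0\<close> by (simp add: lr_statistic_def)
qed

locale paired_jump_scales = H: one_jump_scale M "\<lambda>i \<omega>. h (X i \<omega>)" \<mu> b \<tau> + G: one_jump_scale M "\<lambda>i \<omega>. k (X i \<omega>)" \<nu> b' \<tau>
  for M :: "'a measure" and X :: "nat \<Rightarrow> 'a \<Rightarrow> real" and h k :: "real \<Rightarrow> real" and \<mu> \<nu> b b' \<tau> +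
  assumes X: "prob_space.indep_vars M (\<lambda>_. borel) X UNIV"
    and h_measurable[measurable]: "h \<in> borel_measurable borel" and k_measurable[measurable]: "k \<in> borel_measurable borel"
begin

lemma X_measurable[measurable]: "X i \<in> borel_measurable M"
  using X by (auto simp: H.indep_vars_def)

definition jump :: "nat \<Rightarrow> real set" where
  "jump n = {x. b n / 2 < h x \<or> b' n / 2 < k x}"

lemma jump_sets[measurable]: "jump n \<in> sets borel"
  unfolding jump_def by measurable

text \<open>Outside this event, either no observation jumps and neither sum exceeds \<open>n\<close>, or some observation jumps and both
samples are regular away from it.\<close>

definition exceptional :: "real \<Rightarrow> nat \<Rightarrow> 'a set" where
  "exceptional \<eta> n =
    ({\<omega> \<in> space M. (\<forall>j<n. h (X j \<omega>) \<le> b n / 2) \<and> real n < (\<Sum>j<n. h (X j \<omega>))} \<union>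
     {\<omega> \<in> space M. (\<forall>j<n. k (X j \<omega>) \<le> b' n / 2) \<and> real n < (\<Sum>j<n. k (X j \<omega>))}) \<union>
    ((\<Union>i<n. {\<omega> \<in> space M. X i \<omega> \<in> jump n \<and> \<not> H.regular_away n i (b n) \<eta> \<omega>}) \<union>
     (\<Union>i<n. {\<omega> \<in> space M. X i \<omega> \<in> jump n \<and> \<not> G.regular_away n i (b' n) \<eta> \<omega>}))"

lemma exceptional_sets[measurable]: "exceptional \<eta> n \<in> sets M"
  unfolding exceptional_def by measurable

text \<open>A jump at \<open>i\<close> has probability at most of order \<open>\<tau> / n\<close> and is independent of the irregularity of the other
observations, whose probability vanishes; summing over \<open>i\<close> gives \<open>o(\<tau>)\<close>.\<close>

lemma exceptional_negligible:
  assumes \<eta>: "0 < \<eta>"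
  shows "(\<lambda>n. H.prob (exceptional \<eta> n) / \<tau> n) \<longlonglongrightarrow> 0"
proof -
  let ?E1 = "\<lambda>n. {\<omega> \<in> space M. (\<forall>j<n. h (X j \<omega>) \<le> b n / 2) \<and> real n < (\<Sum>j<n. h (X j \<omega>))}"
  let ?E2 = "\<lambda>n. {\<omega> \<in> space M. (\<forall>j<n. k (X j \<omega>) \<le> b' n / 2) \<and> real n < (\<Sum>j<n. k (X j \<omega>))}"
  let ?B1 = "\<lambda>n i. {\<omega> \<in> space M. X i \<omega> \<in> jump n \<and> \<not> H.regular_away n i (b n) \<eta> \<omega>}"
  let ?B2 = "\<lambda>n i. {\<omega> \<in> space M. X i \<omega> \<in> jump n \<and> \<not> G.regular_away n i (b' n) \<eta> \<omega>}"
  let ?U = "\<lambda>n. (?E1 n \<union> ?E2 n) \<union> ((\<Union>i<n. ?B1 n i) \<union> (\<Union>i<n. ?B2 n i))"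
  obtain \<delta>1 where \<delta>1: "\<delta>1 \<longlonglongrightarrow> 0"
    "\<forall>\<^sub>F n in sequentially. \<forall>i<n. H.prob {\<omega> \<in> space M. \<not> H.regular_away n i (b n) \<eta> \<omega>} \<le> \<delta>1 n"
    using H.prob_not_regular_away_vanishes[OF \<eta>] by blast
  obtain \<delta>2 where \<delta>2: "\<delta>2 \<longlonglongrightarrow> 0"
    "\<forall>\<^sub>F n in sequentially. \<forall>i<n. H.prob {\<omega> \<in> space M. \<not> G.regular_away n i (b' n) \<eta> \<omega>} \<le> \<delta>2 n"
    using G.prob_not_regular_away_vanishes[OF \<eta>] by blast
  obtain C1 where C1: "\<forall>\<^sub>F n in sequentially. real n * measure \<mu> {b n / 2<..} \<le> C1 * \<tau> n" using H.tail by blast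
  obtain C2 where C2: "\<forall>\<^sub>F n in sequentially. real n * measure \<nu> {b' n / 2<..} \<le> C2 * \<tau> n" using G.tail by blast
  have B1: "H.prob (?B1 n i) = H.prob {\<omega> \<in> space M. X i \<omega> \<in> jump n} * H.prob {\<omega> \<in> space M. \<not> H.regular_away n i (b n) \<eta> \<omega>}"
    for n i
    using H.prob_one_coordinate_and_rest[OF X, of "{..<n} - {i}" i "\<lambda>x. h x - 1" "\<lambda>x. (h x - 1)\<^sup>2" "jump n"
        "\<lambda>p. \<not> (\<bar>fst p + b n\<bar> \<le> \<eta> * b n \<and> snd p \<le> \<eta> * (b n)\<^sup>2)"]
    by (simp add: H.regular_away_def del: not_le de_Morgan_conj)
  have B2: "H.prob (?B2 n i) = H.prob {\<omega> \<in> space M. X i \<omega> \<in> jump n} * H.prob {\<omega> \<in> space M. \<not> G.regular_away n i (b' n) \<eta> \<omega>}"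
    for n i
    using H.prob_one_coordinate_and_rest[OF X, of "{..<n} - {i}" i "\<lambda>x. k x - 1" "\<lambda>x. (k x - 1)\<^sup>2" "jump n"
        "\<lambda>p. \<not> (\<bar>fst p + b' n\<bar> \<le> \<eta> * b' n \<and> snd p \<le> \<eta> * (b' n)\<^sup>2)"]
    by (simp add: G.regular_away_def del: not_le de_Morgan_conj)
  have PA: "H.prob {\<omega> \<in> space M. X i \<omega> \<in> jump n} \<le> measure \<mu> {b n / 2<..} + measure \<nu> {b' n / 2<..}"
    for n i
  proof -
    have "H.prob {\<omega> \<in> space M. X i \<omega> \<in> jump n}
        = H.prob ({\<omega> \<in> space M. h (X i \<omega>) \<in> {b n / 2<..}} \<union> {\<omega> \<in> space M. k (X i \<omega>) \<in> {b' n / 2<..}})"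
      by (intro arg_cong[where f = H.prob]) (auto simp: jump_def)
    also have "\<dots> \<le> H.prob {\<omega> \<in> space M. h (X i \<omega>) \<in> {b n / 2<..}} + H.prob {\<omega> \<in> space M. k (X i \<omega>) \<in> {b' n / 2<..}}"
      by (rule measure_Un_le) measurable
    also have "\<dots> = measure \<mu> {b n / 2<..} + measure \<nu> {b' n / 2<..}"
      using H.prob_G[of "{b n / 2<..}" i] G.prob_G[of "{b' n / 2<..}" i] by simp
    finally show ?thesis .
  qed
  let ?g = "\<lambda>n. (H.prob (?E1 n) / \<tau> n + H.prob (?E2 n) / \<tau> n) + (C1 + C2) * (\<delta>1 n + \<delta>2 n)"
  have upper: "\<forall>\<^sub>F n in sequentially. H.prob (?U n) / \<tau> n \<le> ?g n"
    using \<delta>1(2) \<delta>2(2) C1 C2 H.\<tau>_pos eventually_gt_at_top[of 0]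
  proof eventually_elim
    case (elim n)
    let ?p = "measure \<mu> {b n / 2<..} + measure \<nu> {b' n / 2<..}"
    have \<delta>0: "0 \<le> \<delta>1 n" "0 \<le> \<delta>2 n"
      using order_trans[OF measure_nonneg elim(1)[rule_format, OF elim(6)]]
        order_trans[OF measure_nonneg elim(2)[rule_format, OF elim(6)]] by simp_all
    have B1_sum: "H.prob (\<Union>i<n. ?B1 n i) \<le> (\<Sum>i<n. ?p * \<delta>1 n)"
    proof -
      have "H.prob (\<Union>i<n. ?B1 n i) \<le> (\<Sum>i<n. H.prob (?B1 n i))"
        by (rule H.finite_measure_subadditive_finite) auto
      also have "\<dots> \<le> (\<Sum>i<n. ?p * \<delta>1 n)"
        unfolding B1 using elim(1) by (intro sum_mono mult_mono PA add_nonneg_nonneg) auto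
      finally show ?thesis .
    qed
    have B2_sum: "H.prob (\<Union>i<n. ?B2 n i) \<le> (\<Sum>i<n. ?p * \<delta>2 n)"
    proof -
      have "H.prob (\<Union>i<n. ?B2 n i) \<le> (\<Sum>i<n. H.prob (?B2 n i))"
        by (rule H.finite_measure_subadditive_finite) auto
      also have "\<dots> \<le> (\<Sum>i<n. ?p * \<delta>2 n)"
        unfolding B2 using elim(2) by (intro sum_mono mult_mono PA add_nonneg_nonneg) auto
      finally show ?thesis .
    qed
    have "H.prob (?U n) \<le> H.prob (?E1 n \<union> ?E2 n) + H.prob ((\<Union>i<n. ?B1 n i) \<union> (\<Union>i<n. ?B2 n i))"
      by (rule measure_Un_le) measurable
    also have "\<dots> \<le> (H.prob (?E1 n) + H.prob (?E2 n)) + (H.prob (\<Union>i<n. ?B1 n i) + H.prob (\<Union>i<n. ?B2 n i))"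
      by (intro add_mono measure_Un_le) measurable
    also have "\<dots> \<le> (H.prob (?E1 n) + H.prob (?E2 n)) + ((\<Sum>i<n. ?p * \<delta>1 n) + (\<Sum>i<n. ?p * \<delta>2 n))"
      by (intro add_mono order.refl B1_sum B2_sum)
    also have "(\<Sum>i<n. ?p * \<delta>1 n) + (\<Sum>i<n. ?p * \<delta>2 n) = (real n * ?p) * (\<delta>1 n + \<delta>2 n)"
      by (simp add: algebra_simps)
    finally have "H.prob (?U n) \<le> (H.prob (?E1 n) + H.prob (?E2 n)) + (real n * ?p) * (\<delta>1 n + \<delta>2 n)" .
    moreover have "(real n * ?p) * (\<delta>1 n + \<delta>2 n) \<le> ((C1 + C2) * \<tau> n) * (\<delta>1 n + \<delta>2 n)"
    proof (rule mult_right_mono)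
      show "real n * ?p \<le> (C1 + C2) * \<tau> n" using elim(3,4) unfolding distrib_left distrib_right by linarith
    qed (use \<delta>0 in simp)
    ultimately have "H.prob (?U n) \<le> (H.prob (?E1 n) + H.prob (?E2 n)) + ((C1 + C2) * \<tau> n) * (\<delta>1 n + \<delta>2 n)"
      by linarith
    then have "H.prob (?U n) / \<tau> n
        \<le> ((H.prob (?E1 n) + H.prob (?E2 n)) + ((C1 + C2) * \<tau> n) * (\<delta>1 n + \<delta>2 n)) / \<tau> n"
      using elim(5) by (intro divide_right_mono) auto
    also have "\<dots> = ?g n"
      using elim(5) by (simp add: add_divide_distrib)
    finally show ?case .
  qed
  have g_lim: "?g \<longlonglongrightarrow> (0 + 0) + (C1 + C2) * (0 + 0)"
    by (intro tendsto_intros H.no_jump_negligible G.no_jump_negligible \<delta>1(1) \<delta>2(1))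
  have nonneg: "\<forall>\<^sub>F n in sequentially. 0 \<le> H.prob (?U n) / \<tau> n"
    using H.\<tau>_pos by eventually_elim (intro divide_nonneg_pos measure_nonneg)
  have "(\<lambda>n. H.prob (?U n) / \<tau> n) \<longlonglongrightarrow> 0"
    by (rule tendsto_sandwich[OF nonneg upper tendsto_const]) (use g_lim in simp)
  then show ?thesis unfolding exceptional_def .
qed

end

theorem mainTheorem8:
  fixes F1 F2 :: "real measure" and f1 f2 :: "real \<Rightarrow> real" and K \<epsilon> :: real
    and M :: "'a measure" and X :: "nat \<Rightarrow> 'a \<Rightarrow> real"
    and \<theta>1 \<theta>2 :: "nat \<Rightarrow> 'a \<Rightarrow> real"
  assumes sym: "symmetric_distribution F1" "symmetric_distribution F2"
    and dens: "has_bounded_continuous_density F1 f1" "has_bounded_continuous_density F2 f2"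
    and ratio: "((\<lambda>x. f1 x / f2 x) \<longlongrightarrow> K) at_top" "K \<noteq> 0"
    and prob: "prob_space M"
    and indep: "prob_space.indep_vars M (\<lambda>_. borel) X UNIV"
    and normal: "\<And>i. distributed M lborel (X i) std_normal_density"
    and attraction: "cauchy_domain_of_attraction (distr M borel (\<lambda>\<omega>. normal_ratio f1 (X 0 \<omega>)))"
    and meas: "\<And>n. \<theta>1 n \<in> borel_measurable M" "\<And>n. \<theta>2 n \<in> borel_measurable M"
    and mle1: "\<And>n \<omega>. \<omega> \<in> space M \<Longrightarrow> is_mixture_mle f1 n (\<lambda>i. X i \<omega>) (\<theta>1 n \<omega>)"
    and mle2: "\<And>n \<omega>. \<omega> \<in> space M \<Longrightarrow> is_mixture_mle f2 n (\<lambda>i. X i \<omega>) (\<theta>2 n \<omega>)"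
    and eps: "0 < \<epsilon>"
  shows "(\<lambda>n. \<P>(\<omega> in M.
            \<epsilon> < \<bar>lr_statistic f1 n (\<lambda>i. X i \<omega>) (\<theta>1 n \<omega>) - lr_statistic f2 n (\<lambda>i. X i \<omega>) (\<theta>2 n \<omega>)\<bar>
            \<bar> 0 < \<theta>1 n \<omega>)) \<longlonglongrightarrow> 0"
proof -
  interpret prob_space M by (rule prob)
  let ?h = "normal_ratio f1" and ?k = "normal_ratio f2" and ?N = "density lborel std_normal_density"
  have f: "0 \<le> f1 x" "0 \<le> f2 x" for x
    using dens by (auto simp: has_bounded_continuous_density_def)
  have F: "real_distribution F1" "real_distribution F2"
    using sym by (auto simp: symmetric_distribution_def)
  note h = normal_ratio_properties[OF F(1) dens(1)] and k = normal_ratio_properties[OF F(2) dens(2)]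
  have hk_meas[measurable]: "?h \<in> borel_measurable borel" "?k \<in> borel_measurable borel"
    using h(1) k(1) by (auto intro: borel_measurable_continuous_onI)
  have K: "0 < K" using f ratio by (rule ratio_limit_positive)
  have "std_normal_density (- x) = std_normal_density x" for x by (simp add: std_normal_density_def)
  then have even: "?h (- x) = ?h x" "?k (- x) = ?k x" for x
    using symmetric_density_even[OF sym(1) dens(1)] symmetric_density_even[OF sym(2) dens(2)] by simp_all
  have close: "\<exists>r. \<forall>x. r \<le> ?h x \<or> r \<le> K * ?k x \<longrightarrow> \<bar>K * ?k x - ?h x\<bar> \<le> \<kappa> * ?h x" if "0 < \<kappa>" for \<kappa>
    using h(2) k(2) h(1) k(1) even ratio(1) K that by (rule normal_ratios_close_when_large)

  have X_meas[measurable]: "X i \<in> borel_measurable M" for i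
    using indep by (auto simp: indep_vars_def)
  have X_law: "distr M borel (X i) = ?N" for i
  proof -
    have "distr M borel (X i) = distr M lborel (X i)" by (rule distr_cong) auto
    then show ?thesis using distributed_distr_eq_density[OF normal] by simp
  qed
  have sN: "sets ?N = sets borel" by simp
  have pN: "prob_space ?N" by (rule prob_space_normal_density) simp
  have law: "distr M borel (\<lambda>\<omega>. g (X i \<omega>)) = distr ?N borel g" if "g \<in> borel_measurable borel" for g :: "real \<Rightarrow> real" and i
    unfolding X_law[of i, symmetric] using that by (subst distr_distr) (auto simp: comp_def)
  let ?\<mu> = "distr ?N borel ?h"
  have doa: "cauchy_domain_of_attraction ?\<mu>" using attraction law[OF hk_meas(1)] by simp
  have int\<mu>: "integrable ?\<mu> (\<lambda>x. x)" using h(3) by (subst integrable_distr_eq) auto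
  have mean\<mu>: "(\<integral>x. x \<partial>?\<mu>) = 1" using h(4) by (subst integral_distr) auto

  obtain b \<tau> :: "nat \<Rightarrow> real" where scale: "jump_scale ?\<mu> b \<tau>"
    and b_eq: "\<forall>n. real n * (\<integral>x. max 0 (x - b n) \<partial>?\<mu>) = b n"
    and lower: "\<exists>c>0. \<forall>\<^sub>F n in sequentially. c * \<tau> n \<le> real n * measure ?\<mu> {4 * b n<..}"
    and T4: "\<exists>C. \<forall>\<^sub>F n in sequentially. real n * measure ?\<mu> {b n / 4<..} \<le> C * \<tau> n"
    and n_le: "\<exists>C. \<forall>\<^sub>F n in sequentially. real n \<le> C * (b n)\<^sup>2 * \<tau> n"
    using cauchy_jump_scale[OF doa int\<mu> mean\<mu>] by blast
  have scale2: "jump_scale (distr ?N borel ?k) (\<lambda>n. b n / K) \<tau>"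
    using pN sN hk_meas h(2) k(2) h(3) k(3,4) K close scale b_eq T4 n_le by (rule jump_scale_transfer)
  have iid: "iid_nonneg M (\<lambda>i \<omega>. g (X i \<omega>)) (distr ?N borel g)"
    if g: "g \<in> borel_measurable borel" "\<And>x. 0 \<le> g x" for g :: "real \<Rightarrow> real"
  proof (intro iid_nonneg.intro iid_nonneg_axioms.intro)
    show "indep_vars (\<lambda>_. borel) (\<lambda>i \<omega>. g (X i \<omega>)) UNIV"
      by (rule indep_vars_compose2[OF indep]) (rule g(1))
    show "distr M borel (\<lambda>\<omega>. g (X i \<omega>)) = distr ?N borel g" for i by (rule law[OF g(1)])
  qed (use prob g(2) in auto)
  interpret P: paired_jump_scales M X ?h ?k ?\<mu> "distr ?N borel ?k" b "\<lambda>n. b n / K" \<tau>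
    by (intro paired_jump_scales.intro paired_jump_scales_axioms.intro one_jump_scale.intro
        iid scale scale2 hk_meas h(2) k(2) indep)

  define \<eta> \<kappa> where "\<eta> = min (1 / 100) (\<epsilon> / 160)" and "\<kappa> = min 1 (\<epsilon> / 8)"
  have \<eta>: "0 < \<eta>" "\<eta> \<le> 1 / 100" and \<kappa>: "0 < \<kappa>" "\<kappa> \<le> 1" and small: "2 * \<kappa> + 40 * \<eta> \<le> \<epsilon>"
    using eps by (auto simp: \<eta>_def \<kappa>_def)
  obtain r where r: "\<And>x. r \<le> ?h x \<or> r \<le> K * ?k x \<Longrightarrow> 1 \<le> ?h x \<and> 1 \<le> ?k x \<and>
    ?h x - 1 \<le> (1 + \<kappa>) * (K * ?k x - K) \<and> K * ?k x - K \<le> (1 + \<kappa>) * (?h x - 1)"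
    using excesses_comparable[OF close h(2) K \<kappa>] by blast
  define far where "far n \<omega> \<longleftrightarrow> \<epsilon> < \<bar>lr_statistic f1 n (\<lambda>i. X i \<omega>) (\<theta>1 n \<omega>) - lr_statistic f2 n (\<lambda>i. X i \<omega>) (\<theta>2 n \<omega>)\<bar>"
    for n \<omega>
  \<comment> \<open>The whole event is covered, for any choice of the maximizers; conditioning then costs a division by \<open>P(\<theta>1 > 0)\<close>.\<close>
  have cover: "\<forall>\<^sub>F n in sequentially. {\<omega> \<in> space M. far n \<omega>} \<subseteq> P.exceptional \<eta> n"
    using P.H.b_eventually_gt[of "max 4 (2 * r)"] P.G.b_eventually_gt[of 4]
  proof eventually_elim
    case (elim n)
    then have b4: "4 \<le> b n" "2 * r < b n" "4 \<le> b n / K" by simp_all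
    show ?case
    proof (rule subsetI, rule ccontr)
      fix \<omega> assume "\<omega> \<in> {\<omega> \<in> space M. far n \<omega>}" and out: "\<omega> \<notin> P.exceptional \<eta> n"
      then have \<omega>: "\<omega> \<in> space M" "far n \<omega>" by auto
      show False
      proof (cases "\<exists>i<n. X i \<omega> \<in> P.jump n")
        case True
        then obtain i where i: "i < n" "X i \<omega> \<in> P.jump n" by blast
        then have reg: "P.H.regular_away n i (b n) \<eta> \<omega>" "P.G.regular_away n i (b n / K) \<eta> \<omega>"
          using out \<omega>(1) unfolding P.exceptional_def by (blast+)
        from i(2) have "b n / 2 < ?h (X i \<omega>) \<or> b n / K / 2 < ?k (X i \<omega>)"
          unfolding P.jump_def by blast
        then have "r \<le> ?h (X i \<omega>) \<or> r \<le> K * ?k (X i \<omega>)"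
        proof
          assume "b n / K / 2 < ?k (X i \<omega>)"
          then have "K * (b n / K / 2) < K * ?k (X i \<omega>)" using K by (rule mult_strict_left_mono)
          moreover have "K * (b n / K / 2) = b n / 2" using K by simp
          ultimately show ?thesis using b4(2) by linarith
        qed (use b4(2) in linarith)
        note c = r[OF this]
        have js1: "jump_sample (\<lambda>j. ?h (X j \<omega>)) n i (b n) \<eta>"
        proof (rule jump_sample.intro)
          show "0 \<le> ?h (X j \<omega>)" for j by (rule h(2))
          show "i < n" by (rule i(1))
          show "1 \<le> ?h (X i \<omega>)" by (rule c[THEN conjunct1])
          show "4 \<le> b n" by (rule b4(1))
          show "\<eta> \<le> 1 / 100" by (rule \<eta>(2))
        qed (use reg(1) in \<open>simp_all only: P.H.regular_away_def\<close>)
        have js2: "jump_sample (\<lambda>j. ?k (X j \<omega>)) n i (b n / K) \<eta>"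
        proof (rule jump_sample.intro)
          show "0 \<le> ?k (X j \<omega>)" for j by (rule k(2))
          show "i < n" by (rule i(1))
          show "1 \<le> ?k (X i \<omega>)" by (rule c[THEN conjunct2, THEN conjunct1])
          show "4 \<le> b n / K" by (rule b4(3))
          show "\<eta> \<le> 1 / 100" by (rule \<eta>(2))
        qed (use reg(2) in \<open>simp_all only: P.G.regular_away_def\<close>)
        have "\<bar>lr_statistic f1 n (\<lambda>i. X i \<omega>) (\<theta>1 n \<omega>) - lr_statistic f2 n (\<lambda>i. X i \<omega>) (\<theta>2 n \<omega>)\<bar>
            \<le> 2 * \<kappa> + 40 * \<eta>"
          by (rule lr_statistics_close[OF f mle1[OF \<omega>(1)] mle2[OF \<omega>(1)] js1 js2 K less_imp_le[OF \<kappa>(1)]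
              c[THEN conjunct2, THEN conjunct2, THEN conjunct1] c[THEN conjunct2, THEN conjunct2, THEN conjunct2]])
        then show False using \<omega>(2) small by (simp add: far_def)
      next
        case False
        have "\<not> (b n / 2 < ?h (X j \<omega>) \<or> b n / K / 2 < ?k (X j \<omega>))" if "j < n" for j
          using False that unfolding P.jump_def by blast
        then have "\<forall>j<n. ?h (X j \<omega>) \<le> b n / 2" "\<forall>j<n. ?k (X j \<omega>) \<le> b n / K / 2"
          unfolding de_Morgan_disj not_less by (blast+)
        then have S: "(\<Sum>j<n. ?h (X j \<omega>)) \<le> real n" "(\<Sum>j<n. ?k (X j \<omega>)) \<le> real n"
          using out \<omega>(1) unfolding P.exceptional_def not_less[symmetric] by (blast+)
        have "lr_statistic f1 n (\<lambda>i. X i \<omega>) (\<theta>1 n \<omega>) = 0"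
          by (rule lr_statistic_zero[OF f(1) mle1[OF \<omega>(1)] S(1)])
        moreover have "lr_statistic f2 n (\<lambda>i. X i \<omega>) (\<theta>2 n \<omega>) = 0"
          by (rule lr_statistic_zero[OF f(2) mle2[OF \<omega>(1)] S(2)])
        ultimately show False using \<omega>(2) eps by (simp add: far_def)
      qed
    qed
  qed

  obtain c where c: "0 < c" "\<forall>\<^sub>F n in sequentially. c * \<tau> n \<le> prob {\<omega> \<in> space M. real n < (\<Sum>j<n. ?h (X j \<omega>))}"
    using P.H.prob_sum_exceeds_lower[OF lower] by blast
  have pos_lower: "\<forall>\<^sub>F n in sequentially. c * \<tau> n \<le> prob {\<omega> \<in> space M. 0 < \<theta>1 n \<omega>}"
    using c(2)
  proof eventually_elim
    case (elim n)
    have "prob {\<omega> \<in> space M. real n < (\<Sum>j<n. ?h (X j \<omega>))} \<le> prob {\<omega> \<in> space M. 0 < \<theta>1 n \<omega>}"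
    proof (rule finite_measure_mono)
      show "{\<omega> \<in> space M. real n < (\<Sum>j<n. ?h (X j \<omega>))} \<subseteq> {\<omega> \<in> space M. 0 < \<theta>1 n \<omega>}"
        using mle_pos[OF f(1) mle1] by auto
      show "{\<omega> \<in> space M. 0 < \<theta>1 n \<omega>} \<in> sets M" using meas(1)[of n] by measurable
    qed
    with elim show ?case by linarith
  qed
  have "(\<lambda>n. \<P>(\<omega> in M. far n \<omega> \<bar> 0 < \<theta>1 n \<omega>)) \<longlonglongrightarrow> 0"
  proof (rule tendsto_sandwich)
    show "\<forall>\<^sub>F n in sequentially. 0 \<le> \<P>(\<omega> in M. far n \<omega> \<bar> 0 < \<theta>1 n \<omega>)"
      by (simp add: cond_prob_def)
    show "\<forall>\<^sub>F n in sequentially. \<P>(\<omega> in M. far n \<omega> \<bar> 0 < \<theta>1 n \<omega>) \<le> 1 / c * (prob (P.exceptional \<eta> n) / \<tau> n)"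
      using cover pos_lower P.H.\<tau>_pos
    proof eventually_elim
      case (elim n)
      have "prob {\<omega> \<in> space M. far n \<omega> \<and> 0 < \<theta>1 n \<omega>} \<le> prob (P.exceptional \<eta> n)"
      proof (rule finite_measure_mono)
        show "{\<omega> \<in> space M. far n \<omega> \<and> 0 < \<theta>1 n \<omega>} \<subseteq> P.exceptional \<eta> n" using elim(1) by blast
      qed (rule P.exceptional_sets)
      then have "\<P>(\<omega> in M. far n \<omega> \<bar> 0 < \<theta>1 n \<omega>) \<le> prob (P.exceptional \<eta> n) / (c * \<tau> n)"
        unfolding cond_prob_def using elim(2,3) c(1) by (intro frac_le) auto
      also have "\<dots> = 1 / c * (prob (P.exceptional \<eta> n) / \<tau> n)" by simp
      finally show ?case .
    qed
    show "(\<lambda>n. 1 / c * (prob (P.exceptional \<eta> n) / \<tau> n)) \<longlonglongrightarrow> 0" using tendsto_mult_left[OF P.exceptional_negligible[OF \<eta>(1)], of "1 / c"] by simp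
  qed simp
  then show ?thesis by (simp only: far_def)
qed

end
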